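(* Let $r=\frac{\sqrt5-1}{2}$, $0<p_0<1/2<p_1$ with $p_0+p_1=1$, and let $\mu=\mu(p_0,p_1)$ and $\nu=\nu(p_0,p_1)$ be the self-similar probability measures on $[0,1]$ determined by $\mu=p_0\,\mu\circ S_0^{-1}+p_1\,\mu\circ S_1^{-1}$ and $\nu=p_0\,\nu\circ S_0^{-1}+p_1\,\nu\circ R_1^{-1}$, where $S_0(x)=rx$, $S_1(x)=rx+1-r$, $R_1(x)=1-rx$. Then there are real numbers $a\le b$ and $A\le B$ (depending on $p_0$) such that $$\{\dim_{loc}\mu(x):x\in[0,1]\}=[a,b]\cup\left\{\frac{\log p_0}{\log r}\right\},\qquad \{\dim_{loc}\nu(x):x\in[0,1]\}=[A,B]\cup\left\{\frac{\log p_0}{\log r}\right\},$$ where, with $s=\frac12-\frac{\sqrt{6\sqrt{13}-21}}{6}$ (which satisfies $1/3<s<r^2$): For $\mu$: $b=\frac{\log(p_0p_1)}{2\log r}$ for all $0<p_0<1/2$, and - if $0<p_0\le1/3$, then $a=\frac{\log p_1}{\log r}$; - if $1/3<p_0\le s$, then $\frac{\log(2p_0p_1)}{2\log r}\le a<\frac{\log p_1}{\log r}$; - if $s<p_0<1/2$, then $\frac{\log(2p_0p_1)}{2\log r}\le a\le\frac{\log\left[\frac{p_0p_1}{2}\left(1-p_0p_1+\sqrt{(1+p_0p_1)(1-3p_0p_1)}\right)\right]}{4\log r}$. For $\nu$: - if $0<p_0\le r^2$, then $A=\frac{\log p_1}{\log r}$ and $\frac{\log(p_0p_1/r)}{2\log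 r}\le B\le\frac{\log p_0}{2\log r}$; - if $r^2<p_0<1/2$, then $\frac{\log p_0}{2\log r}\le A\le\frac{\log(p_0p_1/r)}{2\log r}$ and $B=\frac{\log p_1}{\log r}$. In particular: (1) $B<b$ and $a<b$. (2) If $1/3<p_0\le r^2$, then $a<A$; if $p_0\le1/3$, then $a=A$. (3) If $p_0\ne r^2$, then $A<B$. (4) If $p_0=r^2$, then $A=B=1$ and $\{\dim_{loc}\nu(x):x\in[0,1]\}=\{1,2\}$. Moreover, in this case $\nu$ is absolutely continuous with respect to Lebesgue measure, with density function $$f(x)=\begin{cases}\frac{2x}{r}&\text{if }0\le x\le r,\\ \frac{2(1-x)}{r^2}&\text{if }r\le x\le1.\end{cases}$$
   Context: For a Borel probability measure $\mu$ and $x\in\operatorname{supp}\mu$, the local dimension is $\dim_{loc}\mu(x)=\lim_{t\to0^+}\frac{\log\mu([x-t,x+t])}{\log t}$ when the limit exists; the set $\{\dim_{loc}\mu(x):x\in[0,1]\}$ is the set of values attained at those points $x$ where the limit exists. The number $r$ is the inverse of the golden mean and satisfies $r^2+r-1=0$. Both measures $\mu$ and $\nu$ have support $[0,1]$, which is the self-similar set of each of the iterated function systems $\{S_0,S_1\}$ and $\{S_0,R_1\}$. *)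

theory Defs
  imports "HOL-Analysis.Analysis" "HOL-Probability.Probability"
begin

definition r_gold :: real where
  "r_gold = (sqrt 5 - 1) / 2"

definition S0 :: "real \<Rightarrow> real" where
  "S0 x = r_gold * x"

definition S1 :: "real \<Rightarrow> real" where
  "S1 x = r_gold * x + 1 - r_gold"

definition R1 :: "real \<Rightarrow> real" where
  "R1 x = 1 - r_gold * x"

text \<open>
  For contractions \<open>f\<close>, \<open>g\<close> mapping the unit interval into itself and weights \<open>p\<close>, \<open>q\<close> with
  \<open>p + q = 1\<close> (both nonnegative), the following predicate holds of exactly one measure on the real line.
\<close>

definition self_similar ::
    "real \<Rightarrow> (real \<Rightarrow> real) \<Rightarrow> real \<Rightarrow> (real \<Rightarrow> real) \<Rightarrow> real measure \<Rightarrow> bool" where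
  "self_similar p f q g M \<longleftrightarrow>
     prob_space M \<and> sets M = sets borel \<and> measure M {0..1} = 1 \<and>
     (\<forall>E\<in>sets borel. measure M E = p * measure M (f -` E) + q * measure M (g -` E))"

text \<open>Local dimensions are finite limits, considered only at points of the support.\<close>

definition supp :: "real measure \<Rightarrow> real set" where
  "supp M = {x. \<forall>U. open U \<longrightarrow> x \<in> U \<longrightarrow> measure M U > 0}"

definition has_local_dim :: "real measure \<Rightarrow> real \<Rightarrow> real \<Rightarrow> bool" where
  "has_local_dim M x d \<longleftrightarrow>
     x \<in> supp M \<and> ((\<lambda>t. ln (measure M {x - t..x + t}) / ln t) \<longlongrightarrow> d) (at_right 0)"

definition local_dims :: "real measure \<Rightarrow> real set" where
  "local_dims M = {d. \<exists>x\<in>{0..1}. has_local_dim M x d}"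

definition s_crit :: real where
  "s_crit = 1 / 2 - sqrt (6 * sqrt 13 - 21) / 6"

definition nu_density :: "real \<Rightarrow> real" where
  "nu_density x =
     (if 0 \<le> x \<and> x \<le> r_gold then 2 * x / r_gold
      else if r_gold \<le> x \<and> x \<le> 1 then 2 * (1 - x) / r_gold\<^sup>2
      else 0)"

end

theory Submission
  imports Defs
begin

text \<open>
  The two systems overlap, but because $r^2 + r = 1$ the overlaps are exact, and a pair of
  masses obeys a recursion without overlaps. For \<open>\<mu>\<close> the pair is the mass of an
  interval in $[0,r]$ together with that of its translate by $r^2$; for \<open>\<nu>\<close> it
  is the mass of the interval together with that of its mirror image in $[0,r]$. Cut $[0,r]$
  into the three tiles $[0,r^3]$, $[r^3,r^2]$, $[r^2,r]$, which are scaled copies of $[0,r]$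
  with ratios $r^2, r^3, r^2$. Passing to a tile multiplies the pair of masses by one of three
  nonnegative $2 \times 2$ matrices \<open>K Lo\<close>, \<open>K Mid\<close>, \<open>K
  Hi\<close>, so the mass of the tile of a word \<open>w\<close> is governed by the matrix
  product along \<open>w\<close>, and local dimensions are growth rates of such products divided
  by \<open>ln r\<close>.

  Let \<open>G w\<close> be the logarithm of the entry sum of the product along
  \<open>w\<close>. It is subadditive, and because \<open>K Mid\<close> is strictly positive it
  is superadditive up to a constant across a letter \<open>Mid\<close>. Hence there are an
  extreme upper and an extreme lower growth rate \<open>gmax\<close> and \<open>gmin\<close>,
  both uniform over all words, and every rate \<open>g\<close> between them is realised by a
  greedy concatenation: append a block of rate almost \<open>gmax\<close> or almost
  \<open>gmin\<close>, according to whether the rate so far is too low or too high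
  (\<open>slope_attained\<close>). Since every block begins with \<open>Mid\<close>, the coded
  point stays away from the ends of its tiles, so its balls are comparable with tiles and the
  local dimension exists (\<open>slope_realised\<close>). Conversely, two tiles cover an
  interval of their size (\<open>two_tile_cover\<close>), which gives the upper mass bound, and
  a ball around a point of $(0,1)$ contains a tile of comparable size, which gives the lower one
  with a constant depending on the point. So the dimensions attained in $(0,1)$ fill the
  interval from \<open>gmax / ln r\<close> to \<open>gmin / ln r\<close>, and at the two end
  points exact scaling gives the dimension (\<open>local_dims_interval\<close>).

  It remains to estimate \<open>gmax\<close> and \<open>gmin\<close>. A positive vector that no
  matrix stretches by more than \<open>exp (g * len l)\<close> bounds \<open>gmax\<close> from
  above, a nonnegative vector that every matrix stretches by at least that much bounds
  \<open>gmin\<close> from below, and a periodic word bounds \<open>gmax\<close> from below and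
  \<open>gmin\<close> from above through the eigenvalue of its product. All the constants of the
  theorem arise from such vectors and from the words \<open>Lo\<close>, \<open>Hi\<close>,
  \<open>Lo Hi\<close> and \<open>Hi ... Hi Mid\<close>. In the critical case $p_0 = r^2$ the
  distribution function of \<open>\<nu>\<close> is the only bounded solution of its functional
  equation with values 0 below 0 and 1 above 1, because two applications of the equation
  contract the difference of two solutions; the integral of the stated density is such a
  solution.\<close>

section \<open>The golden mean\<close>

abbreviation r :: real where "r \<equiv> r_gold"

lemma r_square: "r\<^sup>2 = 1 - r"
  by (simp add: r_gold_def power2_eq_square field_simps)

lemma r_bounds: "3/5 < r" "r < 5/8"
proof -
  have "sqrt 5 > sqrt ((11/5)\<^sup>2)" "sqrt 5 < sqrt ((9/4)\<^sup>2)"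
    by (simp_all only: real_sqrt_less_iff, simp_all add: power2_eq_square)
  then show "3/5 < r" "r < 5/8" unfolding r_gold_def by simp_all
qed

lemma r_pos: "0 < r" and r_less_1: "r < 1"
  using r_bounds by linarith+

lemma r_cube: "r ^ 3 = 2 * r - 1"
  using r_square by algebra

lemma r_power_4: "r ^ 4 = 2 - 3 * r"
  using r_square by algebra

lemma ln_r_neg: "ln r < 0"
  using r_pos r_less_1 by simp

section \<open>Words and tiles\<close>

datatype letter = Lo | Mid | Hi

text \<open>The tile map of the letter \<open>l\<close> contracts by \<open>r ^ len l\<close>.\<close>

fun len :: "letter \<Rightarrow> nat" where
  "len Lo = 2" | "len Mid = 3" | "len Hi = 2"

fun T :: "letter \<Rightarrow> real \<Rightarrow> real" where
  "T Lo x = r\<^sup>2 * x"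
| "T Mid x = r ^ 3 + r ^ 3 * x"
| "T Hi x = r\<^sup>2 + r\<^sup>2 * x"

definition wlen :: "letter list \<Rightarrow> nat" where
  "wlen w = (\<Sum>l\<leftarrow>w. len l)"

abbreviation L :: "letter list \<Rightarrow> real" where
  "L w \<equiv> real (wlen w)"

lemma wlen_simps [simp]:
  "wlen [] = 0" "wlen (l # w) = len l + wlen w" "wlen (u @ v) = wlen u + wlen v"
  by (simp_all add: wlen_def)

lemma wlen_replicate [simp]: "wlen (concat (replicate k w)) = k * wlen w"
  by (induction k) auto

lemma wlen_replicate_letter [simp]: "wlen (replicate k l) = k * len l"
  by (induction k) auto

lemma wlen_pos: "w \<noteq> [] \<Longrightarrow> 0 < wlen w"
proof (induction w)
  case (Cons l w) then show ?case by (cases l) auto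
qed simp

abbreviation TW :: "letter list \<Rightarrow> real \<Rightarrow> real" where
  "TW w \<equiv> foldr T w"

lemma T_affine: "T l x = T l 0 + r ^ len l * x"
  by (cases l) auto

lemma TW_affine: "TW w x = TW w 0 + r ^ wlen w * x"
proof (induction w arbitrary: x)
  case (Cons l w)
  have "TW (l # w) x = T l 0 + r ^ len l * TW w x"
    using T_affine[of l "TW w x"] by simp
  also have "\<dots> = T l 0 + r ^ len l * (TW w 0 + r ^ wlen w * x)"
    by (subst Cons) simp
  also have "\<dots> = TW (l # w) 0 + r ^ wlen (l # w) * x"
    using T_affine[of l "TW w 0"] by (simp add: algebra_simps power_add)
  finally show ?case .
qed simp

lemma TW_mono: "x \<le> y \<Longrightarrow> TW w x \<le> TW w y"
  using TW_affine[of w x] TW_affine[of w y] r_pos by (simp add: mult_left_mono)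

lemma T_range:
  assumes "0 \<le> x" "x \<le> r" shows "0 \<le> T l x" "T l x \<le> r"
proof -
  have m: "r ^ len l * x \<le> r ^ len l * r" "0 \<le> r ^ len l * x"
    using assms r_pos by (auto intro: mult_left_mono)
  have e: "T l 0 \<ge> 0" "T l r \<le> r"
    using r_square r_cube r_power_4 r_pos r_bounds
    by (cases l; simp add: power2_eq_square power3_eq_cube power4_eq_xxxx algebra_simps)+
  show "0 \<le> T l x" "T l x \<le> r"
    using m e T_affine[of l x] T_affine[of l r] by linarith+
qed

lemma TW_range:
  assumes "0 \<le> x" "x \<le> r" shows "0 \<le> TW w x \<and> TW w x \<le> r"
  using assms by (induction w) (auto simp: T_range)

text \<open>
  The three tiles are $[0,r^3]$, $[r^3,r^2]$ and $[r^2,r]$, because $r^3+r^4=r^2$ and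
  $r^2+r^3=r$.\<close>

lemma T_ends: "T Lo 0 = 0" "T Lo r = r ^ 3" "T Mid 0 = r ^ 3" "T Mid r = r\<^sup>2"
    "T Hi 0 = r\<^sup>2" "T Hi r = r"
  using r_square r_cube r_power_4
  by (simp_all add: power2_eq_square power3_eq_cube power4_eq_xxxx algebra_simps)

lemma T_preimage:
  assumes "T l 0 \<le> x" "x \<le> T l r"
  obtains y where "x = T l y" "0 \<le> y" "y \<le> r"
proof
  define y where "y = (x - T l 0) / r ^ len l"
  have p: "r ^ len l > 0" using r_pos by simp
  have "T l y = T l 0 + r ^ len l * y" by (rule T_affine)
  then show "x = T l y" using p r_pos by (simp add: y_def)
  show "0 \<le> y" using assms p by (simp add: y_def)
  show "y \<le> r" using assms p T_affine[of l r] by (simp add: y_def divide_le_eq mult.commute)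
qed

lemma T_diff: "T l y - T l x = r ^ len l * (y - x)"
  using T_affine[of l x] T_affine[of l y] by (simp add: algebra_simps)

lemma T_cover:
  assumes "0 \<le> x" "x \<le> r"
  obtains l where "T l 0 \<le> x" "x \<le> T l r"
proof -
  consider "x \<le> r ^ 3" | "r ^ 3 \<le> x" "x \<le> r\<^sup>2" | "r\<^sup>2 \<le> x" by linarith
  then show ?thesis
  proof cases
    case 1 then show ?thesis using that[of Lo] assms unfolding T_ends by simp
  next
    case 2 then show ?thesis using that[of Mid] unfolding T_ends by simp
  next
    case 3 then show ?thesis using that[of Hi] assms unfolding T_ends by simp
  qed
qed

text \<open>
  The slack of 2 in the length is the price of the ratio $r^3$ of the middle tile. The extra
  clause for \<open>n = 0\<close> serves the induction, in which \<open>n - len l\<close> may be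
  truncated to 0.\<close>

lemma word_at:
  assumes "0 \<le> x" "x \<le> r"
  shows "\<exists>w y. x = TW w y \<and> 0 \<le> y \<and> y \<le> r \<and> n \<le> wlen w \<and> wlen w \<le> n + 2
    \<and> (n = 0 \<longrightarrow> w = [])"
  using assms
proof (induction n arbitrary: x rule: less_induct)
  case (less n)
  show ?case
  proof (cases "n = 0")
    case True
    then show ?thesis using less.prems by (intro exI[of _ "[]"] exI[of _ x]) simp
  next
    case False
    obtain l where l: "T l 0 \<le> x" "x \<le> T l r" using T_cover less.prems by blast
    obtain y where y: "x = T l y" "0 \<le> y" "y \<le> r" using T_preimage[OF l] by blast
    have ll: "0 < len l" "len l \<le> 3" by (cases l; simp)+
    obtain w z where "y = TW w z" "0 \<le> z" "z \<le> r" "n - len l \<le> wlen w" "wlen w \<le> n - len l + 2"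
        "n - len l = 0 \<Longrightarrow> w = []"
      using less.IH[of "n - len l" y] y ll False by fastforce
    then show ?thesis using y ll False
      by (intro exI[of _ "l # w"] exI[of _ z]) (cases "n \<le> len l"; auto)
  qed
qed

lemma TW_replicate_Lo: "TW (replicate k Lo) x = r ^ (2 * k) * x"
  by (induction k) (simp_all add: power_add mult.assoc power2_eq_square)

lemma TW_replicate_Hi: "TW (replicate k Hi) x = r - r ^ (2 * k) * (r - x)"
proof (induction k)
  case (Suc k)
  have "TW (replicate (Suc k) Hi) x = r\<^sup>2 + r\<^sup>2 * (r - r ^ (2 * k) * (r - x))"
    using Suc by simp
  also have "\<dots> = (r\<^sup>2 + r ^ 3) - r\<^sup>2 * r ^ (2 * k) * (r - x)"
    by (simp add: power2_eq_square power3_eq_cube algebra_simps)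
  also have "r\<^sup>2 + r ^ 3 = r" using r_square r_cube by simp
  finally show ?case by (simp add: power2_eq_square)
qed simp

section \<open>Quasi-additive functions on words\<close>

text \<open>
  The abstract setting for logarithms of norms of matrix products: concatenation can lose mass,
  but inserting the letter \<open>Mid\<close> limits the loss to a constant.\<close>

locale quasi_additive =
  fixes G :: "letter list \<Rightarrow> real"
  assumes subadditive: "G (u @ v) \<le> G u + G v"
    and superadditive: "\<exists>c. \<forall>u v. G u + G v - c \<le> G (u @ Mid # v)"
    and linear_growth: "\<exists>c. \<forall>w. \<bar>G w\<bar> \<le> c * (L w + 1)"
begin

text \<open>
  The extreme growth rates, taken as the best slopes of linear bounds. Additive constants are
  allowed, so that estimates by vectors apply directly; the two normalisation lemmas below show
  that the extreme slopes are themselves valid slopes.\<close>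

definition gmax :: real where
  "gmax = Inf {g. \<exists>C. \<forall>w. G w \<le> g * L w + C}"

definition gmin :: real where
  "gmin = Sup {g. \<exists>C. \<forall>w. g * L w - C \<le> G w}"

lemma real_le_of_multiples:
  fixes x y :: real
  assumes "\<And>k::nat. real k * x \<le> real k * y + C"
  shows "x \<le> y"
proof (rule ccontr)
  assume "\<not> x \<le> y"
  then obtain k :: nat where "C / (x - y) < k" using reals_Archimedean2 by blast
  then have "C < k * (x - y)" using \<open>\<not> x \<le> y\<close> by (simp add: divide_less_eq)
  with assms[of k] show False by (simp add: algebra_simps)
qed

lemma G_replicate_le: "G (concat (replicate k w)) \<le> real k * G w + G []"
proof (induction k)
  case (Suc k)
  then show ?case using subadditive[of w "concat (replicate k w)"] by (simp add: algebra_simps)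
qed simp

text \<open>
  Iterating superadditivity along \<open>w Mid w Mid \<dots> w\<close> removes the additive
  constant from an upper bound at the price of the length of one \<open>Mid\<close>.\<close>

lemma G_upper_normalised:
  assumes c: "\<And>u v. G u + G v - c \<le> G (u @ Mid # v)"
    and C: "\<And>w. G w \<le> g * L w + C"
  shows "G w - c \<le> g * (L w + 3)"
proof (rule real_le_of_multiples)
  fix k :: nat
  define z where "z = (\<lambda>k::nat. ((\<lambda>v. w @ Mid # v) ^^ k) w)"
  have z: "G (z k) \<ge> real (Suc k) * G w - k * c \<and> L (z k) = k * (L w + 3) + L w"
  proof (induction k)
    case (Suc k)
    have "z (Suc k) = w @ Mid # z k" by (simp add: z_def)
    then show ?case using Suc c[of w "z k"] by (simp add: algebra_simps)
  qed (simp add: z_def)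
  have "real (Suc k) * G w - k * c \<le> g * (k * (L w + 3) + L w) + C"
    using z C[of "z k"] by (metis order.trans)
  then show "real k * (G w - c) \<le> real k * (g * (L w + 3)) + (g * L w + C - G w)"
    by (simp add: algebra_simps)
qed

text \<open>
  Applied to powers of \<open>w\<close>, the constant is divided by the exponent and disappears.\<close>

lemma G_lower_normalised:
  assumes C: "\<And>w. g * L w - C \<le> G w"
  shows "g * L w \<le> G w"
proof (rule real_le_of_multiples)
  fix k :: nat
  have "g * L (concat (replicate k w)) - C \<le> real k * G w + G []"
    using C G_replicate_le order.trans by blast
  then show "real k * (g * L w) \<le> real k * G w + (G [] + C)"
    by (simp add: algebra_simps)
qed

lemma linear_bounds: "\<exists>c\<ge>0. (\<forall>w. G w \<le> c * L w + c) \<and> (\<forall>w. - c * L w - c \<le> G w)"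
proof -
  obtain c where c: "\<And>w. \<bar>G w\<bar> \<le> c * (L w + 1)" using linear_growth by blast
  have "G w \<le> c * L w + c" "- c * L w - c \<le> G w" for w
    using c[of w] by (auto simp: algebra_simps)
  moreover have "c \<ge> 0" using c[of "[]"] by simp
  ultimately show ?thesis by blast
qed

lemma slope_order:
  assumes "\<And>w. g * L w - C \<le> G w" "\<And>w. G w \<le> g' * L w + C'"
  shows "g \<le> g'"
proof (rule real_le_of_multiples)
  fix k :: nat
  have "g * L (concat (replicate k [Lo])) - C \<le> g' * L (concat (replicate k [Lo])) + C'"
    using assms order.trans by blast
  then show "real k * g \<le> real k * g' + (C + C') / 2" by (simp add: field_simps)
qed

lemma gmax_le: assumes "\<And>w. G w \<le> g * L w + C" shows "gmax \<le> g"
proof -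
  obtain c where c: "\<And>w. G w \<le> c * L w + c" "\<And>w. - c * L w - c \<le> G w" "c \<ge> 0"
    using linear_bounds by blast
  have "bdd_below {g. \<exists>C. \<forall>w. G w \<le> g * L w + C}"
    by (rule bdd_belowI[of _ "- c"]) (use slope_order[OF c(2)] in blast)
  then show ?thesis unfolding gmax_def using assms by (intro cInf_lower) blast+
qed

lemma gmin_ge: assumes "\<And>w. g * L w - C \<le> G w" shows "g \<le> gmin"
proof -
  obtain c where c: "\<And>w. G w \<le> c * L w + c" "\<And>w. - c * L w - c \<le> G w" "c \<ge> 0"
    using linear_bounds by blast
  have "bdd_above {g. \<exists>C. \<forall>w. g * L w - C \<le> G w}"
    by (rule bdd_aboveI[of _ c]) (use slope_order[OF _ c(1)] in blast)
  then show ?thesis unfolding gmin_def using assms by (intro cSup_upper) blast+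
qed

lemma gmax_greatest:
  assumes "\<And>g C. (\<And>w. G w \<le> g * L w + C) \<Longrightarrow> x \<le> g" shows "x \<le> gmax"
  unfolding gmax_def
proof (rule cInf_greatest)
  obtain c where c: "\<And>w. G w \<le> c * L w + c" "\<And>w. - c * L w - c \<le> G w" "c \<ge> 0"
    using linear_bounds by blast
  show "{g. \<exists>C. \<forall>w. G w \<le> g * L w + C} \<noteq> {}" using c by blast
qed (use assms in blast)

lemma gmin_least:
  assumes "\<And>g C. (\<And>w. g * L w - C \<le> G w) \<Longrightarrow> g \<le> x" shows "gmin \<le> x"
  unfolding gmin_def
proof (rule cSup_least)
  obtain c where c: "\<And>w. G w \<le> c * L w + c" "\<And>w. - c * L w - c \<le> G w" "c \<ge> 0"
    using linear_bounds by blast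
  show "{g. \<exists>C. \<forall>w. g * L w - C \<le> G w} \<noteq> {}" using c by blast
qed (use assms in blast)

text \<open>Powers of one word already force the slope, since their lengths are unbounded.\<close>

lemma gmax_ge_periodic:
  assumes "w \<noteq> []" "\<And>k. g * L (concat (replicate k w)) - C \<le> G (concat (replicate k w))"
  shows "g \<le> gmax"
proof (rule gmax_greatest)
  fix g' C' assume g': "\<And>w. G w \<le> g' * L w + C'"
  have "g * L w \<le> g' * L w"
  proof (rule real_le_of_multiples)
    fix k :: nat
    show "real k * (g * L w) \<le> real k * (g' * L w) + (C + C')"
      using assms(2)[of k] g'[of "concat (replicate k w)"] by (simp add: algebra_simps)
  qed
  then show "g \<le> g'" using wlen_pos[OF assms(1)] by simp
qed

lemma gmin_le_periodic:
  assumes "w \<noteq> []" "\<And>k. G (concat (replicate k w)) \<le> g * L (concat (replicate k w)) + C"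
  shows "gmin \<le> g"
proof (rule gmin_least)
  fix g' C' assume g': "\<And>w. g' * L w - C' \<le> G w"
  have "g' * L w \<le> g * L w"
  proof (rule real_le_of_multiples)
    fix k :: nat
    show "real k * (g' * L w) \<le> real k * (g * L w) + (C + C')"
      using assms(2)[of k] g'[of "concat (replicate k w)"] by (simp add: algebra_simps)
  qed
  then show "g' \<le> g" using wlen_pos[OF assms(1)] by simp
qed

lemma gmin_le_gmax: "gmin \<le> gmax"
  by (intro gmin_least gmax_greatest) (rule slope_order)

lemma G_le_gmax: "\<exists>C. \<forall>w. G w \<le> gmax * L w + C"
proof -
  obtain c where c: "\<And>u v. G u + G v - c \<le> G (u @ Mid # v)" using superadditive by blast
  have "(G w - c) / (L w + 3) \<le> gmax" for w
  proof (rule gmax_greatest)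
    fix g C assume "\<And>w. G w \<le> g * L w + C"
    then show "(G w - c) / (L w + 3) \<le> g"
      using G_upper_normalised[OF c, of g C w] by (simp add: divide_le_eq)
  qed
  then have "G w \<le> gmax * L w + (3 * gmax + c)" for w
    by (simp add: divide_le_eq algebra_simps)
  then show ?thesis by blast
qed

lemma gmin_le_G: "gmin * L w \<le> G w"
proof (cases "w = []")
  case True then show ?thesis using subadditive[of "[]" "[]"] by simp
next
  case False
  have p: "0 < wlen w" using wlen_pos[OF False] .
  have "gmin \<le> G w / L w"
  proof (rule gmin_least)
    fix g C assume "\<And>w. g * L w - C \<le> G w"
    then show "g \<le> G w / L w"
      using G_lower_normalised[of g C w] p by (simp add: le_divide_eq)
  qed
  then show ?thesis using p by (simp add: le_divide_eq)
qed

text \<open>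
  If no block rose this fast, then \<open>g - e\<close> would be an admissible slope below
  \<open>gmax\<close>. The summand 3 is the length of the letter \<open>Mid\<close> that will
  separate the block from the preceding ones.\<close>

lemma rising_block:
  assumes c: "\<And>u v. G u + G v - c \<le> G (u @ Mid # v)" and "g \<le> gmax" "0 < e"
  shows "\<exists>v. (g - e) * (L v + 3) \<le> G v - c"
proof (rule ccontr)
  assume "\<not> ?thesis"
  then have "G v \<le> (g - e) * L v + (3 * (g - e) + c)" for v
    by (auto simp: algebra_simps not_le dest!: spec[of _ v])
  then have "gmax \<le> g - e" by (rule gmax_le)
  then show False using assms by simp
qed

lemma falling_block:
  assumes "gmin \<le> g" "0 < e"
  shows "\<exists>v. G (Mid # v) \<le> (g + e) * (L v + 3)"
proof (rule ccontr)
  assume "\<not> ?thesis"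
  then have *: "(g + e) * (L v + 3) < G (Mid # v)" for v by (auto simp: not_le)
  have "(g + e) * L v - (G [Mid] - 3 * (g + e)) \<le> G v" for v
    using *[of v] subadditive[of "[Mid]" v] by (simp add: algebra_simps)
  then have "g + e \<le> gmin" by (rule gmin_ge)
  then show False using assms by simp
qed

text \<open>
  A way to pass through stages \<open>0, 1, 2, ...\<close> so slowly that the sizes
  \<open>f\<close> of the stages stay negligible compared with the number of steps.\<close>

lemma slow_index:
  fixes f :: "nat \<Rightarrow> nat"
  obtains k :: "nat \<Rightarrow> nat"
  where "\<And>i. f (k i) * k i \<le> i" "\<And>n. eventually (\<lambda>i. n \<le> k i) sequentially"
proof
  define k where "k = (\<lambda>i. GREATEST n. n \<le> i \<and> f n * n \<le> i)"
  have ex: "0 \<le> i \<and> f 0 * 0 \<le> i" for i by simp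
  show "f (k i) * k i \<le> i" for i
    using GreatestI_nat[of "\<lambda>n. n \<le> i \<and> f n * n \<le> i" 0 i] by (simp add: k_def)
  show "eventually (\<lambda>i. n \<le> k i) sequentially" for n
  proof (rule eventually_sequentiallyI)
    fix i assume "max n (f n * n) \<le> i"
    then show "n \<le> k i" unfolding k_def
      by (intro Greatest_le_nat[where b=i]) auto
  qed
qed

text \<open>
  Greedy construction. At stage \<open>n\<close> there are a block \<open>P n\<close> of rate at
  least \<open>g - 1/(n+1)\<close> and a block \<open>Q n\<close> of rate at most \<open>g +
  1/(n+1)\<close>. Let \<open>S\<close> be the excess of \<open>G\<close> over the line of slope
  \<open>g\<close>; append \<open>P\<close> when \<open>S\<close> is nonpositive and
  \<open>Q\<close> otherwise. Then \<open>S\<close> overshoots zero by at most one block and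
  moves away from zero only at the small rate \<open>1/(n+1)\<close>. Stages change so slowly
  that a single block is negligible compared with the word built so far, hence \<open>S\<close>
  is of smaller order than the length.\<close>

theorem slope_attained:
  assumes "gmin \<le> g" "g \<le> gmax"
  obtains u v :: "nat \<Rightarrow> letter list"
  where "u 0 = []" "\<And>i. u (Suc i) = u i @ Mid # v i"
    "\<And>e. 0 < e \<Longrightarrow> eventually (\<lambda>i. \<bar>G (u i) - g * L (u i)\<bar> \<le> e * L (u i)) sequentially"
    "\<And>e. 0 < e \<Longrightarrow> eventually (\<lambda>i. L (v i) + 3 \<le> e * L (u i)) sequentially"
proof -
  obtain c where c: "\<And>u v. G u + G v - c \<le> G (u @ Mid # v)" using superadditive by blast
  obtain c' where c': "\<And>w. G w \<le> c' * L w + c'" "\<And>w. - c' * L w - c' \<le> G w" "c' \<ge> 0"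
    using linear_bounds by blast
  define D where "D = 2 * c' + \<bar>c\<bar> + \<bar>g\<bar> + 1"
  have D: "D > 0" using c'(3) by (simp add: D_def)
  have "\<exists>v. (g - 1 / Suc n) * (L v + 3) \<le> G v - c" for n
    by (rule rising_block[OF c assms(2)]) simp
  then obtain P where P: "\<And>n. (g - 1 / Suc n) * (L (P n) + 3) \<le> G (P n) - c" by metis
  have "\<exists>v. G (Mid # v) \<le> (g + 1 / Suc n) * (L v + 3)" for n
    by (rule falling_block[OF assms(1)]) simp
  then obtain Q where Q: "\<And>n. G (Mid # Q n) \<le> (g + 1 / Suc n) * (L (Q n) + 3)" by metis
  obtain k where k: "\<And>i. (wlen (P (k i)) + wlen (Q (k i)) + 3) * k i \<le> i"
      "\<And>n. eventually (\<lambda>i. n \<le> k i) sequentially"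
    using slow_index[of "\<lambda>n. wlen (P n) + wlen (Q n) + 3"] by blast
  define step where "step = (\<lambda>i u. if G u \<le> g * L u then P (k i) else Q (k i))"
  define u where "u = rec_nat [] (\<lambda>i u. u @ Mid # step i u)"
  define v where "v = (\<lambda>i. step i (u i))"
  have u0: "u 0 = []" and uS: "u (Suc i) = u i @ Mid # v i" for i by (simp_all add: u_def v_def)
  define S where "S = (\<lambda>i. G (u i) - g * L (u i))"
  have L_ge: "3 * i \<le> wlen (u i)" for i by (induction i) (auto simp: u0 uS)
  have v_len: "(wlen (v i) + 3) * k i \<le> i" for i
  proof -
    have "wlen (v i) \<le> wlen (P (k i)) + wlen (Q (k i))" by (simp add: v_def step_def)
    then have "(wlen (v i) + 3) * k i \<le> (wlen (P (k i)) + wlen (Q (k i)) + 3) * k i"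
      by (intro mult_right_mono) auto
    then show ?thesis using k(1)[of i] by linarith
  qed
  have v_small: "eventually (\<lambda>i. L (v i) + 3 \<le> e * L (u i)) sequentially" if "0 < e" for e
  proof -
    obtain n :: nat where n: "1 / e < n" using reals_Archimedean2 by blast
    have n0: "n > 0" using n that by (metis less_trans of_nat_0_less_iff zero_less_divide_1_iff)
    have en: "1 < e * n" using n that by (simp add: divide_less_eq mult.commute)
    show ?thesis using k(2)[of n]
    proof eventually_elim
      case (elim i)
      have "(wlen (v i) + 3) * n \<le> wlen (u i)"
        using v_len[of i] L_ge[of i] mult_le_mono2[OF elim, of "wlen (v i) + 3"] by linarith
      then have a: "(L (v i) + 3) * n \<le> L (u i)" by (metis of_nat_le_iff of_nat_mult of_nat_add of_nat_numeral)
      have "(L (v i) + 3) \<le> (L (v i) + 3) * (e * n)"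
        using en by (intro mult_le_cancel_left1[THEN iffD2]) auto
      also have "\<dots> = e * ((L (v i) + 3) * n)" by simp
      also have "\<dots> \<le> e * L (u i)" using a that by (intro mult_left_mono) auto
      finally show ?case .
    qed
  qed
  have jump: "\<bar>S (Suc i) - S i\<bar> \<le> D * (L (v i) + 3)" for i
  proof -
    have "S (Suc i) - S i = G (u i @ Mid # v i) - G (u i) - g * (L (v i) + 3)"
      by (simp add: S_def uS algebra_simps)
    moreover have "G (u i @ Mid # v i) - G (u i) \<le> c' * (L (v i) + 3) + c'"
      using subadditive[of "u i" "Mid # v i"] c'(1)[of "Mid # v i"] by (simp add: algebra_simps)
    moreover have "- (c' * L (v i)) - c' - c \<le> G (u i @ Mid # v i) - G (u i)"
      using c[of "u i" "v i"] c'(2)[of "v i"] by simp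
    moreover have "\<bar>g * (L (v i) + 3)\<bar> = \<bar>g\<bar> * (L (v i) + 3)" by (simp add: abs_mult)
    moreover have "\<bar>c\<bar> \<le> \<bar>c\<bar> * (L (v i) + 3)" "c' \<le> c' * (L (v i) + 3)"
        "c' * L (v i) \<le> c' * (L (v i) + 3)"
      using c'(3) by (auto simp: mult_le_cancel_left1 intro!: mult_left_mono)
    moreover have "D * (L (v i) + 3)
        = 2 * (c' * (L (v i) + 3)) + \<bar>c\<bar> * (L (v i) + 3) + \<bar>g\<bar> * (L (v i) + 3) + (L (v i) + 3)"
      by (simp add: D_def algebra_simps)
    moreover have "0 \<le> L (v i)" by simp
    ultimately show ?thesis using c'(3) by linarith
  qed
  have drift: "S i \<le> 0 \<Longrightarrow> S i - 1 / Suc (k i) * (L (v i) + 3) \<le> S (Suc i)"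
      "S i > 0 \<Longrightarrow> S (Suc i) \<le> S i + 1 / Suc (k i) * (L (v i) + 3)" for i
  proof -
    assume "S i \<le> 0"
    then have v: "v i = P (k i)" by (simp add: S_def v_def step_def)
    show "S i - 1 / Suc (k i) * (L (v i) + 3) \<le> S (Suc i)"
      using c[of "u i" "v i"] P[of "k i"] unfolding S_def uS v by (simp add: algebra_simps)
  next
    assume "S i > 0"
    then have v: "v i = Q (k i)" by (simp add: S_def v_def step_def)
    show "S (Suc i) \<le> S i + 1 / Suc (k i) * (L (v i) + 3)"
      using subadditive[of "u i" "Mid # v i"] Q[of "k i"] unfolding S_def uS v
      by (simp add: algebra_simps)
  qed
  have S_small: "eventually (\<lambda>i. \<bar>S i\<bar> \<le> e * L (u i)) sequentially" if e: "0 < e" for e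
  proof -
    define d where "d = e / 2"
    have d: "d > 0" using e by (simp add: d_def)
    obtain n :: nat where n: "1 / d < n" using reals_Archimedean2 by blast
    have "eventually (\<lambda>i. n \<le> k i \<and> L (v i) + 3 \<le> d / D * L (u i)) sequentially"
      using k(2)[of n] v_small[of "d / D"] d D by (intro eventually_conj) auto
    then obtain N where N: "\<And>i. i \<ge> N \<Longrightarrow> n \<le> k i"
        "\<And>i. i \<ge> N \<Longrightarrow> L (v i) + 3 \<le> d / D * L (u i)"
      unfolding eventually_sequentially by blast
    have inc: "1 / Suc (k i) * (L (v i) + 3) \<le> d * (L (v i) + 3)" if "i \<ge> N" for i
    proof -
      have "1 / d < Suc (k i)" using n N(1)[OF that] by linarith
      then have "1 / Suc (k i) \<le> d" using d by (simp add: divide_le_eq divide_less_eq mult.commute)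
      then show ?thesis by (intro mult_right_mono) auto
    qed
    have jmp: "D * (L (v i) + 3) \<le> d * L (u i)" if "i \<ge> N" for i
      using N(2)[OF that] D by (simp add: field_simps)
    \<comment> \<open>Motion away from zero is limited by \<open>drift\<close>, and a crossing of zero by \<open>jump\<close>.\<close>
    have bound: "\<bar>S i\<bar> \<le> \<bar>S N\<bar> + d * L (u i)" if "i \<ge> N" for i
      using that
    proof (induction i rule: dec_induct)
      case base then show ?case using d by simp
    next
      case (step i)
      have L: "L (u (Suc i)) = L (u i) + (L (v i) + 3)" by (simp add: uS)
      have L': "d * L (u (Suc i)) = d * L (u i) + d * (L (v i) + 3)"
        unfolding L by (rule distrib_left)
      have nn: "0 \<le> d * (L (v i) + 3)" using d by simp
      note facts = jump[of i] drift[of i] inc[OF step.hyps(1)] jmp[OF step.hyps(1)] step.IH L' nn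
      show ?case
      proof (cases "S i \<le> 0")
        case True
        then show ?thesis using facts by linarith
      next
        case False
        then show ?thesis using facts by linarith
      qed
    qed
    obtain M :: nat where M: "\<bar>S N\<bar> / d < M" using reals_Archimedean2 by blast
    show ?thesis
    proof (rule eventually_sequentiallyI)
      fix i assume i: "max N M \<le> i"
      have "\<bar>S N\<bar> \<le> d * M" using M d by (simp add: divide_less_eq mult.commute)
      also have "\<dots> \<le> d * L (u i)"
        using d i L_ge[of i] by (intro mult_left_mono) auto
      finally show "\<bar>S i\<bar> \<le> e * L (u i)" using bound[of i] i by (simp add: d_def)
    qed
  qed
  show ?thesis
    using that[of u v] u0 uS S_small v_small unfolding S_def by blast
qed

end

section \<open>Products of nonnegative matrices\<close>

text \<open>For nonnegative matrices this is a submultiplicative norm.\<close>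

definition entry_sum :: "real^'n^'n \<Rightarrow> real" where
  "entry_sum A = (\<Sum>i\<in>UNIV. \<Sum>j\<in>UNIV. A $ i $ j)"

abbreviation nonneg :: "real^'n^'n \<Rightarrow> bool" where
  "nonneg A \<equiv> \<forall>i j. 0 \<le> A $ i $ j"

lemma nonneg_mult: "nonneg A \<Longrightarrow> nonneg B \<Longrightarrow> nonneg (A ** B)"
  by (simp add: matrix_matrix_mult_def sum_nonneg)

lemma nonneg_mat_1: "nonneg (mat 1)"
  by (simp add: mat_def)

lemma entry_sum_mult_le:
  assumes A: "nonneg A" and B: "nonneg B"
  shows "entry_sum (A ** B) \<le> entry_sum A * entry_sum B"
proof -
  have rows: "(\<Sum>j\<in>UNIV. B$k$j) \<le> entry_sum B" for k
    unfolding entry_sum_def by (rule member_le_sum[of k]) (use B in \<open>auto intro: sum_nonneg\<close>)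
  have "entry_sum (A ** B) = (\<Sum>i\<in>UNIV. \<Sum>k\<in>UNIV. \<Sum>j\<in>UNIV. A$i$k * B$k$j)"
    unfolding entry_sum_def matrix_matrix_mult_def vec_lambda_beta
    by (rule sum.cong[OF refl]) (rule sum.swap)
  also have "\<dots> \<le> (\<Sum>i\<in>UNIV. \<Sum>k\<in>UNIV. A$i$k * entry_sum B)"
    unfolding sum_distrib_left[symmetric] using A rows by (intro sum_mono mult_left_mono) auto
  finally show ?thesis by (simp add: entry_sum_def[of A] sum_distrib_right)
qed

lemma row_mult_ge:
  assumes "\<And>k. c \<le> A $ i $ k" and B: "nonneg B" and "\<And>j. m \<le> x $ j" and "0 \<le> c" "0 \<le> m"
  shows "c * m * entry_sum B \<le> ((A ** B) *v x) $ i"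
proof -
  have A: "0 \<le> A $ i $ k" for k using assms(1)[of k] \<open>0 \<le> c\<close> by simp
  have "c * m * entry_sum B = (\<Sum>k\<in>UNIV. c * (\<Sum>j\<in>UNIV. B$k$j * m))"
    by (simp add: entry_sum_def sum_distrib_left sum_distrib_right mult_ac)
  also have "\<dots> \<le> (\<Sum>k\<in>UNIV. A$i$k * (\<Sum>j\<in>UNIV. B$k$j * x$j))"
    using assms A by (intro sum_mono mult_mono mult_left_mono sum_nonneg) auto
  also have "\<dots> = (A *v (B *v x)) $ i" by (simp add: matrix_vector_mult_def)
  finally show ?thesis by (simp add: matrix_vector_mul_assoc)
qed

lemma matrix_vector_le:
  assumes A: "nonneg A" and "\<And>j. x $ j \<le> C" "0 \<le> C"
  shows "(A *v x) $ i \<le> C * entry_sum A"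
proof -
  have "(A *v x) $ i \<le> (\<Sum>j\<in>UNIV. A$i$j * C)"
    using assms by (auto simp: matrix_vector_mult_def intro!: sum_mono mult_left_mono)
  also have "\<dots> \<le> (\<Sum>i\<in>UNIV. \<Sum>j\<in>UNIV. A$i$j * C)"
    using assms by (intro member_le_sum) (auto intro: sum_nonneg)
  finally show ?thesis by (simp add: entry_sum_def sum_distrib_left mult_ac)
qed

text \<open>
  A strictly positive middle factor dominates \<open>c\<close> times the all-ones matrix, and
  inserting the latter turns the entry sum of the product into the product of the entry sums.\<close>

lemma entry_sum_sandwich:
  assumes A: "nonneg A" and B: "nonneg B" and M: "\<And>i j. c \<le> M $ i $ j" and c: "0 \<le> c"
  shows "c * entry_sum A * entry_sum B \<le> entry_sum (A ** (M ** B))"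
proof -
  have MB: "c * (\<Sum>l\<in>UNIV. B$l$j) \<le> (M ** B) $ k $ j" for k j
    using B M by (auto simp: matrix_matrix_mult_def sum_distrib_left intro!: sum_mono mult_right_mono)
  have "c * entry_sum A * entry_sum B
      = (\<Sum>i\<in>UNIV. \<Sum>k\<in>UNIV. A$i$k) * (\<Sum>j\<in>UNIV. c * (\<Sum>l\<in>UNIV. B$l$j))"
    using sum.swap[of "\<lambda>l j. B$l$j" UNIV UNIV]
    by (simp add: entry_sum_def sum_distrib_left[symmetric] mult_ac)
  also have "\<dots> = (\<Sum>i\<in>UNIV. \<Sum>j\<in>UNIV. \<Sum>k\<in>UNIV. A$i$k * (c * (\<Sum>l\<in>UNIV. B$l$j)))"
    by (simp add: sum_product) (simp add: sum_distrib_right)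
  also have "\<dots> \<le> (\<Sum>i\<in>UNIV. \<Sum>j\<in>UNIV. \<Sum>k\<in>UNIV. A$i$k * (M ** B)$k$j)"
    using A MB by (intro sum_mono mult_left_mono) auto
  finally show ?thesis by (simp add: entry_sum_def matrix_matrix_mult_def[of A])
qed

lemma row_vector_mono:
  assumes A: "nonneg A" and "\<And>i. x $ i \<le> y $ i"
  shows "(x v* A) $ j \<le> (y v* A) $ j"
  using assms by (auto simp: vector_matrix_mult_def intro!: sum_mono mult_right_mono)

lemma col_vector_mono:
  assumes A: "nonneg A" and "\<And>i. x $ i \<le> y $ i"
  shows "(A *v x) $ j \<le> (A *v y) $ j"
  using assms by (auto simp: matrix_vector_mult_def intro!: sum_mono mult_left_mono)

lemma sum_row_vector: "(\<Sum>j\<in>UNIV. (v v* A) $ j) = (\<Sum>i\<in>UNIV. v$i * (\<Sum>j\<in>UNIV. A$i$j))"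
  unfolding vector_matrix_mult_def
  by (simp add: sum_distrib_left mult.commute) (rule sum.swap)

text \<open>
  A nonzero entry in every column keeps all products nonzero, so that logarithms make sense; the
  positive matrix of \<open>Mid\<close> provides superadditivity.\<close>

locale matrix_words =
  fixes K :: "letter \<Rightarrow> real^'n^'n"
  assumes K_nonneg: "nonneg (K l)"
    and K_Mid_pos: "0 < K Mid $ i $ j"
    and K_column: "\<exists>i. 0 < K l $ i $ j"
begin

abbreviation KW :: "letter list \<Rightarrow> real^'n^'n" where
  "KW w \<equiv> foldr (\<lambda>l M. K l ** M) w (mat 1)"

definition G :: "letter list \<Rightarrow> real" where
  "G w = ln (entry_sum (KW w))"

lemma KW_append: "KW (u @ v) = KW u ** KW v"
  by (induction u) (simp_all add: matrix_mul_assoc)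

lemma KW_nonneg: "nonneg (KW w)"
  by (induction w) (simp_all add: nonneg_mat_1 nonneg_mult K_nonneg)

text \<open>
  Nonnegative matrices preserve the order of row vectors, so that an eigenvector-type inequality
  can be iterated along any concatenation of blocks that satisfy it. Blocks of one letter give
  bounds for all words, and equal blocks give bounds for periodic words.\<close>

lemma row_ge_concat:
  assumes "\<And>w j. w \<in> set ws \<Longrightarrow> exp (g * L w) * v$j \<le> (v v* KW w) $ j"
  shows "exp (g * L (concat ws)) * v$j \<le> (v v* KW (concat ws)) $ j"
  using assms
proof (induction ws arbitrary: j)
  case (Cons w ws)
  have "exp (g * L (concat (w # ws))) * v$j = exp (g * L w) * (exp (g * L (concat ws)) * v$j)"
    by (simp add: exp_add algebra_simps)
  also have "\<dots> \<le> exp (g * L w) * (v v* KW (concat ws)) $ j"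
    using Cons by (intro mult_left_mono) auto
  also have "\<dots> = ((exp (g * L w) *\<^sub>R v) v* KW (concat ws)) $ j"
    by (simp add: vector_matrix_mult_def sum_distrib_left mult_ac)
  also have "\<dots> \<le> ((v v* KW w) v* KW (concat ws)) $ j"
    using Cons.prems by (intro row_vector_mono KW_nonneg) auto
  finally show ?case by (simp add: KW_append vector_matrix_mul_assoc del: foldr_append)
qed simp

lemma row_le_concat:
  assumes "\<And>w j. w \<in> set ws \<Longrightarrow> (v v* KW w) $ j \<le> exp (g * L w) * v$j"
  shows "(v v* KW (concat ws)) $ j \<le> exp (g * L (concat ws)) * v$j"
  using assms
proof (induction ws arbitrary: j)
  case (Cons w ws)
  have "(v v* KW (concat (w # ws))) $ j = ((v v* KW w) v* KW (concat ws)) $ j"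
    by (simp add: KW_append vector_matrix_mul_assoc del: foldr_append)
  also have "\<dots> \<le> ((exp (g * L w) *\<^sub>R v) v* KW (concat ws)) $ j"
    using Cons.prems by (intro row_vector_mono KW_nonneg) auto
  also have "\<dots> = exp (g * L w) * (v v* KW (concat ws)) $ j"
    by (simp add: vector_matrix_mult_def sum_distrib_left mult_ac)
  also have "\<dots> \<le> exp (g * L w) * (exp (g * L (concat ws)) * v$j)"
    using Cons by (intro mult_left_mono) auto
  also have "\<dots> = exp (g * L (concat (w # ws))) * v$j"
    by (simp add: exp_add algebra_simps)
  finally show ?case .
qed simp

lemma concat_singletons: "concat (map (\<lambda>l. [l]) w) = w"
  by (induction w) auto

lemma row_ge_word:
  assumes "\<And>l j. exp (g * real (len l)) * v$j \<le> (v v* K l) $ j"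
  shows "exp (g * L w) * v$j \<le> (v v* KW w) $ j"
  using row_ge_concat[of "map (\<lambda>l. [l]) w" g v j] assms
  unfolding concat_singletons by fastforce

lemma row_le_word:
  assumes "\<And>l j. (v v* K l) $ j \<le> exp (g * real (len l)) * v$j"
  shows "(v v* KW w) $ j \<le> exp (g * L w) * v$j"
  using row_le_concat[of "map (\<lambda>l. [l]) w" v g j] assms
  unfolding concat_singletons by fastforce

lemma col_le:
  assumes "\<And>l i. (K l *v u) $ i \<le> exp (g * real (len l)) * u$i"
  shows "(KW w *v u) $ i \<le> exp (g * L w) * u$i"
proof (induction w arbitrary: i)
  case (Cons l w)
  have "(KW (l # w) *v u) $ i = (K l *v (KW w *v u)) $ i"
    by (simp add: matrix_vector_mul_assoc)
  also have "\<dots> \<le> (K l *v (exp (g * L w) *\<^sub>R u)) $ i"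
    using Cons by (intro col_vector_mono K_nonneg) auto
  also have "\<dots> = exp (g * L w) * (K l *v u) $ i"
    by (simp add: matrix_vector_mult_def sum_distrib_left mult_ac)
  also have "\<dots> \<le> exp (g * L w) * (exp (g * real (len l)) * u$i)"
    using assms by (intro mult_left_mono) auto
  also have "\<dots> = exp (g * L (l # w)) * u$i"
    by (simp add: exp_add algebra_simps)
  finally show ?case .
qed simp

lemma entry_sum_ge_row:
  assumes "\<And>j. c * v$j \<le> (v v* A) $ j" "nonneg A" "\<And>j. 0 \<le> v $ j" "v $ k > 0"
  shows "c * (v $ k / (\<Sum>j\<in>UNIV. v$j)) \<le> entry_sum A"
    and "(\<Sum>j\<in>UNIV. v$j) > 0"
proof -
  define V where "V = (\<Sum>j\<in>UNIV. v$j)"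
  have vV: "v $ j \<le> V" for j unfolding V_def using assms by (intro member_le_sum) auto
  then show pos: "(\<Sum>j\<in>UNIV. v$j) > 0" using assms(4) V_def by (metis less_le_trans)
  have "c * v$k \<le> (v v* A) $ k" using assms by blast
  also have "\<dots> \<le> (\<Sum>j\<in>UNIV. (v v* A) $ j)"
    using assms by (intro member_le_sum) (auto simp: vector_matrix_mult_def intro!: sum_nonneg)
  also have "\<dots> = (\<Sum>i\<in>UNIV. v$i * (\<Sum>j\<in>UNIV. A$i$j))" by (rule sum_row_vector)
  also have "\<dots> \<le> (\<Sum>i\<in>UNIV. V * (\<Sum>j\<in>UNIV. A$i$j))"
    using assms vV by (intro sum_mono mult_right_mono sum_nonneg) auto
  also have "\<dots> = V * entry_sum A" by (simp add: entry_sum_def sum_distrib_left)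
  finally show "c * (v $ k / (\<Sum>j\<in>UNIV. v$j)) \<le> entry_sum A"
    using pos unfolding V_def[symmetric] by (simp add: field_simps)
qed

text \<open>
  The row \<open>(1, ..., 1)\<close> is multiplied by at least the least column sum, so that
  entry sums decay at most exponentially.\<close>

lemma entry_sum_KW_pos: "0 < entry_sum (KW w)"
  and KW_lower: "\<exists>g. \<forall>w. exp (g * L w) / CARD('n) \<le> entry_sum (KW w)"
proof -
  define c where "c = Min (insert 1 ((\<lambda>(l, j). \<Sum>i\<in>UNIV. K l $ i $ j) ` ({Lo, Mid, Hi} \<times> UNIV)))"
  have col: "0 < (\<Sum>i\<in>UNIV. K l $ i $ j)" for l j
  proof -
    obtain i where "0 < K l $ i $ j" using K_column by blast
    also have "\<dots> \<le> (\<Sum>i\<in>UNIV. K l $ i $ j)" using K_nonneg by (intro member_le_sum) auto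
    finally show ?thesis .
  qed
  have c: "0 < c" "c \<le> 1" unfolding c_def using col by (auto simp: Min_gr_iff)
  have cl: "c \<le> (\<Sum>i\<in>UNIV. K l $ i $ j)" for l j
    unfolding c_def by (rule Min_le) (use letter.exhaust[of l] in \<open>auto simp: image_iff\<close>)
  define v :: "real^'n" where "v = (\<chi> i. 1)"
  have "exp (ln c * real (len l)) * v$j \<le> (v v* K l) $ j" for l j
  proof -
    have "ln c * real (len l) \<le> ln c" using c by (cases l) (auto simp: mult_le_cancel_left1)
    then have "exp (ln c * real (len l)) \<le> c" using c by (metis exp_le_cancel_iff exp_ln)
    also have "\<dots> \<le> (v v* K l) $ j"
      using cl[of l j] by (simp add: vector_matrix_mult_def v_def)
    finally show ?thesis by (simp add: v_def)
  qed
  then have row: "exp (ln c * L w) * v$j \<le> (v v* KW w) $ j" for w j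
    by (rule row_ge_word)
  have "exp (ln c * L w) * (v $ k / (\<Sum>j\<in>UNIV. v$j)) \<le> entry_sum (KW w)" for k w
    by (rule entry_sum_ge_row(1)[OF row KW_nonneg]) (auto simp: v_def)
  then have *: "exp (ln c * L w) / CARD('n) \<le> entry_sum (KW w)" for w by (simp add: v_def)
  then show "\<exists>g. \<forall>w. exp (g * L w) / CARD('n) \<le> entry_sum (KW w)" by blast
  have "0 < exp (ln c * L w) / CARD('n)" by simp
  then show "0 < entry_sum (KW w)" using *[of w] by linarith
qed

lemma exp_G: "exp (G w) = entry_sum (KW w)"
  by (simp add: G_def entry_sum_KW_pos)

lemma KW_Mid_lower: obtains c where "0 < c" "\<And>i j. c \<le> K Mid $ i $ j"
proof
  define c where "c = Min (range (\<lambda>(i, j). K Mid $ i $ j))"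
  show "0 < c" unfolding c_def using K_Mid_pos by (subst Min_gr_iff) auto
  show "c \<le> K Mid $ i $ j" for i j unfolding c_def by (rule Min_le) auto
qed

sublocale quasi_additive G
proof
  show sub: "G (u @ v) \<le> G u + G v" for u v
  proof -
    have "exp (G (u @ v)) \<le> exp (G u + G v)"
      unfolding exp_add exp_G KW_append by (intro entry_sum_mult_le KW_nonneg)
    then show ?thesis by simp
  qed
  show "\<exists>c. \<forall>u v. G u + G v - c \<le> G (u @ Mid # v)"
  proof -
    obtain c where c: "0 < c" "\<And>i j. c \<le> K Mid $ i $ j" using KW_Mid_lower by blast
    have "G u + G v - (- ln c) \<le> G (u @ Mid # v)" for u v
    proof -
      have "exp (G u + G v + ln c) \<le> exp (G (u @ Mid # v))"
        using entry_sum_sandwich[OF KW_nonneg[of u] KW_nonneg[of v] c(2)] c(1)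
        unfolding exp_add exp_G KW_append by (simp add: mult_ac)
      then show ?thesis by simp
    qed
    then show ?thesis by blast
  qed
  show "\<exists>c. \<forall>w. \<bar>G w\<bar> \<le> c * (L w + 1)"
  proof -
    obtain g where g: "\<And>w. exp (g * L w) / CARD('n) \<le> entry_sum (KW w)" using KW_lower by blast
    define M where "M = \<bar>G [Lo]\<bar> + \<bar>G [Mid]\<bar> + \<bar>G [Hi]\<bar>"
    have "G w \<le> M * L w + \<bar>G []\<bar>" for w
    proof (induction w)
      case (Cons l w)
      have "G [l] \<le> M" by (cases l) (auto simp: M_def)
      also have "\<dots> \<le> M * len l" by (cases l) (auto simp: M_def mult_le_cancel_left1)
      finally show ?case using sub[of "[l]" w] Cons by (simp add: algebra_simps)
    qed simp
    moreover have "g * L w - ln (CARD('n)) \<le> G w" for w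
    proof -
      have "exp (g * L w - ln (CARD('n))) \<le> exp (G w)"
        unfolding exp_diff exp_G using g[of w] by simp
      then show ?thesis by simp
    qed
    moreover have "\<bar>g * L w\<bar> = \<bar>g\<bar> * L w" for w by (simp add: abs_mult)
    ultimately have "\<bar>G w\<bar> \<le> (M + \<bar>g\<bar>) * L w + (\<bar>G []\<bar> + \<bar>ln (CARD('n))\<bar>)" for w
    proof -
      have "0 \<le> M * L w" "0 \<le> \<bar>g\<bar> * L w" by (simp_all add: M_def)
      moreover note \<open>G w \<le> M * L w + \<bar>G []\<bar>\<close> \<open>g * L w - ln (CARD('n)) \<le> G w\<close>
        \<open>\<bar>g * L w\<bar> = \<bar>g\<bar> * L w\<close>
      ultimately show ?thesis unfolding distrib_right by linarith
    qed
    moreover have "(M + \<bar>g\<bar>) * L w + (\<bar>G []\<bar> + \<bar>ln (CARD('n))\<bar>)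
        \<le> (M + \<bar>g\<bar> + \<bar>G []\<bar> + \<bar>ln (CARD('n))\<bar>) * (L w + 1)" for w
      by (simp add: algebra_simps M_def)
    ultimately show ?thesis by (meson order.trans)
  qed
qed

lemma G_le_row:
  assumes "\<And>j. 0 < v$j" "\<And>j. (v v* KW w) $ j \<le> exp (g * L w) * v$j"
  shows "G w \<le> g * L w + ln ((\<Sum>j\<in>UNIV. v$j) / Min (range (\<lambda>i. v$i)))"
proof -
  define m where "m = Min (range (\<lambda>i. v$i))"
  have m: "0 < m" "\<And>i. m \<le> v$i" unfolding m_def using assms(1) by (auto simp: Min_gr_iff)
  have V: "0 < (\<Sum>j\<in>UNIV. v$j)" using assms(1) by (intro sum_pos) auto
  have "m * entry_sum (KW w) = (\<Sum>i\<in>UNIV. m * (\<Sum>j\<in>UNIV. KW w$i$j))"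
    by (simp add: entry_sum_def sum_distrib_left)
  also have "\<dots> \<le> (\<Sum>i\<in>UNIV. v$i * (\<Sum>j\<in>UNIV. KW w$i$j))"
    using m KW_nonneg by (intro sum_mono mult_right_mono sum_nonneg) auto
  also have "\<dots> = (\<Sum>j\<in>UNIV. (v v* KW w) $ j)" by (simp add: sum_row_vector)
  also have "\<dots> \<le> (\<Sum>j\<in>UNIV. exp (g * L w) * v$j)" by (intro sum_mono assms)
  finally have "entry_sum (KW w) \<le> exp (g * L w) * ((\<Sum>j\<in>UNIV. v$j) / m)"
    using m unfolding sum_distrib_left[symmetric] by (simp add: pos_le_divide_eq mult.commute)
  also have "\<dots> = exp (g * L w + ln ((\<Sum>j\<in>UNIV. v$j) / m))"
    using V m by (simp add: exp_add)
  finally have "exp (G w) \<le> exp (g * L w + ln ((\<Sum>j\<in>UNIV. v$j) / m))" by (simp only: exp_G)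
  then show ?thesis by (simp add: m_def)
qed

lemma G_ge_row:
  assumes "\<And>j. 0 \<le> v$j" "0 < v$k" "\<And>j. exp (g * L w) * v$j \<le> (v v* KW w) $ j"
  shows "g * L w - ln ((\<Sum>j\<in>UNIV. v$j) / v$k) \<le> G w"
proof -
  have V: "0 < (\<Sum>j\<in>UNIV. v$j)"
    by (rule entry_sum_ge_row(2)[OF assms(3) KW_nonneg assms(1,2)])
  have "exp (g * L w - ln ((\<Sum>j\<in>UNIV. v$j) / v$k)) = exp (g * L w) * (v$k / (\<Sum>j\<in>UNIV. v$j))"
    using V assms(2) by (simp add: exp_diff)
  also have "\<dots> \<le> exp (G w)"
    unfolding exp_G by (rule entry_sum_ge_row(1)[OF assms(3) KW_nonneg assms(1,2)])
  finally show ?thesis by simp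
qed

text \<open>
  The following five tests read off growth rates from vectors. For \<open>gmax_le_row\<close>
  and \<open>gmin_le_row\<close> the vector must be positive in order to dominate the entry sum;
  for the reverse estimates a single positive entry suffices.\<close>

lemma gmax_le_row:
  assumes "\<And>j. 0 < v$j" "\<And>l j. (v v* K l) $ j \<le> exp (g * real (len l)) * v$j"
  shows "gmax \<le> g"
proof (rule gmax_le)
  fix w show "G w \<le> g * L w + ln ((\<Sum>j\<in>UNIV. v$j) / Min (range (\<lambda>i. v$i)))"
    using assms by (intro G_le_row row_le_word)
qed

lemma gmax_le_col:
  assumes "\<And>l i. (K l *v (\<chi> i. 1)) $ i \<le> exp (g * real (len l))"
  shows "gmax \<le> g"
proof (rule gmax_le)
  fix w
  have "(KW w *v (\<chi> i. 1)) $ i \<le> exp (g * L w) * (\<chi> i. (1::real)) $ i" for i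
    by (rule col_le) (use assms in simp)
  then have "entry_sum (KW w) \<le> (\<Sum>i\<in>(UNIV::'n set). exp (g * L w))"
    unfolding entry_sum_def matrix_vector_mult_def by (intro sum_mono) simp
  also have "\<dots> = exp (g * L w + ln (CARD('n)))" by (simp add: exp_add)
  finally show "G w \<le> g * L w + ln (CARD('n))"
    unfolding exp_G[symmetric] by simp
qed

lemma gmin_ge_row:
  assumes "\<And>j. 0 \<le> v$j" "0 < v$k" "\<And>l j. exp (g * real (len l)) * v$j \<le> (v v* K l) $ j"
  shows "g \<le> gmin"
proof (rule gmin_ge)
  fix w show "g * L w - ln ((\<Sum>j\<in>UNIV. v$j) / v$k) \<le> G w"
    using assms by (intro G_ge_row row_ge_word)
qed

lemma gmax_ge_row:
  assumes "\<And>j. 0 \<le> v$j" "0 < v$k" "w \<noteq> []" "\<And>j. exp (g * L w) * v$j \<le> (v v* KW w) $ j"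
  shows "g \<le> gmax"
proof (rule gmax_ge_periodic[OF assms(3)])
  fix n show "g * L (concat (replicate n w)) - ln ((\<Sum>j\<in>UNIV. v$j) / v$k)
      \<le> G (concat (replicate n w))"
    using row_ge_concat[of "replicate n w" g v] assms by (intro G_ge_row) auto
qed

lemma gmin_le_row:
  assumes "\<And>j. 0 < v$j" "w \<noteq> []" "\<And>j. (v v* KW w) $ j \<le> exp (g * L w) * v$j"
  shows "gmin \<le> g"
proof (rule gmin_le_periodic[OF assms(2)])
  fix n show "G (concat (replicate n w))
      \<le> g * L (concat (replicate n w)) + ln ((\<Sum>j\<in>UNIV. v$j) / Min (range (\<lambda>i. v$i)))"
    using row_le_concat[of "replicate n w" v g] assms by (intro G_le_row) auto
qed

end

section \<open>From checkpoints to a limit\<close>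

text \<open>
  The logarithmic ball mass \<open>\<phi>\<close> at scale $r^s$ is compared with the values
  \<open>\<Gamma>\<close> along a sequence of tiles. A ball fits into tile \<open>i\<close> once
  \<open>s\<close> is at least \<open>l i + 6\<close> and contains it while \<open>s\<close> is
  at most \<open>l i + 4\<close>. The largest \<open>i\<close> with \<open>l i + 6 \<le>
  s\<close> gives the upper estimate. For the lower estimate one goes two tiles further, because
  consecutive lengths differ by at least 3. As the gaps are of smaller order than the lengths,
  both estimates are asymptotic to \<open>g * s\<close>.\<close>

lemma limit_of_ratio_from_checkpoints:
  fixes \<phi> \<Gamma> l :: "_ \<Rightarrow> real"
  assumes gap: "\<And>i. l i + 3 \<le> l (Suc i)" and l0: "0 \<le> l 0"
    and slope: "\<And>e. 0 < e \<Longrightarrow> eventually (\<lambda>i. \<bar>\<Gamma> i - g * l i\<bar> \<le> e * l i) sequentially"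
    and small: "\<And>e. 0 < e \<Longrightarrow> eventually (\<lambda>i. l (Suc i) - l i \<le> e * l i) sequentially"
    and upper: "\<And>i s. l i + 6 \<le> s \<Longrightarrow> \<phi> s \<le> \<Gamma> i + C"
    and lower: "\<And>i s. 6 \<le> s \<Longrightarrow> s \<le> l i + 4 \<Longrightarrow> \<Gamma> i - C \<le> \<phi> s"
  shows "((\<lambda>s::real. \<phi> s / s) \<longlongrightarrow> g) at_top"
proof (rule tendstoI)
  fix e' :: real assume e': "e' > 0"
  define h where "h = \<bar>g\<bar>"
  have h: "0 \<le> h" by (simp add: h_def)
  define e where "e = min 1 (e' / (3 * h + 7))"
  have pos: "0 < 3 * h + 7" using h by simp
  have e: "0 < e" "e \<le> 1" using e' pos by (auto simp: e_def)
  have "e \<le> e' / (3 * h + 7)" by (simp add: e_def)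
  then have "e * (3 * h + 7) \<le> e'" using pos by (simp add: pos_le_divide_eq)
  note e = e this
  have l_ge: "3 * real i \<le> l i" for i
  proof (induction i)
    case (Suc i) then show ?case using gap[of i] by simp
  qed (simp add: l0)
  have l_mono: "i \<le> j \<Longrightarrow> l i \<le> l j" for i j
    by (rule lift_Suc_mono_le[of l]) (use gap in \<open>simp add: order.trans[OF _ gap]\<close>)
  have "eventually (\<lambda>i. \<bar>\<Gamma> i - g * l i\<bar> \<le> e * l i \<and> l (Suc i) - l i \<le> e * l i) sequentially"
    using slope[OF e(1)] small[OF e(1)] by (rule eventually_conj)
  then obtain N where N: "\<And>i. i \<ge> N \<Longrightarrow> \<bar>\<Gamma> i - g * l i\<bar> \<le> e * l i"
      "\<And>i. i \<ge> N \<Longrightarrow> l (Suc i) - l i \<le> e * l i"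
    unfolding eventually_sequentially by blast
  define C2 where "C2 = 6 * h + \<bar>C\<bar>"
  have "eventually (\<lambda>s. max (l N + 6) (C2 / e + 1) \<le> s) at_top" by (rule eventually_ge_at_top)
  then show "eventually (\<lambda>s. dist (\<phi> s / s) g < e') at_top"
  proof eventually_elim
    case (elim s)
    have s0: "s > 0" using elim l_ge[of N] by simp
    obtain n :: nat where "s < n" using reals_Archimedean2 by blast
    then have ex: "s < l n + 6" using l_ge[of n] by simp
    define n0 where "n0 = (LEAST n. s < l n + 6)"
    have n0: "s < l n0 + 6" unfolding n0_def using ex by (rule LeastI)
    have "N < n0" using n0 elim l_mono[of n0 N] by (cases "n0 \<le> N") auto
    then obtain i where i: "n0 = Suc i" "i \<ge> N" by (cases n0) auto
    have "\<not> s < l i + 6" using i(1) not_less_Least[of i "\<lambda>n. s < l n + 6"] by (simp add: n0_def)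
    then have s: "l i + 6 \<le> s" "s < l (Suc i) + 6" using n0 i by auto
    define X where "X = l i"
    define Y where "Y = l (Suc i)"
    define Z where "Z = l (Suc (Suc i))"
    have X0: "0 \<le> X" using l_ge[of i] by (simp add: X_def)
    have XYZ: "Y - X \<le> e * X" "Z - Y \<le> e * Y" "Y + 3 \<le> Z" "X + 3 \<le> Y"
      using N(2)[of i] N(2)[of "Suc i"] gap i by (auto simp: X_def Y_def Z_def)
    have eX: "e * X \<le> X" using e X0 by (simp add: mult_left_le_one_le)
    have eY: "e * Y \<le> 2 * (e * X)"
      using XYZ(1) eX e X0 mult_left_mono[of Y "2 * X" e] by linarith
    have eZ: "e * Z \<le> 4 * (e * X)"
    proof -
      have "Z \<le> 4 * X" using XYZ eX eY by linarith
      then show ?thesis using e mult_left_mono[of Z "4 * X" e] by simp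
    qed
    have up: "\<phi> s - g * s \<le> (3 * h + 4) * (e * X) + C2"
    proof -
      have "\<phi> s \<le> \<Gamma> i + C" using upper s by blast
      also have "\<Gamma> i \<le> g * X + e * X" using N(1)[OF i(2)] by (simp add: X_def)
      finally have 1: "\<phi> s \<le> g * X + e * X + C" by simp
      have "g * (X - s) \<le> h * (e * X + 6)"
      proof -
        have "g * (X - s) \<le> \<bar>g * (X - s)\<bar>" by simp
        also have "\<dots> = h * (s - X)" using s by (simp add: abs_mult X_def h_def)
        also have "\<dots> \<le> h * (e * X + 6)"
          using s XYZ by (intro mult_left_mono) (auto simp: X_def Y_def h)
        finally show ?thesis .
      qed
      moreover have "0 \<le> h * (e * X)" "0 \<le> e * X" using e X0 h by simp_all
      ultimately show ?thesis using 1 unfolding C2_def by (simp add: algebra_simps)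
    qed
    have low: "- ((3 * h + 4) * (e * X) + C2) \<le> \<phi> s - g * s"
    proof -
      have "\<Gamma> (Suc (Suc i)) - C \<le> \<phi> s"
        using s XYZ X0 by (intro lower) (auto simp: X_def Y_def Z_def)
      moreover have "g * Z - e * Z \<le> \<Gamma> (Suc (Suc i))"
        using N(1)[of "Suc (Suc i)"] i by (simp add: Z_def)
      moreover have "- (h * (3 * (e * X) + 6)) \<le> g * (Z - s)"
      proof -
        have "\<bar>g * (Z - s)\<bar> = h * \<bar>Z - s\<bar>" by (simp add: abs_mult h_def)
        also have "\<dots> \<le> h * (3 * (e * X) + 6)"
          using s XYZ eY X0 by (intro mult_left_mono) (auto simp: X_def Y_def Z_def h)
        finally show ?thesis by linarith
      qed
      moreover have "0 \<le> h * (e * X)" "0 \<le> e * X" using e X0 h by simp_all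
      ultimately show ?thesis using eZ unfolding C2_def by (simp add: algebra_simps)
    qed
    have "\<bar>\<phi> s - g * s\<bar> \<le> (3 * h + 4) * (e * X) + C2" using up low by linarith
    also have "\<dots> \<le> (3 * h + 4) * (e * s) + e * s"
    proof (intro add_mono mult_left_mono)
      show "X \<le> s" using s by (simp add: X_def)
      show "C2 \<le> e * s" using elim e by (simp add: divide_simps mult.commute split: if_splits)
    qed (use e h in auto)
    also have "\<dots> < e * (3 * h + 7) * s" using e s0 by (simp add: algebra_simps)
    also have "\<dots> \<le> e' * s" using e s0 by (intro mult_right_mono) auto
    finally have "\<bar>\<phi> s - g * s\<bar> / s < e'" using s0 by (simp add: pos_divide_less_eq)
    moreover have "\<phi> s / s - g = (\<phi> s - g * s) / s" using s0 by (simp add: field_simps)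
    ultimately show ?case using s0 by (simp add: dist_real_def)
  qed
qed

lemma mult_le_abs_mult:
  fixes g x b :: real
  assumes "\<bar>x\<bar> \<le> b" shows "g * x \<le> \<bar>g\<bar> * b"
proof -
  have "g * x \<le> \<bar>g\<bar> * \<bar>x\<bar>" by (metis abs_ge_self abs_mult)
  also have "\<dots> \<le> \<bar>g\<bar> * b" using assms by (intro mult_left_mono) auto
  finally show ?thesis .
qed

lemma scale_index:
  assumes "0 < t" "t \<le> 1"
  obtains n :: nat where "real n \<le> ln t / ln r" "ln t / ln r < real n + 1" "r ^ (n + 1) \<le> t" "t \<le> r ^ n"
proof
  define s where "s = ln t / ln r"
  define n where "n = nat \<lfloor>s\<rfloor>"
  have s0: "0 \<le> s" using assms ln_r_neg by (simp add: s_def divide_nonpos_neg)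
  show n: "real n \<le> ln t / ln r" "ln t / ln r < real n + 1"
    using s0 unfolding n_def s_def[symmetric] by linarith+
  have pw: "r ^ k = exp (real k * ln r)" for k using r_pos by (simp add: exp_of_nat_mult)
  have t: "t = exp (s * ln r)" using assms ln_r_neg by (simp add: s_def)
  have "real (n + 1) * ln r \<le> s * ln r" "s * ln r \<le> real n * ln r"
    using n ln_r_neg by (auto simp: s_def[symmetric] intro!: mult_right_mono_neg)
  then show "r ^ (n + 1) \<le> t" "t \<le> r ^ n" unfolding pw t by simp_all
qed

lemma powr_div_ln_r: "0 < t \<Longrightarrow> t powr (g / ln r) = exp (g * (ln t / ln r))"
  by (simp add: powr_def)

section \<open>Self-similar interval functions\<close>

text \<open>
  \<open>F x y\<close> is a vector of masses attached to the interval \<open>{x..y}\<close>; the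
  tile maps act on it by the matrices without overlap. Only closed intervals occur, and
  subadditivity under splitting replaces additivity.\<close>

locale cascade = matrix_words K for K :: "letter \<Rightarrow> real^'n^'n" +
  fixes F :: "real \<Rightarrow> real \<Rightarrow> real^'n"
  assumes F_tile: "\<lbrakk>0 \<le> x; x \<le> y; y \<le> r\<rbrakk> \<Longrightarrow> F (T l x) (T l y) = K l *v F x y"
    and F_mono: "\<lbrakk>0 \<le> x'; x' \<le> x; x \<le> y; y \<le> y'; y' \<le> r\<rbrakk> \<Longrightarrow> F x y $ i \<le> F x' y' $ i"
    and F_split: "\<lbrakk>0 \<le> x; x \<le> y; y \<le> z; z \<le> r\<rbrakk> \<Longrightarrow> F x z $ i \<le> F x y $ i + F y z $ i"
    and F_pos: "0 < F 0 r $ i"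
begin

lemma F_word:
  assumes "0 \<le> x" "x \<le> y" "y \<le> r"
  shows "F (TW w x) (TW w y) = KW w *v F x y"
proof (induction w)
  case (Cons l w)
  have "F (TW (l # w) x) (TW (l # w) y) = K l *v F (TW w x) (TW w y)"
    using F_tile[of "TW w x" "TW w y" l] TW_range TW_mono[of x y w] assms by simp
  then show ?case using Cons by (simp add: matrix_vector_mul_assoc)
qed simp

lemma tile_mass_nonneg: "0 \<le> (KW w *v F 0 r) $ i"
  using KW_nonneg less_imp_le[OF F_pos] by (auto simp: matrix_vector_mult_def intro!: sum_nonneg)

lemma F_le_tile:
  assumes "TW w 0 \<le> x" "x \<le> y" "y \<le> TW w r"
  shows "F x y $ i \<le> (KW w *v F 0 r) $ i"
  using F_mono[of "TW w 0" x y "TW w r" i] F_word[of 0 r w] TW_range[of 0 w] TW_range[of r w]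
    assms r_pos by simp

lemma tile_le_F:
  assumes "0 \<le> x" "x \<le> TW w 0" "TW w r \<le> y" "y \<le> r"
  shows "(KW w *v F 0 r) $ i \<le> F x y $ i"
  using F_mono[of x "TW w 0" "TW w r" y i] F_word[of 0 r w] TW_mono[of 0 r w] assms r_pos by simp

text \<open>
  A short interval across the common end of two neighbouring tiles is covered by the last
  subtile of the left one and the first subtile of the right one; these have the words \<open>l
  Hi ... Hi\<close> and \<open>l' Lo ... Lo\<close>, with the number of repetitions chosen to
  match the length of the interval.\<close>

lemma F_junction:
  assumes "T l r = T l' 0" "T l 0 \<le> x" "x \<le> T l r" "T l' 0 \<le> y" "y \<le> T l' r"
    and "y - x \<le> r ^ (m + 4)" "3 \<le> m"
  shows "\<exists>w w'. wlen w \<le> m + 3 \<and> m \<le> wlen w + 3 \<and> wlen w' \<le> m + 3 \<and> m \<le> wlen w' + 3 \<and>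
    (\<forall>i. F x y $ i \<le> (KW w *v F 0 r) $ i + (KW w' *v F 0 r) $ i)"
proof -
  have len: "2 \<le> len l" "len l \<le> 3" for l by (cases l; simp)+
  have short: "r ^ len l * r ^ (2 * ((m - len l) div 2)) * r \<ge> r ^ (m + 4)" for l
  proof -
    have "r ^ (m + 4) \<le> r ^ (len l + 2 * ((m - len l) div 2) + 1)"
      using r_pos r_less_1 len[of l] assms(7) by (intro power_decreasing) auto
    then show ?thesis by (simp add: power_add mult_ac)
  qed
  define w where "w = l # replicate ((m - len l) div 2) Hi"
  define w' where "w' = l' # replicate ((m - len l') div 2) Lo"
  have wr: "TW w r = T l r" by (simp add: w_def TW_replicate_Hi del: foldr_replicate)
  have w0: "TW w 0 \<le> x"
  proof -
    have "TW w 0 = T l r - r ^ len l * r ^ (2 * ((m - len l) div 2)) * r"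
      using T_diff[of l r "TW (replicate ((m - len l) div 2) Hi) 0"]
      by (simp add: w_def TW_replicate_Hi mult.assoc del: foldr_replicate)
    then show ?thesis using short[of l] assms by linarith
  qed
  have w0': "TW w' 0 = T l' 0" by (simp add: w'_def TW_replicate_Lo del: foldr_replicate)
  have wr': "y \<le> TW w' r"
  proof -
    have "TW w' r = T l' 0 + r ^ len l' * r ^ (2 * ((m - len l') div 2)) * r"
      using T_diff[of l' "TW (replicate ((m - len l') div 2) Lo) r" 0]
      by (simp add: w'_def TW_replicate_Lo mult.assoc del: foldr_replicate)
    then show ?thesis using short[of l'] assms by linarith
  qed
  have "F x y $ i \<le> (KW w *v F 0 r) $ i + (KW w' *v F 0 r) $ i" for i
  proof -
    have "0 \<le> x" "y \<le> r" using assms T_range[of 0 l] T_range[of r l'] r_pos by auto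
    then have "F x y $ i \<le> F x (T l r) $ i + F (T l' 0) y $ i"
      using F_split[of x "T l r" y i] assms by simp
    also have "\<dots> \<le> (KW w *v F 0 r) $ i + (KW w' *v F 0 r) $ i"
      using assms wr w0 w0' wr' by (intro add_mono F_le_tile) auto
    finally show ?thesis .
  qed
  moreover have "wlen w \<le> m + 3" "m \<le> wlen w + 3" "wlen w' \<le> m + 3" "m \<le> wlen w' + 3"
    using len[of l] len[of l'] assms(7) unfolding w_def w'_def by (simp; linarith)+
  ultimately show ?thesis by blast
qed

text \<open>
  Zoom into tiles as long as the interval lies in one of them; when it first crosses a junction,
  \<open>F_junction\<close> applies. At most one junction is crossed, since the middle tile has
  length $r^4$ and the interval is shorter.\<close>

lemma two_tile_cover:
  assumes "0 \<le> x" "x \<le> y" "y \<le> r" "3 \<le> m \<Longrightarrow> y - x \<le> r ^ (m + 4)"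
  shows "\<exists>w w'. wlen w \<le> m + 3 \<and> m \<le> wlen w + 3 \<and> wlen w' \<le> m + 3 \<and> m \<le> wlen w' + 3 \<and>
    (\<forall>i. F x y $ i \<le> (KW w *v F 0 r) $ i + (KW w' *v F 0 r) $ i)"
  using assms
proof (induction m arbitrary: x y rule: less_induct)
  case (less m)
  consider "m < 3" | l where "3 \<le> m" "T l 0 \<le> x" "y \<le> T l r"
    | "3 \<le> m" "x \<le> r ^ 3" "r ^ 3 \<le> y" "y \<le> r\<^sup>2" | "3 \<le> m" "r ^ 3 \<le> x" "x \<le> r\<^sup>2" "r\<^sup>2 \<le> y"
  proof (cases "3 \<le> m")
    case True
    have "r ^ (m + 4) \<le> r ^ 4" using r_pos r_less_1 by (intro power_decreasing) auto
    moreover have "r ^ 3 + r ^ 4 = r\<^sup>2" using r_square r_cube r_power_4 by simp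
    ultimately have d: "y \<le> x + r\<^sup>2 - r ^ 3" using less.prems(4)[OF True] by linarith
    consider "y \<le> r ^ 3" | "x \<le> r ^ 3" "r ^ 3 \<le> y" | "r ^ 3 \<le> x" "y \<le> r\<^sup>2"
      | "r ^ 3 \<le> x" "x \<le> r\<^sup>2" "r\<^sup>2 \<le> y" | "r\<^sup>2 \<le> x"
      by linarith
    then show ?thesis
    proof cases
      case 1 then show ?thesis using that(2)[of Lo] True less.prems unfolding T_ends by simp
    next
      case 2 then show ?thesis using that(3) True d by simp
    next
      case 3 then show ?thesis using that(2)[of Mid] True unfolding T_ends by simp
    next
      case 4 then show ?thesis using that(4) True by simp
    next
      case 5 then show ?thesis using that(2)[of Hi] True less.prems unfolding T_ends by simp
    qed
  qed (use that in auto)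
  then show ?case
  proof cases
    case 1
    have "F x y $ i \<le> (KW [] *v F 0 r) $ i + (KW [] *v F 0 r) $ i" for i
      using F_le_tile[of "[]" x y i] tile_mass_nonneg[of "[]" i] less.prems by simp
    then show ?thesis using 1 by (intro exI[of _ "[]"]) simp
  next
    case 2
    have in_l: "x \<le> T l r" "T l 0 \<le> y" using 2 less.prems by linarith+
    obtain x' where x': "x = T l x'" "0 \<le> x'" "x' \<le> r"
      using T_preimage[OF 2(2) in_l(1)] by blast
    obtain y' where y': "y = T l y'" "0 \<le> y'" "y' \<le> r"
      using T_preimage[OF in_l(2) 2(3)] by blast
    have len: "2 \<le> len l" "len l \<le> 3" by (cases l; simp)+
    have pl: "r ^ len l > 0" using r_pos by simp
    have xy: "y - x = r ^ len l * (y' - x')" using T_diff x' y' by simp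
    have le: "x' \<le> y'"
    proof (rule ccontr)
      assume "\<not> x' \<le> y'"
      then have "r ^ len l * (y' - x') < 0" using pl by (simp add: mult_pos_neg)
      then show False using xy less.prems(2) by linarith
    qed
    have "y' - x' \<le> r ^ (m - len l + 4)"
    proof -
      have "r ^ len l * (y' - x') \<le> r ^ len l * r ^ (m - len l + 4)"
        using less.prems(4) 2 xy len by (simp flip: power_add)
      then show ?thesis using pl by simp
    qed
    then obtain w w' where w: "wlen w \<le> m - len l + 3" "m - len l \<le> wlen w + 3"
        "wlen w' \<le> m - len l + 3" "m - len l \<le> wlen w' + 3"
        "\<And>i. F x' y' $ i \<le> (KW w *v F 0 r) $ i + (KW w' *v F 0 r) $ i"
      using less.IH[of "m - len l" x' y'] x' y' le len 2 by auto
    have "F x y $ i \<le> (KW (l # w) *v F 0 r) $ i + (KW (l # w') *v F 0 r) $ i" for i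
    proof -
      have "F x y $ i = (K l *v F x' y') $ i" using F_tile x' y' le by simp
      also have "\<dots> \<le> (K l *v (KW w *v F 0 r + KW w' *v F 0 r)) $ i"
        using w(5) by (intro col_vector_mono K_nonneg) simp
      finally show ?thesis by (simp add: matrix_vector_mul_assoc matrix_vector_right_distrib)
    qed
    moreover have "wlen (l # w) \<le> m + 3" "m \<le> wlen (l # w) + 3"
        "wlen (l # w') \<le> m + 3" "m \<le> wlen (l # w') + 3"
      using w(1-4) len 2(1) by simp_all
    ultimately show ?thesis by blast
  next
    case 3
    then show ?thesis
      using F_junction[of Lo Mid x y m] less.prems unfolding T_ends by auto
  next
    case 4
    then show ?thesis
      using F_junction[of Mid Hi x y m] less.prems unfolding T_ends by auto
  qed
qed

text \<open>
  Two tiles of the size of the interval cover it, and the mass of a tile is at most a constant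
  times \<open>exp (gmax * L w)\<close>. Intervals of length up to \<open>4 * t\<close> are
  allowed because a ball has diameter \<open>2 * t\<close> and pulling it back enlarges it by
  \<open>1 / r < 2\<close>.\<close>

lemma F_upper:
  obtains C where "0 < C" "\<And>x y t i. \<lbrakk>0 \<le> x; x \<le> y; y \<le> r; y - x \<le> 4 * t; 0 < t; t \<le> 1\<rbrakk>
    \<Longrightarrow> F x y $ i \<le> C * t powr (gmax / ln r)"
proof -
  obtain C0 where C0: "\<And>w. G w \<le> gmax * L w + C0" using G_le_gmax by blast
  define B where "B = (\<Sum>i\<in>UNIV. F 0 r $ i)"
  have B: "F 0 r $ i \<le> B" for i
    unfolding B_def using F_pos by (intro member_le_sum) (auto intro: less_imp_le)
  have B0: "0 < B" using B F_pos less_le_trans by blast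
  define C where "C = 2 * (B * exp (11 * \<bar>gmax\<bar> + C0))"
  have tile: "(KW w *v F 0 r) $ i \<le> B * exp (11 * \<bar>gmax\<bar> + C0) * exp (gmax * s)"
    if "\<bar>L w - s\<bar> \<le> 11" for w i s
  proof -
    have "(KW w *v F 0 r) $ i \<le> B * entry_sum (KW w)"
      using B B0 by (intro matrix_vector_le KW_nonneg) auto
    also have "entry_sum (KW w) \<le> exp (gmax * L w + C0)" using C0 by (simp flip: exp_G)
    also have "gmax * L w + C0 \<le> 11 * \<bar>gmax\<bar> + C0 + gmax * s"
    proof -
      have "gmax * (L w - s) \<le> \<bar>gmax\<bar> * 11"
        using that by (rule mult_le_abs_mult)
      then show ?thesis by (simp add: algebra_simps)
    qed
    finally show ?thesis using B0 by (simp add: exp_add)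
  qed
  show ?thesis
  proof (rule that[of C])
    show "0 < C" using B0 by (simp add: C_def)
    fix x y t i assume xy: "0 \<le> x" "x \<le> y" "y \<le> r" "y - x \<le> 4 * t" "0 < t" "t \<le> (1::real)"
    obtain n :: nat where n: "real n \<le> ln t / ln r" "ln t / ln r < real n + 1" "t \<le> r ^ n"
      using scale_index xy by metis
    \<comment> \<open>The factor 4 costs three powers of \<open>r\<close>, and the covering lemma four more.\<close>
    have "y - x \<le> r ^ (n - 7 + 4)" if "3 \<le> n - 7"
    proof -
      have r3: "4 * r ^ 3 \<le> 1" using r_cube r_bounds by linarith
      have "y - x \<le> 4 * r ^ n" using xy n by linarith
      also have "r ^ n = r ^ 3 * r ^ (n - 7 + 4)" using that by (simp flip: power_add)
      also have "4 * (r ^ 3 * r ^ (n - 7 + 4)) \<le> r ^ (n - 7 + 4)"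
        using mult_right_mono[OF r3, of "r ^ (n - 7 + 4)"] r_pos by (simp add: mult.assoc)
      finally show ?thesis .
    qed
    then obtain w w' where w: "wlen w \<le> n - 7 + 3" "n - 7 \<le> wlen w + 3"
        "wlen w' \<le> n - 7 + 3" "n - 7 \<le> wlen w' + 3"
        "\<And>i. F x y $ i \<le> (KW w *v F 0 r) $ i + (KW w' *v F 0 r) $ i"
      using two_tile_cover[of x y "n - 7"] xy by blast
    have "F x y $ i \<le> (KW w *v F 0 r) $ i + (KW w' *v F 0 r) $ i" by (rule w)
    also have "\<dots> \<le> B * exp (11 * \<bar>gmax\<bar> + C0) * exp (gmax * (ln t / ln r))
        + B * exp (11 * \<bar>gmax\<bar> + C0) * exp (gmax * (ln t / ln r))"
      using w(1-4) n by (intro add_mono tile) linarith+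
    finally show "F x y $ i \<le> C * t powr (gmax / ln r)"
      unfolding powr_div_ln_r[OF xy(5)] C_def by (simp add: mult_ac)
  qed
qed

text \<open>
  A point of $[r^3,r]$ lies in the tile of \<open>Mid\<close> or of \<open>Hi\<close>, whose
  matrix has a positive row \<open>i\<close>. That row sees the full entry sum of the remaining
  product, which is at least \<open>exp (gmin * L v)\<close>. For both measures the first row of
  \<open>K Lo\<close> has a zero, which excludes points near 0.\<close>

lemma F_lower:
  assumes i: "\<And>j. 0 < K Hi $ i $ j" and x: "r ^ 3 \<le> x" "x \<le> r"
  obtains c where "0 < c" "\<And>t. \<lbrakk>0 < t; t \<le> 1\<rbrakk>
    \<Longrightarrow> c * t powr (gmin / ln r) \<le> F (max 0 (x - t)) (min r (x + t)) $ i"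
proof -
  have "\<exists>l. l \<noteq> Lo \<and> T l 0 \<le> x \<and> x \<le> T l r"
  proof (cases "x \<le> r\<^sup>2")
    case True
    then show ?thesis using x by (intro exI[of _ Mid]) (simp only: T_ends, simp)
  next
    case False
    then show ?thesis using x by (intro exI[of _ Hi]) (simp only: T_ends, simp)
  qed
  then obtain l where l: "l \<noteq> Lo" "T l 0 \<le> x" "x \<le> T l r" by blast
  obtain z where z: "x = T l z" "0 \<le> z" "z \<le> r" using T_preimage l by blast
  define c where "c = Min (range (\<lambda>j. K l $ i $ j))"
  define m where "m = Min (range (\<lambda>j. F 0 r $ j))"
  have "0 < K l $ i $ j" for j using l(1) i K_Mid_pos by (cases l) auto
  then have c: "0 < c" "\<And>j. c \<le> K l $ i $ j" unfolding c_def by (auto simp: Min_gr_iff)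
  have m: "0 < m" "\<And>j. m \<le> F 0 r $ j" unfolding m_def using F_pos by (auto simp: Min_gr_iff)
  show ?thesis
  proof (rule that[of "c * m * exp (- 2 * \<bar>gmin\<bar>)"])
    show "0 < c * m * exp (- 2 * \<bar>gmin\<bar>)" using c m by simp
    fix t :: real assume t: "0 < t" "t \<le> 1"
    obtain n :: nat where n: "real n \<le> ln t / ln r" "ln t / ln r < real n + 1" "r ^ (n + 1) \<le> t"
      using scale_index t by metis
    obtain v y where v: "z = TW v y" "0 \<le> y" "y \<le> r" "n \<le> wlen v" "wlen v \<le> n + 2"
      using word_at[OF z(2,3), of n] by blast
    define w where "w = l # v"
    have xw: "x = TW w y" using z v by (simp add: w_def)
    have ends: "TW w 0 \<le> x" "x \<le> TW w r" using v xw by (auto intro: TW_mono)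
    have "TW w r - TW w 0 = r ^ wlen w * r" using TW_affine[of w r] by simp
    also have "\<dots> = r ^ (wlen w + 1)" by simp
    also have "\<dots> \<le> r ^ (n + 1)"
      using v r_pos r_less_1 by (intro power_decreasing) (auto simp: w_def)
    finally have "TW w r - TW w 0 \<le> t" using n by linarith
    then have inside: "(KW w *v F 0 r) $ i \<le> F (max 0 (x - t)) (min r (x + t)) $ i"
      using ends TW_range[of 0 w] TW_range[of r w] r_pos by (intro tile_le_F) auto
    have row: "c * m * entry_sum (KW v) \<le> (KW w *v F 0 r) $ i"
      using row_mult_ge[of c "K l" i "KW v" m "F 0 r"] c m KW_nonneg by (simp add: w_def)
    have "exp (- 2 * \<bar>gmin\<bar>) * t powr (gmin / ln r) \<le> entry_sum (KW v)"
    proof -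
      have "\<bar>ln t / ln r - L v\<bar> \<le> 2" using v n by linarith
      then have "gmin * (ln t / ln r - L v) \<le> \<bar>gmin\<bar> * 2"
        by (rule mult_le_abs_mult)
      then have "- 2 * \<bar>gmin\<bar> + gmin * (ln t / ln r) \<le> gmin * L v"
        by (simp add: right_diff_distrib)
      also have "\<dots> \<le> G v" by (rule gmin_le_G)
      finally show ?thesis unfolding powr_div_ln_r[OF t(1)] exp_G[symmetric] exp_add[symmetric] by simp
    qed
    then have "c * m * (exp (- 2 * \<bar>gmin\<bar>) * t powr (gmin / ln r)) \<le> c * m * entry_sum (KW v)"
      using c m by (intro mult_left_mono) auto
    also note row
    also note inside
    finally show "c * m * exp (- 2 * \<bar>gmin\<bar>) * t powr (gmin / ln r)
        \<le> F (max 0 (x - t)) (min r (x + t)) $ i"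
      by (simp add: mult.assoc)
  qed
qed

end

context cascade begin

text \<open>
  The tiles of the words \<open>Mid # u n\<close> from \<open>slope_attained\<close> are nested.
  Because \<open>u (n + 1)\<close> continues \<open>u n\<close> with the letter
  \<open>Mid\<close>, the next tile keeps a distance of $r^3$ times the scale from both ends of
  the previous one. Hence balls around the common point \<open>x\<close> lie in tiles of
  comparable size, no neighbouring tile interferes, and the checkpoint lemma gives the limit.\<close>

theorem slope_realised:
  assumes g: "gmin \<le> g" "g \<le> gmax" and i: "\<And>j. 0 < K Hi $ i $ j"
  obtains x where "r ^ 3 \<le> x" "x \<le> r\<^sup>2"
    "((\<lambda>t. ln (F (x - t) (x + t) $ i) / ln t) \<longlongrightarrow> g / ln r) (at_right 0)"
proof (rule slope_attained[OF g])
  fix u v :: "nat \<Rightarrow> letter list"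
  assume u0: "u 0 = []" and uS: "\<And>n. u (Suc n) = u n @ Mid # v n"
    and slope: "\<And>e. 0 < e \<Longrightarrow> eventually (\<lambda>n. \<bar>G (u n) - g * L (u n)\<bar> \<le> e * L (u n)) sequentially"
    and small: "\<And>e. 0 < e \<Longrightarrow> eventually (\<lambda>n. L (v n) + 3 \<le> e * L (u n)) sequentially"
  define W where "W = (\<lambda>n. Mid # u n)"
  define a where "a = (\<lambda>n. TW (W n) 0)"
  define b where "b = (\<lambda>n. TW (W n) r)"
  have WS: "TW (W (Suc n)) y = TW (W n) (T Mid (TW (v n) y))" for n y
    by (simp add: W_def uS)
  have mid: "r ^ 3 \<le> T Mid (TW w y)" "T Mid (TW w y) \<le> r\<^sup>2" if "0 \<le> y" "y \<le> r" for w y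
    using TW_range[OF that, of w] TW_mono[of 0 "TW w y" "[Mid]"] TW_mono[of "TW w y" r "[Mid]"]
      T_ends(3,4) by auto
  have margin: "TW (W n) (r ^ 3) = a n + r ^ (wlen (W n) + 3)"
    "TW (W n) (r\<^sup>2) = b n - r ^ (wlen (W n) + 3)" for n
  proof -
    show "TW (W n) (r ^ 3) = a n + r ^ (wlen (W n) + 3)"
      using TW_affine[of "W n" "r ^ 3"] by (simp add: a_def power_add)
    have "r = r\<^sup>2 + r ^ 3" using r_square r_cube by simp
    then have "r ^ wlen (W n) * r = r ^ wlen (W n) * r\<^sup>2 + r ^ wlen (W n) * r ^ 3"
      by (metis distrib_left)
    then show "TW (W n) (r\<^sup>2) = b n - r ^ (wlen (W n) + 3)"
      using TW_affine[of "W n" "r\<^sup>2"] TW_affine[of "W n" r] by (simp add: b_def power_add)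
  qed
  have step: "a n + r ^ (wlen (W n) + 3) \<le> a (Suc n)" "b (Suc n) \<le> b n - r ^ (wlen (W n) + 3)" for n
  proof -
    have "TW (W n) (r ^ 3) \<le> TW (W n) (T Mid (TW (v n) 0))"
      using r_pos by (intro TW_mono mid) auto
    then show "a n + r ^ (wlen (W n) + 3) \<le> a (Suc n)"
      using margin(1)[of n] WS[of n 0] by (simp only: a_def)
    have "TW (W n) (T Mid (TW (v n) r)) \<le> TW (W n) (r\<^sup>2)"
      using r_pos by (intro TW_mono mid) auto
    then show "b (Suc n) \<le> b n - r ^ (wlen (W n) + 3)"
      using margin(2)[of n] WS[of n r] by (simp only: b_def)
  qed
  have pw: "0 < r ^ k" for k using r_pos by simp
  have inc: "incseq a" "decseq b"
    by (auto intro!: incseq_SucI decseq_SucI intro: order.trans[OF _ step(1)] order.trans[OF step(2)]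
        simp: less_imp_le[OF pw])
  have ab: "a n \<le> b m" for n m
  proof -
    have "a n \<le> a (max n m)" "b (max n m) \<le> b m" using inc by (auto simp: incseq_def decseq_def)
    moreover have "a (max n m) \<le> b (max n m)" unfolding a_def b_def using r_pos by (intro TW_mono) auto
    ultimately show ?thesis by linarith
  qed
  define x where "x = (SUP n. a n)"
  have bdd: "bdd_above (range a)" using ab[of _ 0] by (auto intro!: bdd_aboveI)
  have x: "a n \<le> x" "x \<le> b n" for n
    unfolding x_def using ab bdd by (auto intro!: cSUP_upper cSUP_least)
  have ball: "a n \<le> x - t \<and> x + t \<le> b n" if "t \<le> r ^ (wlen (u n) + 6)" for n t
    using step[of n] x[of "Suc n"] that by (simp add: W_def add.commute)
  have xmid: "r ^ 3 \<le> x" "x \<le> r\<^sup>2"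
    using x[of 0] T_ends by (simp_all add: a_def b_def W_def u0)
  have x_le_r: "x \<le> r" using xmid(2) r_square r_bounds by linarith
  define B where "B = (\<Sum>i\<in>UNIV. F 0 r $ i)"
  have B: "F 0 r $ i \<le> B" for i
    unfolding B_def using F_pos by (intro member_le_sum) (auto intro: less_imp_le)
  have B0: "0 < B" using B F_pos less_le_trans by blast
  obtain c where c: "0 < c" "\<And>i j. c \<le> K Mid $ i $ j" using KW_Mid_lower by blast
  define m where "m = Min (range (\<lambda>j. F 0 r $ j))"
  have m: "0 < m" "\<And>j. m \<le> F 0 r $ j" unfolding m_def using F_pos by (auto simp: Min_gr_iff)
  define f where "f = (\<lambda>t. F (x - t) (x + t) $ i)"
  define C where "C = \<bar>ln B\<bar> + \<bar>G [Mid]\<bar> + \<bar>ln (c * m)\<bar>"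
  have f_pos: "0 < f t" if "0 < t" "t \<le> r ^ 6" for t
  proof -
    obtain d where d: "0 < d" "\<And>t. \<lbrakk>0 < t; t \<le> 1\<rbrakk>
        \<Longrightarrow> d * t powr (gmin / ln r) \<le> F (max 0 (x - t)) (min r (x + t)) $ i"
      using F_lower[OF i xmid(1) x_le_r] by blast
    have "t \<le> 1" using that r_pos r_less_1 power_le_one[of r 6] by linarith
    have "0 < d * t powr (gmin / ln r)" using d that by simp
    also have "\<dots> \<le> F (max 0 (x - t)) (min r (x + t)) $ i" using d that \<open>t \<le> 1\<close> by blast
    finally have "0 < F (max 0 (x - t)) (min r (x + t)) $ i" .
    moreover have "0 \<le> x - t" "x + t \<le> r"
      using ball[of t 0] that ab TW_range[of 0 "W 0"] TW_range[of r "W 0"] r_pos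
      by (auto simp: u0 a_def b_def)
    ultimately show ?thesis by (simp add: f_def)
  qed
  have upper: "ln (f t) \<le> G (u n) + C" if "0 < t" "t \<le> r ^ (wlen (u n) + 6)" for t n
  proof -
    have "r ^ (wlen (u n) + 6) \<le> r ^ 6" using r_pos r_less_1 by (intro power_decreasing) auto
    then have "t \<le> r ^ 6" using that by linarith
    have "f t \<le> (KW (W n) *v F 0 r) $ i"
      unfolding f_def using ball[OF that(2)] that(1) by (intro F_le_tile) (auto simp: a_def b_def)
    also have "\<dots> \<le> B * entry_sum (KW (W n))"
      using B B0 by (intro matrix_vector_le KW_nonneg) auto
    also have "\<dots> = exp (ln B + G (W n))" using B0 by (simp add: exp_add exp_G)
    also have "\<dots> \<le> exp (G (u n) + C)"
      using subadditive[of "[Mid]" "u n"] by (simp add: C_def W_def)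
    finally show ?thesis using f_pos[OF that(1) \<open>t \<le> r ^ 6\<close>] by (metis exp_le_cancel_iff exp_ln)
  qed
  have lower: "G (u n) - C \<le> ln (f t)" if "t \<le> r ^ 6" "r ^ (wlen (u n) + 4) \<le> t" for t n
  proof -
    have t0: "0 < t" using that pw less_le_trans by blast
    have len: "b n - a n = r ^ (wlen (u n) + 4)"
      using TW_affine[of "W n" r] by (simp add: a_def b_def W_def power_add eval_nat_numeral)
    have "0 \<le> x - t" "x + t \<le> r"
      using ball[of t 0] that TW_range[of 0 "W 0"] TW_range[of r "W 0"] r_pos
      by (auto simp: u0 a_def b_def)
    then have "(KW (W n) *v F 0 r) $ i \<le> f t"
      unfolding f_def using x[of n] len that by (intro tile_le_F) (auto simp: a_def b_def)
    moreover have "c * m * entry_sum (KW (u n)) \<le> (KW (W n) *v F 0 r) $ i"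
      using row_mult_ge[of c "K Mid" i "KW (u n)" m "F 0 r"] c m KW_nonneg by (simp add: W_def)
    moreover have "c * m * entry_sum (KW (u n)) = exp (ln (c * m) + G (u n))"
      using c m by (simp add: exp_add exp_G)
    ultimately have "exp (ln (c * m) + G (u n)) \<le> f t" by linarith
    then have "ln (c * m) + G (u n) \<le> ln (f t)"
      using f_pos[OF t0 that(1)] by (simp add: ln_ge_iff)
    then show ?thesis by (simp add: C_def)
  qed
  have r_powr: "r powr s \<le> r ^ k \<longleftrightarrow> real k \<le> s" "r ^ k \<le> r powr s \<longleftrightarrow> s \<le> real k" for s k
  proof -
    have "r powr s = exp (s * ln r)" "r ^ k = exp (real k * ln r)"
      using r_pos by (simp_all add: powr_def exp_of_nat_mult)
    then show "r powr s \<le> r ^ k \<longleftrightarrow> real k \<le> s" "r ^ k \<le> r powr s \<longleftrightarrow> s \<le> real k"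
      using ln_r_neg by (simp_all add: mult_le_cancel_right)
  qed
  have lim: "((\<lambda>s. ln (f (r powr s)) / s) \<longlongrightarrow> g) at_top"
  proof (rule limit_of_ratio_from_checkpoints[where l = "\<lambda>n. L (u n)" and \<Gamma> = "\<lambda>n. G (u n)" and C = C])
    show "L (u n) + 3 \<le> L (u (Suc n))" for n by (simp add: uS)
    show "0 \<le> L (u 0)" by simp
    show "eventually (\<lambda>n. \<bar>G (u n) - g * L (u n)\<bar> \<le> e * L (u n)) sequentially" if "0 < e" for e
      by (rule slope[OF that])
    show "eventually (\<lambda>n. L (u (Suc n)) - L (u n) \<le> e * L (u n)) sequentially" if "0 < e" for e
      using small[OF that] by (simp add: uS add.commute)
    show "ln (f (r powr s)) \<le> G (u n) + C" if "L (u n) + 6 \<le> s" for n s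
      using that r_pos r_powr by (intro upper) auto
    show "G (u n) - C \<le> ln (f (r powr s))" if "6 \<le> s" "s \<le> L (u n) + 4" for n s
      using that r_powr by (intro lower) auto
  qed
  have top: "filterlim (\<lambda>t. ln t / ln r) at_top (at_right 0)"
  proof -
    have "filterlim (\<lambda>t. - ln t :: real) at_top (at_right 0)"
      using ln_at_0 by (simp add: filterlim_uminus_at_top)
    then have "filterlim (\<lambda>t. (- 1 / ln r) * - ln t) at_top (at_right 0)"
      using ln_r_neg by (intro filterlim_tendsto_pos_mult_at_top[OF tendsto_const]) (auto simp: field_simps)
    then show ?thesis by simp
  qed
  have "((\<lambda>t. ln (f (r powr (ln t / ln r))) / (ln t / ln r)) \<longlongrightarrow> g) (at_right 0)"
    by (rule filterlim_compose[OF lim top])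
  then have "((\<lambda>t. ln (f (r powr (ln t / ln r))) / (ln t / ln r) / ln r) \<longlongrightarrow> g / ln r) (at_right 0)"
    using ln_r_neg by (intro tendsto_divide) auto
  moreover have "eventually (\<lambda>t. ln (f (r powr (ln t / ln r))) / (ln t / ln r) / ln r = ln (f t) / ln t) (at_right 0)"
    using eventually_at_right_less[of 0]
  proof eventually_elim
    case (elim t)
    then have "r powr (ln t / ln r) = t" using ln_r_neg r_pos by (simp add: powr_def)
    then show ?case using ln_r_neg by simp
  qed
  ultimately have "((\<lambda>t. ln (f t) / ln t) \<longlongrightarrow> g / ln r) (at_right 0)"
    by (rule Lim_transform_eventually)
  then show ?thesis using that[OF xmid] by (simp add: f_def)
qed

end

section \<open>Local dimensions\<close>

lemma const_div_ln_tendsto_0: "((\<lambda>t::real. c / ln t) \<longlongrightarrow> 0) (at_right 0)"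
  by (rule tendsto_divide_0[OF tendsto_const filterlim_at_bot_imp_at_infinity[OF ln_at_0]])

lemma eventually_less_1_at_right_0: "eventually (\<lambda>t::real. t < 1) (at_right 0)"
  by (metis eventually_at_right_field zero_less_one)

text \<open>
  A power bound with an arbitrary constant determines the dimension, since the constant
  disappears after division by \<open>ln t\<close>.\<close>

lemma local_dim_ge:
  assumes "has_local_dim M x d" "0 < C"
    and "\<And>t. \<lbrakk>0 < t; t \<le> 1\<rbrakk> \<Longrightarrow> measure M {x - t..x + t} \<le> C * t powr a"
    and pos: "\<And>t. \<lbrakk>0 < t; t \<le> 1\<rbrakk> \<Longrightarrow> 0 < measure M {x - t..x + t}"
  shows "a \<le> d"
proof (rule tendsto_le[OF trivial_limit_at_right_real])
  show "((\<lambda>t. ln (measure M {x - t..x + t}) / ln t) \<longlongrightarrow> d) (at_right 0)"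
    using assms(1) by (simp add: has_local_dim_def)
  show "((\<lambda>t. ln C / ln t + a) \<longlongrightarrow> a) (at_right 0)"
    using tendsto_add[OF const_div_ln_tendsto_0 tendsto_const, of "ln C" a] by simp
  from eventually_at_right_less[of 0] eventually_less_1_at_right_0
  show "eventually (\<lambda>t. ln C / ln t + a \<le> ln (measure M {x - t..x + t}) / ln t) (at_right 0)"
  proof eventually_elim
    case (elim t)
    have "ln (measure M {x - t..x + t}) \<le> ln (C * t powr a)"
      using assms elim by (subst ln_le_cancel_iff) auto
    also have "\<dots> = ln C + a * ln t" using elim assms(2) by (simp add: ln_mult ln_powr)
    finally have "(ln C + a * ln t) / ln t \<le> ln (measure M {x - t..x + t}) / ln t"
      using elim by (intro divide_right_mono_neg) auto
    then show ?case using elim by (simp add: add_divide_distrib)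
  qed
qed

lemma local_dim_le:
  assumes "has_local_dim M x d" "0 < c"
    and "\<And>t. \<lbrakk>0 < t; t \<le> 1\<rbrakk> \<Longrightarrow> c * t powr b \<le> measure M {x - t..x + t}"
  shows "d \<le> b"
proof (rule tendsto_le[OF trivial_limit_at_right_real])
  show "((\<lambda>t. ln (measure M {x - t..x + t}) / ln t) \<longlongrightarrow> d) (at_right 0)"
    using assms(1) by (simp add: has_local_dim_def)
  show "((\<lambda>t. ln c / ln t + b) \<longlongrightarrow> b) (at_right 0)"
    using tendsto_add[OF const_div_ln_tendsto_0 tendsto_const, of "ln c" b] by simp
  from eventually_at_right_less[of 0] eventually_less_1_at_right_0
  show "eventually (\<lambda>t. ln (measure M {x - t..x + t}) / ln t \<le> ln c / ln t + b) (at_right 0)"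
  proof eventually_elim
    case (elim t)
    have "0 < c * t powr b" using assms elim by simp
    then have "ln (c * t powr b) \<le> ln (measure M {x - t..x + t})"
      using assms(3)[of t] elim by (subst ln_le_cancel_iff) auto
    moreover have "ln (c * t powr b) = ln c + b * ln t" using elim assms(2) by (simp add: ln_mult ln_powr)
    ultimately have "ln (measure M {x - t..x + t}) / ln t \<le> (ln c + b * ln t) / ln t"
      using elim by (intro divide_right_mono_neg) auto
    then show ?case using elim by (simp add: add_divide_distrib)
  qed
qed

lemma in_supp:
  assumes "finite_measure M" "sets M = sets borel"
    and "\<And>t. \<lbrakk>0 < t; t \<le> 1\<rbrakk> \<Longrightarrow> 0 < measure M {x - t..x + t}"
  shows "x \<in> supp M"
  unfolding supp_def
proof (safe)
  fix U :: "real set" assume U: "open U" "x \<in> U"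
  then obtain e where e: "e > 0" "cball x e \<subseteq> U" using open_contains_cball by blast
  define t where "t = min e 1"
  have "{x - t..x + t} \<subseteq> U" using e unfolding cball_eq_atLeastAtMost by (force simp: t_def)
  then have "measure M {x - t..x + t} \<le> measure M U"
    using U assms by (intro finite_measure.finite_measure_mono) auto
  then show "0 < measure M U" using assms(3)[of t] e by (simp add: t_def)
qed

text \<open>
  Between consecutive powers of \<open>r\<close> the monotone function \<open>h\<close> varies
  by at most the factor \<open>p\<close>, so that \<open>ln (h t)\<close> stays within a bounded
  distance of \<open>ln p * (ln t / ln r)\<close>.\<close>

lemma dim_of_scaling:
  fixes h :: "real \<Rightarrow> real"
  assumes scale: "\<And>t. \<lbrakk>0 < t; t \<le> r\<^sup>2\<rbrakk> \<Longrightarrow> h (r * t) = p * h t"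
    and mono: "\<And>s t. \<lbrakk>0 < s; s \<le> t\<rbrakk> \<Longrightarrow> h s \<le> h t"
    and p: "0 < p" and h: "0 < h (r\<^sup>2)"
  shows "((\<lambda>t. ln (h t) / ln t) \<longlongrightarrow> ln p / ln r) (at_right 0)"
    and "\<And>t. 0 < t \<Longrightarrow> 0 < h t"
proof -
  have pw: "h (r ^ (n + 2)) = p ^ n * h (r\<^sup>2)" for n
  proof (induction n)
    case (Suc n)
    have "r ^ (n + 2) \<le> r\<^sup>2" using r_pos r_less_1 by (intro power_decreasing) auto
    then have "h (r * r ^ (n + 2)) = p * h (r ^ (n + 2))" using r_pos by (intro scale) auto
    then show ?case using Suc by simp
  qed (simp add: power2_eq_square)
  show pos: "0 < h t" if t: "0 < t" for t
  proof -
    obtain n where "r ^ n < t" using real_arch_pow_inv[OF t r_less_1] by blast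
    moreover have "r ^ (n + 2) \<le> r ^ n" using r_pos r_less_1 by (intro power_decreasing) auto
    ultimately have "r ^ (n + 2) \<le> t" by linarith
    then have "h (r ^ (n + 2)) \<le> h t" using r_pos by (intro mono) auto
    moreover have "0 < h (r ^ (n + 2))" unfolding pw using p h by simp
    ultimately show ?thesis by linarith
  qed
  define D where "D = 3 * \<bar>ln p\<bar> + \<bar>ln (h (r\<^sup>2))\<bar>"
  have lnp: "ln (p ^ m * h (r\<^sup>2)) = real m * ln p + ln (h (r\<^sup>2))" for m
    using p h by (simp add: ln_mult ln_realpow)
  have r2: "r\<^sup>2 < 1" using r_pos r_square by simp
  have bound: "\<bar>ln (h t) - ln p * (ln t / ln r)\<bar> \<le> D" if t: "0 < t" "t < r\<^sup>2" for t
  proof -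
    obtain n :: nat where n: "real n \<le> ln t / ln r" "ln t / ln r < real n + 1"
        "r ^ (n + 1) \<le> t" "t \<le> r ^ n"
      using scale_index[OF t(1) order.strict_implies_order[OF less_trans[OF t(2) r2]]] by metis
    define s where "s = ln t / ln r"
    have "2 \<le> n"
    proof (rule ccontr)
      assume "\<not> 2 \<le> n"
      then have "r\<^sup>2 \<le> r ^ (n + 1)" using r_pos r_less_1 by (intro power_decreasing) auto
      then show False using n(3) t(2) by linarith
    qed
    then obtain k where k: "n = k + 2" by (metis add.commute le_Suc_ex)
    have "p ^ Suc k * h (r\<^sup>2) \<le> h t"
      using mono[of "r ^ (n + 1)" t] n r_pos pw[of "Suc k"] k by simp
    then have 1: "real (Suc k) * ln p + ln (h (r\<^sup>2)) \<le> ln (h t)"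
      unfolding lnp[symmetric] using p h pos[OF t(1)] by (subst ln_le_cancel_iff) auto
    have "h t \<le> p ^ k * h (r\<^sup>2)" using mono[of t "r ^ n"] n t pw[of k] k by simp
    then have 2: "ln (h t) \<le> real k * ln p + ln (h (r\<^sup>2))"
      unfolding lnp[symmetric] using p h pos[OF t(1)] by (subst ln_le_cancel_iff) auto
    have "ln p * (Suc k - s) \<le> \<bar>ln p\<bar> * 3" "ln p * (s - Suc k) \<le> \<bar>ln p\<bar> * 3"
         "ln p * (k - s) \<le> \<bar>ln p\<bar> * 3" "ln p * (s - k) \<le> \<bar>ln p\<bar> * 3"
      using n k unfolding s_def by (intro mult_le_abs_mult; simp)+
    then show ?thesis using 1 2 unfolding s_def[symmetric] D_def right_diff_distrib
      by (simp add: mult.commute[of "ln p"])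
  qed
  have z: "((\<lambda>t. \<bar>D / ln t\<bar>) \<longlongrightarrow> 0) (at_right 0)"
    by (rule tendsto_rabs_zero[OF const_div_ln_tendsto_0])
  have "eventually (\<lambda>t. norm (ln (h t) / ln t - ln p / ln r) \<le> \<bar>D / ln t\<bar>) (at_right 0)"
  proof -
    have "0 < r\<^sup>2" using r_pos by simp
    then have "eventually (\<lambda>t::real. t < r\<^sup>2) (at_right 0)"
      by (metis eventually_at_right_field)
    with eventually_at_right_less[of 0] show ?thesis
    proof eventually_elim
      case (elim t)
      have l: "ln t < 0" using elim r2 by simp
      have "ln (h t) / ln t - ln p / ln r = (ln (h t) - ln p * (ln t / ln r)) / ln t"
        using l by (simp add: field_simps)
      then show ?case using bound[of t] elim l 
        using abs_ge_zero[THEN order_trans, OF bound[of t]] l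
        by (simp add: abs_divide divide_right_mono_neg)
    qed
  qed
  then have "((\<lambda>t. ln (h t) / ln t - ln p / ln r) \<longlongrightarrow> 0) (at_right 0)"
    using z by (rule Lim_null_comparison)
  then show "((\<lambda>t. ln (h t) / ln t) \<longlongrightarrow> ln p / ln r) (at_right 0)"
    by (rule LIM_zero_cancel)
qed

text \<open>
  The exponent survives because enlarging the radius from \<open>t\<close> to \<open>t /
  r\<close> only adds mass; the share \<open>w\<close> enters the constant. In the applications
  \<open>y\<close> is a preimage of \<open>x\<close> under one of the two contractions, whose
  weight is \<open>w\<close>.\<close>

lemma lower_bound_transfer:
  fixes M :: "real measure"
  assumes M: "finite_measure M" "sets M = sets borel" and w: "0 < w"
    and pull: "\<And>t. w * measure M {y - t / r..y + t / r} \<le> measure M {x - t..x + t}"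
    and y: "\<exists>c>0. \<forall>t. 0 < t \<longrightarrow> t \<le> 1 \<longrightarrow> c * t powr b \<le> measure M {y - t..y + t}"
  shows "\<exists>c>0. \<forall>t. 0 < t \<longrightarrow> t \<le> 1 \<longrightarrow> c * t powr b \<le> measure M {x - t..x + t}"
proof -
  interpret finite_measure M by (rule M)
  obtain c where c: "c > 0" "\<And>t. 0 < t \<Longrightarrow> t \<le> 1 \<Longrightarrow> c * t powr b \<le> measure M {y - t..y + t}"
    using y by blast
  have "w * c * t powr b \<le> measure M {x - t..x + t}" if t: "0 < t" "t \<le> 1" for t
  proof -
    have "t \<le> t / r" using t r_pos r_less_1 by (simp add: pos_le_divide_eq mult_left_le)
    then have "measure M {y - t..y + t} \<le> measure M {y - t / r..y + t / r}"
      using M by (intro finite_measure_mono) auto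
    then have "w * (c * t powr b) \<le> w * measure M {y - t / r..y + t / r}"
      using c(2)[OF t] w by (intro mult_left_mono) auto
    then show ?thesis using pull[of t] by (simp add: mult.assoc)
  qed
  then show ?thesis using w c by (intro exI[of _ "w * c"]) auto
qed

context cascade begin

context
  fixes M :: "real measure" and i :: 'n
  assumes finM: "finite_measure M" and setsM: "sets M = sets borel"
    and link: "\<And>x y. \<lbrakk>0 \<le> x; x \<le> y; y \<le> r\<rbrakk> \<Longrightarrow> measure M {x..y} = F x y $ i"
    and Hi_row: "\<And>j. 0 < K Hi $ i $ j"
begin

text \<open>
  Near 0 the map \<open>S0\<close> alone carries the mass, and finitely many applications of its
  inverse move \<open>x\<close> into $[r^3,r]$, where \<open>F_lower\<close> applies. The
  constant deteriorates as \<open>x\<close> approaches 0.\<close>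

lemma measure_lower_left:
  assumes pull: "\<And>x t. p * measure M {x / r - t / r..x / r + t / r} \<le> measure M {x - t..x + t}"
    and p: "0 < p" and x: "0 < x" "x \<le> r"
  shows "\<exists>c>0. \<forall>t. 0 < t \<longrightarrow> t \<le> 1 \<longrightarrow> c * t powr (gmin / ln r) \<le> measure M {x - t..x + t}"
proof -
  interpret finite_measure M by (rule finM)
  have base: "\<exists>c>0. \<forall>t. 0 < t \<longrightarrow> t \<le> 1 \<longrightarrow> c * t powr (gmin / ln r) \<le> measure M {x - t..x + t}"
    if x: "r ^ 3 \<le> x" "x \<le> r" for x
  proof -
    obtain c where c: "0 < c" "\<And>t. \<lbrakk>0 < t; t \<le> 1\<rbrakk>
        \<Longrightarrow> c * t powr (gmin / ln r) \<le> F (max 0 (x - t)) (min r (x + t)) $ i"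
      using F_lower[OF Hi_row x] by blast
    have "F (max 0 (x - t)) (min r (x + t)) $ i \<le> measure M {x - t..x + t}" if t: "0 < t" for t
    proof -
      have "0 < r ^ 3" using r_pos by simp
      then have "0 \<le> x" using x by linarith
      then have "F (max 0 (x - t)) (min r (x + t)) $ i = measure M {max 0 (x - t)..min r (x + t)}"
        using x t r_pos by (intro link[symmetric]) auto
      also have "\<dots> \<le> measure M {x - t..x + t}" using setsM by (intro finite_measure_mono) auto
      finally show ?thesis .
    qed
    then show ?thesis using c order.trans by (intro exI[of _ c]) blast
  qed
  have "\<exists>c>0. \<forall>t. 0 < t \<longrightarrow> t \<le> 1 \<longrightarrow> c * t powr (gmin / ln r) \<le> measure M {x - t..x + t}"
    if "r ^ (n + 3) \<le> x" "x \<le> r" for n x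
    using that
  proof (induction n arbitrary: x)
    case 0
    then show ?case using base[of x] by simp
  next
    case (Suc n)
    show ?case
    proof (cases "r ^ 3 \<le> x")
      case True
      then show ?thesis using base Suc.prems by blast
    next
      case False
      have "r * r ^ (n + 3) \<le> x" using Suc.prems(1) by (simp only: add_Suc power_Suc)
      then have "r ^ (n + 3) \<le> x / r" using r_pos by (simp add: pos_le_divide_eq mult.commute)
      moreover have "x / r \<le> r"
      proof -
        have "r ^ 3 \<le> r * r" using r_pos r_less_1 power_decreasing[of 2 3 r] by (simp add: power2_eq_square)
        then show ?thesis using False r_pos by (simp add: pos_divide_le_eq)
      qed
      ultimately show ?thesis
        using lower_bound_transfer[OF finM setsM p pull Suc.IH] by blast
    qed
  qed
  note * = this
  obtain n where "r ^ n < x" using real_arch_pow_inv[OF x(1) r_less_1] by blast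
  moreover have "r ^ (n + 3) \<le> r ^ n" using r_pos r_less_1 by (intro power_decreasing) auto
  ultimately have "r ^ (n + 3) \<le> x" by linarith
  then show ?thesis using * x(2) by blast
qed

text \<open>
  Inside $(0,1)$ the two power bounds confine every existing dimension, and
  \<open>slope_realised\<close> attains every value between them. The end points contribute
  their own dimensions.\<close>

theorem local_dims_interval:
  assumes C: "0 < C" "\<And>x t. \<lbrakk>0 < t; t \<le> 1\<rbrakk>
      \<Longrightarrow> measure M {x - t..x + t} \<le> C * t powr (gmax / ln r)"
    and lower: "\<And>x. \<lbrakk>0 < x; x < 1\<rbrakk>
      \<Longrightarrow> \<exists>c>0. \<forall>t. 0 < t \<longrightarrow> t \<le> 1 \<longrightarrow> c * t powr (gmin / ln r) \<le> measure M {x - t..x + t}"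
    and d0: "has_local_dim M 0 d0" and d1: "has_local_dim M 1 d1"
  shows "local_dims M = {gmax / ln r..gmin / ln r} \<union> {d0, d1}"
proof (intro equalityI subsetI)
  fix d assume "d \<in> local_dims M"
  then obtain x where x: "0 \<le> x" "x \<le> 1" "has_local_dim M x d" by (auto simp: local_dims_def)
  have unique: "d = d'" if "has_local_dim M x d'" for d'
    using x(3) that tendsto_unique[OF trivial_limit_at_right_real] unfolding has_local_dim_def by blast
  consider "x = 0" | "x = 1" | "0 < x" "x < 1" using x by linarith
  then show "d \<in> {gmax / ln r..gmin / ln r} \<union> {d0, d1}"
  proof cases
    case 1 then show ?thesis using unique d0 by blast
  next
    case 2 then show ?thesis using unique d1 by blast
  next
    case 3
    then obtain c where c: "0 < c"
        "\<And>t. \<lbrakk>0 < t; t \<le> 1\<rbrakk> \<Longrightarrow> c * t powr (gmin / ln r) \<le> measure M {x - t..x + t}"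
      using lower by blast
    have pos: "0 < measure M {x - t..x + t}" if t: "0 < t" "t \<le> 1" for t
    proof -
      have "0 < c * t powr (gmin / ln r)" using c(1) t by simp
      then show ?thesis using c(2)[OF t] by linarith
    qed
    have "gmax / ln r \<le> d" by (rule local_dim_ge[OF x(3) C(1) C(2) pos])
    moreover have "d \<le> gmin / ln r" by (rule local_dim_le[OF x(3) c])
    ultimately show ?thesis by simp
  qed
next
  fix d assume d: "d \<in> {gmax / ln r..gmin / ln r} \<union> {d0, d1}"
  show "d \<in> local_dims M"
  proof (cases "d = d0 \<or> d = d1")
    case True then show ?thesis using d0 d1 by (auto simp: local_dims_def)
  next
    case False
    then have "gmax / ln r \<le> d" "d \<le> gmin / ln r" using d by auto
    then have "gmin \<le> d * ln r" "d * ln r \<le> gmax"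
      using ln_r_neg by (simp_all add: neg_divide_le_eq neg_le_divide_eq)
    then obtain x where x: "r ^ 3 \<le> x" "x \<le> r\<^sup>2"
        and lim: "((\<lambda>t. ln (F (x - t) (x + t) $ i) / ln t) \<longlongrightarrow> d * ln r / ln r) (at_right 0)"
      using slope_realised[OF _ _ Hi_row] by blast
    have x01: "0 < r ^ 3" "r\<^sup>2 < r" using r_pos r_square r_bounds by auto
    then have x01': "0 < x" "x < 1" "x < r" using x r_less_1 by linarith+
    obtain c where c: "0 < c"
        "\<And>t. \<lbrakk>0 < t; t \<le> 1\<rbrakk> \<Longrightarrow> c * t powr (gmin / ln r) \<le> measure M {x - t..x + t}"
      using lower x01' by blast
    have pos: "0 < measure M {x - t..x + t}" if t: "0 < t" "t \<le> 1" for t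
    proof -
      have "0 < c * t powr (gmin / ln r)" using c(1) t by simp
      then show ?thesis using c(2)[OF t] by linarith
    qed
    have "x \<in> supp M" by (rule in_supp[OF finM setsM pos])
    moreover have "((\<lambda>t. ln (measure M {x - t..x + t}) / ln t) \<longlongrightarrow> d) (at_right 0)"
    proof (rule Lim_transform_eventually)
      show "((\<lambda>t. ln (F (x - t) (x + t) $ i) / ln t) \<longlongrightarrow> d) (at_right 0)"
        using lim ln_r_neg by simp
      have "0 < min x (r - x)" using x01' by simp
      then have "eventually (\<lambda>t::real. t < min x (r - x)) (at_right 0)"
        by (metis eventually_at_right_field)
      with eventually_at_right_less[of 0]
      show "eventually (\<lambda>t. ln (F (x - t) (x + t) $ i) / ln t = ln (measure M {x - t..x + t}) / ln t) (at_right 0)"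
        by eventually_elim (subst link, auto)
    qed
    ultimately show ?thesis using x01' by (auto simp: local_dims_def has_local_dim_def intro!: bexI[of _ x])
  qed
qed

end

end

section \<open>Self-similar measures\<close>

lemma vimage_S0: "S0 -` {x..y} = {x / r..y / r}"
proof -
  have "x \<le> r * z \<longleftrightarrow> x / r \<le> z" "r * z \<le> y \<longleftrightarrow> z \<le> y / r" for z
    using r_pos by (simp_all add: pos_divide_le_eq pos_le_divide_eq mult.commute)
  then show ?thesis by (simp add: set_eq_iff S0_def)
qed

lemma vimage_S1: "S1 -` {x..y} = {(x - r\<^sup>2) / r..(y - r\<^sup>2) / r}"
proof -
  have "x \<le> r * z + 1 - r \<longleftrightarrow> (x - r\<^sup>2) / r \<le> z" "r * z + 1 - r \<le> y \<longleftrightarrow> z \<le> (y - r\<^sup>2) / r" for z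
    using r_pos unfolding r_square by (simp_all add: pos_divide_le_eq pos_le_divide_eq mult.commute) linarith+
  then show ?thesis by (simp add: set_eq_iff S1_def)
qed

lemma vimage_R1: "R1 -` {x..y} = {(1 - y) / r..(1 - x) / r}"
proof -
  have "x \<le> 1 - r * z \<longleftrightarrow> z \<le> (1 - x) / r" "1 - r * z \<le> y \<longleftrightarrow> (1 - y) / r \<le> z" for z
    using r_pos by (simp_all add: pos_divide_le_eq pos_le_divide_eq mult.commute) linarith+
  then show ?thesis by (auto simp add: set_eq_iff R1_def)
qed

text \<open>
  What the two measures have in common: the first map is \<open>S0\<close> in both cases, with
  the smaller weight.\<close>

locale self_similar_measure =
  fixes M :: "real measure" and p q :: real and g :: "real \<Rightarrow> real"
  assumes self_similar: "self_similar p S0 q g M"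
    and p: "0 < p" "p < 1 / 2" and pq: "p + q = 1"
begin

sublocale prob_space M
  using self_similar unfolding self_similar_def by blast

lemma sets_M [simp, measurable_cong]: "sets M = sets borel"
  using self_similar unfolding self_similar_def by blast

lemma q: "1 / 2 < q" "q < 1"
  using p pq by linarith+

lemma pq_pos: "0 < p" "0 < q" "0 < p * q"
  using p q by auto

abbreviation h :: "real \<Rightarrow> real \<Rightarrow> real" where
  "h x y \<equiv> measure M {x..y}"

lemma h_self_similar: "h x y = p * h (x / r) (y / r) + q * measure M (g -` {x..y})"
proof -
  have "\<forall>E\<in>sets borel. measure M E = p * measure M (S0 -` E) + q * measure M (g -` E)"
    using self_similar unfolding self_similar_def by blast
  from this[rule_format, of "{x..y}"] show ?thesis unfolding vimage_S0 by simp
qed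

lemma null_outside:
  assumes "E \<in> sets borel" "E \<inter> {0..1} = {}" shows "measure M E = 0"
proof -
  have "measure M (E \<union> {0..1}) = measure M E + measure M {0..1}"
    using assms by (intro finite_measure_Union) auto
  moreover have "measure M {0..1} = 1" using self_similar unfolding self_similar_def by blast
  ultimately show ?thesis using prob_le_1[of "E \<union> {0..1}"] measure_nonneg[of M E] by linarith
qed

lemma h_mono: "x' \<le> x \<Longrightarrow> y \<le> y' \<Longrightarrow> h x y \<le> h x' y'"
  by (intro finite_measure_mono) auto

lemma h_split: "h x z \<le> h x y + h y z"
proof -
  have "{x..z} \<subseteq> {x..y} \<union> {y..z}" by auto
  then have "h x z \<le> measure M ({x..y} \<union> {y..z})" by (intro finite_measure_mono) simp_all
  also have "\<dots> \<le> h x y + h y z" by (intro measure_Un_le) simp_all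
  finally show ?thesis .
qed

text \<open>
  Closed intervals that meet $[0,1]$ in an end point at most; needed because neighbouring tiles
  share end points.\<close>

lemma h_null:
  assumes "measure M {0} = 0" "measure M {1} = 0" and "y \<le> 0 \<or> 1 \<le> x"
  shows "h x y = 0"
proof -
  have "{x..y} \<subseteq> {0} \<union> {1} \<union> ({x..y} - {0..1})" using assms(3) by force
  then have "h x y \<le> measure M ({0} \<union> {1} \<union> ({x..y} - {0..1}))"
    by (intro finite_measure_mono) simp_all
  also have "\<dots> \<le> measure M ({0} \<union> {1}) + measure M ({x..y} - {0..1})"
    by (intro measure_Un_le) simp_all
  also have "measure M ({0} \<union> {1}) \<le> measure M {0} + measure M {1}"
    by (intro measure_Un_le) simp_all
  also have "measure M ({x..y} - {0..1}) = 0" by (intro null_outside) (simp, blast)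
  finally have "h x y \<le> measure M {0} + measure M {1} + 0" by simp
  then show ?thesis using assms(1,2) measure_nonneg[of M "{x..y}"] by linarith
qed

lemma h_clip: "h x y = h (max 0 x) (min 1 y)"
proof -
  have "{x..y} \<subseteq> {max 0 x..min 1 y} \<union> ({x..y} - {0..1})" by (simp add: subset_iff)
  then have "h x y \<le> measure M ({max 0 x..min 1 y} \<union> ({x..y} - {0..1}))"
    by (intro finite_measure_mono) simp_all
  also have "\<dots> \<le> h (max 0 x) (min 1 y) + measure M ({x..y} - {0..1})"
    by (intro measure_Un_le) simp_all
  also have "measure M ({x..y} - {0..1}) = 0" by (intro null_outside) (simp, blast)
  finally have "h x y \<le> h (max 0 x) (min 1 y) + 0" .
  moreover have "h (max 0 x) (min 1 y) \<le> h x y" by (rule h_mono) simp_all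
  ultimately show ?thesis by linarith
qed

lemma h_unit: "h 0 1 = 1"
  using self_similar unfolding self_similar_def by blast

lemma ball_le_two_halves:
  assumes left: "\<And>a b. \<lbrakk>0 \<le> a; a \<le> b; b \<le> r; b - a \<le> 2 * t\<rbrakk> \<Longrightarrow> h a b \<le> B"
    and right: "\<And>a b. \<lbrakk>r \<le> a; a \<le> b; b \<le> 1; b - a \<le> 2 * t\<rbrakk> \<Longrightarrow> h a b \<le> B"
    and t: "0 < t" and B: "0 \<le> B"
  shows "h (x - t) (x + t) \<le> 2 * B"
proof -
  define u where "u = max 0 (x - t)"
  define v where "v = min 1 (x + t)"
  have uv: "0 \<le> u" "v \<le> 1" "v - u \<le> 2 * t" using t by (auto simp: u_def v_def)
  consider "v < u" | "u \<le> v" "v \<le> r" | "r \<le> u" "u \<le> v" | "u \<le> r" "r \<le> v" by linarith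
  then have "h u v \<le> 2 * B"
  proof cases
    case 1 then show ?thesis using B by simp
  next
    case 2 then show ?thesis using left[of u v] uv B by linarith
  next
    case 3 then show ?thesis using right[of u v] uv B by linarith
  next
    case 4 then show ?thesis using left[of u r] right[of r v] h_split[of u v r] uv by linarith
  qed
  then show ?thesis unfolding u_def v_def using h_clip[of "x - t" "x + t"] by simp
qed

lemma pull_S0: "p * h (x / r - t / r) (x / r + t / r) \<le> h (x - t) (x + t)"
  using h_self_similar[of "x - t" "x + t"] q measure_nonneg[of M "g -` {x - t..x + t}"]
  by (simp add: diff_divide_distrib add_divide_distrib)

lemma two_sided_local_dim:
  assumes scale: "\<And>t. \<lbrakk>0 < t; t \<le> r\<^sup>2\<rbrakk> \<Longrightarrow> h (x - r * t) (x + r * t) = w * h (x - t) (x + t)"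
    and w: "0 < w" and pos: "0 < h (x - r\<^sup>2) (x + r\<^sup>2)"
  shows "has_local_dim M x (ln w / ln r)"
proof -
  have mono: "h (x - s) (x + s) \<le> h (x - t) (x + t)" if "s \<le> t" for s t
    using that by (intro h_mono) simp_all
  note dim = dim_of_scaling[where h = "\<lambda>t. h (x - t) (x + t)", OF scale mono w pos]
  have "((\<lambda>t. ln (h (x - t) (x + t)) / ln t) \<longlongrightarrow> ln w / ln r) (at_right 0)"
    using dim(1) by simp
  moreover have "0 < h (x - t) (x + t)" if "0 < t" for t
    using dim(2) that by simp
  then have "x \<in> supp M" by (intro in_supp finite_measure_axioms sets_M)
  ultimately show ?thesis by (simp add: has_local_dim_def)
qed

end

section \<open>The measure $\mu$\<close>

text \<open>
  The state of an interval $[x,y] \subseteq [0,r]$ is the pair of the masses of $[x,y]$ and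
  $[x+r^2,y+r^2]$. The matrix of \<open>Mid\<close> has rank one, because the middle tile and
  its translate both reduce to a copy of the overlap $[r^2,r]$ of the images of $[0,1]$ under
  the two maps.\<close>

fun K_mu :: "real \<Rightarrow> real \<Rightarrow> letter \<Rightarrow> real^2^2" where
  "K_mu p q Lo = vector [vector [p\<^sup>2, 0], vector [p * q, p * q]]"
| "K_mu p q Mid = vector [vector [p * q * p, p * q * p], vector [p * q * q, p * q * q]]"
| "K_mu p q Hi = vector [vector [p * q, p * q], vector [0, q\<^sup>2]]"

lemma matrix_vector_2: "(A *v x) $ i = A $ i $ 1 * x $ 1 + A $ i $ (2::2) * x $ 2"
  by (simp add: matrix_vector_mult_def sum_2)

lemma vector_matrix_2: "(x v* A) $ j = x $ 1 * A $ 1 $ j + x $ (2::2) * A $ 2 $ j"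
  by (simp add: vector_matrix_mult_def sum_2 mult.commute)

lemma vec_eq_2: "x = y \<longleftrightarrow> x $ 1 = y $ 1 \<and> x $ (2::2) = y $ 2"
  by (simp add: vec_eq_iff forall_2)

lemma exp_half_ln: "0 < z \<Longrightarrow> exp (ln z / 2) = sqrt z"
  by (simp flip: ln_sqrt)

text \<open>
  The stretching factors \<open>exp (g * len l)\<close> for the two shapes of rates that occur.\<close>

lemma exp_slope:
  assumes "0 < z"
  shows "exp (ln z / 2 * real (len Lo)) = z" "exp (ln z / 2 * real (len Mid)) = z * sqrt z"
    "exp (ln z / 2 * real (len Hi)) = z"
    "exp (ln z * real (len Lo)) = z\<^sup>2" "exp (ln z * real (len Mid)) = z ^ 3"
    "exp (ln z * real (len Hi)) = z\<^sup>2"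
proof -
  have "exp (ln z / 2 * 3) = exp (ln z) * exp (ln z / 2)" by (simp flip: exp_add)
  then show "exp (ln z / 2 * real (len Mid)) = z * sqrt z" using assms by (simp add: exp_half_ln)
  have "exp (ln z * real n) = z ^ n" for n
    using assms by (simp add: exp_of_nat2_mult)
  from this[of 2] this[of 3] show "exp (ln z * real (len Lo)) = z\<^sup>2"
      "exp (ln z * real (len Mid)) = z ^ 3" "exp (ln z * real (len Hi)) = z\<^sup>2"
    by simp_all
qed (use assms in simp_all)

locale mu_measure = self_similar_measure M p q S1 for M p q
begin

lemma h_rec: "h x y = p * h (x / r) (y / r) + q * h ((x - r\<^sup>2) / r) ((y - r\<^sup>2) / r)"
  using h_self_similar[of x y] by (simp add: vimage_S1)

lemma no_atoms: "measure M {0} = 0" "measure M {1} = 0"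
proof -
  have "h (- r) (- r) = 0" "h (1 / r) (1 / r) = 0"
    using r_pos r_less_1 by (auto intro!: null_outside simp: field_simps)
  moreover have "(0 - r\<^sup>2) / r = - r" "(1 - r\<^sup>2) / r = 1"
    using r_pos by (simp add: power2_eq_square, simp add: r_square)
  ultimately have "h 0 0 = p * h 0 0" "h 1 1 = q * h 1 1"
    using h_rec[of 0 0] h_rec[of 1 1] by simp_all
  then have "(1 - p) * h 0 0 = 0" "(1 - q) * h 1 1 = 0" by (simp_all add: algebra_simps)
  then show "measure M {0} = 0" "measure M {1} = 0" using p q by auto
qed

lemmas h_zero = h_null[OF no_atoms]

lemma h_left: "y \<le> r \<Longrightarrow> h (r * x) (r * y) = p * h x y"
proof -
  assume y: "y \<le> r"
  have "(r * y - r\<^sup>2) / r = y - r" using r_pos by (simp add: power2_eq_square field_simps)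
  then have "h ((r * x - r\<^sup>2) / r) ((r * y - r\<^sup>2) / r) = 0" using y by (intro h_zero) simp
  then show ?thesis using h_rec[of "r * x" "r * y"] r_pos by simp
qed

lemma h_right: "0 \<le> x \<Longrightarrow> h (r + r * x) (r + r * y) = q * h (x + r\<^sup>2) (y + r\<^sup>2)"
proof -
  assume x: "0 \<le> x"
  have "(r + r * x) / r = 1 + x" using r_pos by (simp add: field_simps)
  then have "h ((r + r * x) / r) ((r + r * y) / r) = 0" using x by (intro h_zero) simp
  moreover have "(r + r * z - r\<^sup>2) / r = z + r\<^sup>2" for z
  proof -
    have "(r + r * z - r\<^sup>2) / r = 1 + z - r" using r_pos by (simp add: field_simps power2_eq_square)
    then show ?thesis by (simp add: r_square)
  qed
  ultimately show ?thesis using h_rec[of "r + r * x" "r + r * y"] by simp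
qed

text \<open>
  An interval in the overlap is pulled back through \<open>S0\<close> and then
  \<open>S1\<close>, or through \<open>S1\<close> and then \<open>S0\<close>. Both routes carry
  the weight \<open>p * q\<close>, and $r^2 + r = 1$ makes their results differ exactly by the
  translation by $r^2$.\<close>

lemma h_middle:
  assumes "0 \<le> x" "y \<le> r"
  shows "h (r\<^sup>2 + r\<^sup>2 * x) (r\<^sup>2 + r\<^sup>2 * y) = p * q * (h x y + h (x + r\<^sup>2) (y + r\<^sup>2))"
proof -
  have "(r\<^sup>2 + r\<^sup>2 * z) / r = r + r * z" "(r\<^sup>2 + r\<^sup>2 * z - r\<^sup>2) / r = r * z" for z
    using r_pos by (simp_all add: power2_eq_square field_simps)
  then show ?thesis
    using h_rec[of "r\<^sup>2 + r\<^sup>2 * x" "r\<^sup>2 + r\<^sup>2 * y"] h_left[OF assms(2), of x] h_right[OF assms(1), of y]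
    by (simp add: algebra_simps)
qed

definition F :: "real \<Rightarrow> real \<Rightarrow> real^2" where
  "F x y = vector [h x y, h (x + r\<^sup>2) (y + r\<^sup>2)]"

lemma F_tile_mu:
  assumes "0 \<le> x" "x \<le> y" "y \<le> r"
  shows "F (T l x) (T l y) = K_mu p q l *v F x y"
proof (cases l)
  case Lo
  have e: "r\<^sup>2 * z = r * (r * z)" "r\<^sup>2 * z + r\<^sup>2 = r\<^sup>2 + r\<^sup>2 * z" for z
    by (simp_all add: power2_eq_square)
  have "r * y \<le> r" using assms r_pos r_less_1 by (simp add: mult_left_le)
  then have "h (r\<^sup>2 * x) (r\<^sup>2 * y) = p * (p * h x y)"
    unfolding e(1) using h_left assms by simp
  moreover have "h (r\<^sup>2 * x + r\<^sup>2) (r\<^sup>2 * y + r\<^sup>2) = p * q * (h x y + h (x + r\<^sup>2) (y + r\<^sup>2))"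
    unfolding e(2) using h_middle assms by simp
  ultimately show ?thesis using Lo
    by (simp add: vec_eq_2 matrix_vector_2 F_def power2_eq_square[of p] algebra_simps)
next
  case Mid
  have e: "r ^ 3 + r ^ 3 * z = r * (r\<^sup>2 + r\<^sup>2 * z)" "r ^ 3 + r ^ 3 * z + r\<^sup>2 = r + r * (r\<^sup>2 * z)" for z
    using r_square r_cube by (simp_all add: algebra_simps power2_eq_square power3_eq_cube)
  have "r\<^sup>2 + r\<^sup>2 * y \<le> r\<^sup>2 + r\<^sup>2 * r" using assms by (intro add_left_mono mult_left_mono) auto
  also have "\<dots> = r" using r_square r_cube by (simp add: power2_eq_square power3_eq_cube)
  finally have "h (r ^ 3 + r ^ 3 * x) (r ^ 3 + r ^ 3 * y) = p * (p * q * (h x y + h (x + r\<^sup>2) (y + r\<^sup>2)))"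
    unfolding e(1) using h_left h_middle assms by simp
  moreover have "h (r ^ 3 + r ^ 3 * x + r\<^sup>2) (r ^ 3 + r ^ 3 * y + r\<^sup>2)
      = q * (p * q * (h x y + h (x + r\<^sup>2) (y + r\<^sup>2)))"
    unfolding e(2) using h_right[of "r\<^sup>2 * x" "r\<^sup>2 * y"] h_middle[of x y] assms by (simp add: add.commute)
  ultimately show ?thesis using Mid
    by (simp add: vec_eq_2 matrix_vector_2 F_def algebra_simps)
next
  case Hi
  have e: "r\<^sup>2 + r\<^sup>2 * z + r\<^sup>2 = r + r * (r ^ 3 + r * z)" "r ^ 3 + r * z + r\<^sup>2 = r + r * z" for z
    using r_square r_cube r_power_4 by (simp_all add: algebra_simps power2_eq_square power4_eq_xxxx power3_eq_cube)
  have "h (r\<^sup>2 + r\<^sup>2 * x + r\<^sup>2) (r\<^sup>2 + r\<^sup>2 * y + r\<^sup>2) = q * (q * h (x + r\<^sup>2) (y + r\<^sup>2))"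
    unfolding e(1) using h_right[of "r ^ 3 + r * x" "r ^ 3 + r * y"] h_right[of x y] assms r_pos
    unfolding e(2) by simp
  then show ?thesis using Hi h_middle[of x y] assms
    by (simp add: vec_eq_2 matrix_vector_2 F_def power2_eq_square[of q] algebra_simps)
qed

lemma h_ends_pos: "0 < h 0 r" "0 < h (r\<^sup>2) 1"
proof -
  have "h 0 r \<ge> p * h 0 1" using h_rec[of 0 r] r_pos q by simp
  then show "0 < h 0 r" using h_unit p by simp
  have "(1 - r\<^sup>2) / r = 1" "(r\<^sup>2 - r\<^sup>2) / r = 0" using r_pos r_square by simp_all
  then have "h (r\<^sup>2) 1 \<ge> q * h 0 1" using h_rec[of "r\<^sup>2" 1] p by simp
  then show "0 < h (r\<^sup>2) 1" using h_unit q by simp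
qed

sublocale cascade "K_mu p q" F
proof
  have pq0: "0 < p" "0 < q" using p q by auto
  show "nonneg (K_mu p q l)" for l using pq0 by (cases l) (auto simp: forall_2)
  show "0 < K_mu p q Mid $ i $ j" for i j using pq0 exhaust_2[of i] exhaust_2[of j] by auto
  show "\<exists>i. 0 < K_mu p q l $ i $ j" for l j
    using pq0 exhaust_2[of j] by (intro exI[of _ "if l = Hi then 1 else 2"], cases l) auto
  show "F (T l x) (T l y) = K_mu p q l *v F x y" if "0 \<le> x" "x \<le> y" "y \<le> r" for x y l
    using F_tile_mu that by blast
  show "F x y $ i \<le> F x' y' $ i" if "0 \<le> x'" "x' \<le> x" "x \<le> y" "y \<le> y'" "y' \<le> r" for x' x y y' i
    using that exhaust_2[of i] by (auto simp: F_def intro!: h_mono)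
  show "F x z $ i \<le> F x y $ i + F y z $ i" for x y z i
    using exhaust_2[of i] by (auto simp: F_def h_split)
  show "0 < F 0 r $ i" for i
    using exhaust_2[of i] h_ends_pos r_square by (auto simp: F_def)
qed

lemma has_local_dim_0: "has_local_dim M 0 (ln p / ln r)"
proof (rule two_sided_local_dim)
  fix t assume t: "0 < t" "t \<le> r\<^sup>2"
  then have "t \<le> r" using r_square r_bounds by linarith
  show "h (0 - r * t) (0 + r * t) = p * h (0 - t) (0 + t)" using h_left[of t "- t"] \<open>t \<le> r\<close> by simp
next
  have "h (r * - r) (r * r) = p * h (- r) r" by (rule h_left) simp
  moreover have "h 0 r \<le> h (- r) r" using r_pos by (intro h_mono) auto
  ultimately show "0 < h (0 - r\<^sup>2) (0 + r\<^sup>2)"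
    using h_ends_pos p by (simp add: power2_eq_square)
qed (rule p)

lemma has_local_dim_1: "has_local_dim M 1 (ln q / ln r)"
proof (rule two_sided_local_dim)
  have scale: "h (1 - r * t) (1 + r * t) = q * h (1 - t) (1 + t)" if t: "t \<le> r" for t
  proof -
    have "1 \<le> (1 - r * t) / r"
    proof -
      have "r * t \<le> r * r" using t r_pos by simp
      then have "r \<le> 1 - r * t" using r_square unfolding power2_eq_square by linarith
      then show ?thesis using r_pos by (simp add: pos_le_divide_eq)
    qed
    then have "h ((1 - r * t) / r) ((1 + r * t) / r) = 0" by (intro h_zero) simp
    moreover have "(1 - r * t - r\<^sup>2) / r = 1 - t" "(1 + r * t - r\<^sup>2) / r = 1 + t"
      using r_pos r_square by (simp_all add: field_simps)
    ultimately show ?thesis using h_rec[of "1 - r * t" "1 + r * t"] by simp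
  qed
  show "h (1 - r * t) (1 + r * t) = q * h (1 - t) (1 + t)" if "0 < t" "t \<le> r\<^sup>2" for t
    using that r_square r_bounds by (intro scale) linarith
  have "h (r\<^sup>2) 1 \<le> h (1 - r) (1 + r)" using r_pos r_square by (intro h_mono) auto
  then show "0 < h (1 - r\<^sup>2) (1 + r\<^sup>2)"
    using scale[of r] h_ends_pos q by (simp add: power2_eq_square)
qed (use q in simp)

lemma upper_bound:
  obtains C where "0 < C"
    "\<And>x t. \<lbrakk>0 < t; t \<le> 1\<rbrakk> \<Longrightarrow> h (x - t) (x + t) \<le> C * t powr (gmax / ln r)"
proof -
  obtain C where C: "0 < C" "\<And>x y t i. \<lbrakk>0 \<le> x; x \<le> y; y \<le> r; y - x \<le> 4 * t; 0 < t; t \<le> 1\<rbrakk>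
      \<Longrightarrow> F x y $ i \<le> C * t powr (gmax / ln r)" using F_upper by blast
  show ?thesis
  proof (rule that[of "2 * C"])
    fix x t :: real assume t: "0 < t" "t \<le> 1"
    have "h (x - t) (x + t) \<le> 2 * (C * t powr (gmax / ln r))"
    proof (rule ball_le_two_halves[OF _ _ t(1)])
      show "h a b \<le> C * t powr (gmax / ln r)" if "0 \<le> a" "a \<le> b" "b \<le> r" "b - a \<le> 2 * t" for a b
        using C(2)[of a b t 1] that t by (simp add: F_def)
      show "h a b \<le> C * t powr (gmax / ln r)" if "r \<le> a" "a \<le> b" "b \<le> 1" "b - a \<le> 2 * t" for a b
        using C(2)[of "a - r\<^sup>2" "b - r\<^sup>2" t 2] that t r_square r_bounds by (simp add: F_def)
    qed (use C(1) in simp)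
    then show "h (x - t) (x + t) \<le> 2 * C * t powr (gmax / ln r)" by simp
  qed (use C in simp)
qed

lemma Hi_row: "0 < K_mu p q Hi $ 1 $ j"
  using p q exhaust_2[of j] by auto

lemma link: "h x y = F x y $ 1"
  by (simp add: F_def)

lemma lower_bound:
  assumes "0 < x" "x < 1"
  shows "\<exists>c>0. \<forall>t. 0 < t \<longrightarrow> t \<le> 1 \<longrightarrow> c * t powr (gmin / ln r) \<le> h (x - t) (x + t)"
proof -
  note left = measure_lower_left[OF finite_measure_axioms sets_M link Hi_row pull_S0 p(1)]
  have "\<exists>c>0. \<forall>t. 0 < t \<longrightarrow> t \<le> 1 \<longrightarrow> c * t powr (gmin / ln r) \<le> h (x - t) (x + t)"
    if "0 < x" "r ^ (n + 2) \<le> 1 - x" for n x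
    using that
  proof (induction n arbitrary: x)
    case 0
    then show ?case using r_square by (intro left) (auto simp: power2_eq_square)
  next
    case (Suc n)
    show ?case
    proof (cases "x \<le> r")
      case True then show ?thesis using Suc.prems by (intro left)
    next
      case False
      define y where "y = (x - r\<^sup>2) / r"
      have y0: "0 < y" using False r_pos r_square r_bounds by (simp add: y_def)
      have "r ^ (n + 2) \<le> 1 - y"
      proof -
        have "1 - y = (1 - x) / r" using r_pos r_square by (simp add: y_def field_simps)
        moreover have "r * r ^ (n + 2) \<le> 1 - x" using Suc.prems(2) by (simp only: add_Suc power_Suc)
        ultimately show ?thesis using r_pos by (simp add: pos_le_divide_eq mult.commute)
      qed
      note y = this
      have pull: "q * h (y - t / r) (y + t / r) \<le> h (x - t) (x + t)" for t
      proof -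
        have "(x - t - r\<^sup>2) / r = y - t / r" "(x + t - r\<^sup>2) / r = y + t / r"
          using r_pos by (simp_all add: y_def field_simps)
        then show ?thesis using h_rec[of "x - t" "x + t"] p by simp
      qed
      have "0 < q" using q by simp
      then show ?thesis
        by (rule lower_bound_transfer[OF finite_measure_axioms sets_M _ pull Suc.IH[OF y0 y]])
    qed
  qed
  note * = this
  obtain n where "r ^ n < 1 - x" using real_arch_pow_inv[of "1 - x" r] assms r_less_1 by auto
  moreover have "r ^ (n + 2) \<le> r ^ n" using r_pos r_less_1 by (intro power_decreasing) auto
  ultimately have "r ^ (n + 2) \<le> 1 - x" by linarith
  then show ?thesis using * assms(1) by blast
qed

lemma local_dims_mu:
  "local_dims M = {gmax / ln r..gmin / ln r} \<union> {ln p / ln r, ln q / ln r}"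
proof -
  obtain C where C: "0 < C"
    "\<And>x t. \<lbrakk>0 < t; t \<le> 1\<rbrakk> \<Longrightarrow> h (x - t) (x + t) \<le> C * t powr (gmax / ln r)"
    using upper_bound by blast
  show ?thesis
    by (rule local_dims_interval[OF finite_measure_axioms sets_M link Hi_row C lower_bound
          has_local_dim_0 has_local_dim_1])
qed


lemma pq_less: "p < q" "p * q < q\<^sup>2" "p\<^sup>2 < p * q"
  using p q by (auto simp: power2_eq_square)

subsection \<open>Growth rates for $\mu$\<close>

text \<open>
  The lower right entries of the matrices never fall below \<open>(p * q) powr (len l /
  2)\<close>, which bounds the rate of every product from below. The word \<open>Lo ...
  Lo\<close> attains it, since \<open>p * q\<close> is the larger eigenvalue of \<open>K_mu p q
  Lo\<close>.\<close>

lemma gmin_mu: "gmin = ln (p * q) / 2"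
proof (rule antisym)
  define v :: "real^2" where "v = vector [q / (q - p), 1]"
  have v: "v $ 1 = q / (q - p)" "v $ 2 = 1" by (simp_all add: v_def)
  show "gmin \<le> ln (p * q) / 2"
  proof (rule gmin_le_row[of v "[Lo]"])
    show "0 < v $ j" for j using pq_less q exhaust_2[of j] v by auto
    have "p\<^sup>2 * (q / (q - p)) + p * q = p * q * (q / (q - p))"
      using pq_less by (simp add: field_simps power2_eq_square)
    then show "(v v* KW [Lo]) $ j \<le> exp (ln (p * q) / 2 * L [Lo]) * v $ j" for j
      using exhaust_2[of j] pq_pos by (auto simp: vector_matrix_2 v mult.commute)
  qed simp
next
  define v :: "real^2" where "v = vector [0, 1]"
  have v: "v $ 1 = 0" "v $ 2 = 1" by (simp_all add: v_def)
  show "ln (p * q) / 2 \<le> gmin"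
  proof (rule gmin_ge_row[of v 2])
    show "0 \<le> v $ j" for j using exhaust_2[of j] v by auto
    have "sqrt (p * q) \<le> q"
      using pq_less pq_pos by (intro real_le_lsqrt) auto
    then have "p * q * sqrt (p * q) \<le> p * q * q"
      using pq_pos by (intro mult_left_mono) auto
    then show "exp (ln (p * q) / 2 * real (len l)) * v $ j \<le> (v v* K_mu p q l) $ j" for l j
      using exhaust_2[of j] pq_pos pq_less(2) exp_slope[of "p * q"]
      by (cases l) (auto simp: vector_matrix_2 v less_imp_le)
  qed (simp add: v)
qed

text \<open>
  The word \<open>Hi ... Hi\<close> describes intervals shrinking to a right end point, with
  eigenvalue $q^2$.\<close>

lemma ln_q_le_gmax: "ln q \<le> gmax"
proof -
  define v :: "real^2" where "v = vector [0, 1]"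
  have v: "v $ 1 = 0" "v $ 2 = 1" by (simp_all add: v_def)
  show ?thesis
  proof (rule gmax_ge_row[of v 2 "[Hi]"])
    show "0 \<le> v $ j" for j using exhaust_2[of j] v by auto
    show "exp (ln q * L [Hi]) * v $ j \<le> (v v* KW [Hi]) $ j" for j
      using exhaust_2[of j] exp_slope[of q] pq_pos by (auto simp: vector_matrix_2 v)
  qed (auto simp: v)
qed

text \<open>
  The row sums of the three matrices are at most $q^2$, $q^3$ and $q^2$ as soon as $2p \le q$.\<close>

lemma gmax_le_ln_q:
  assumes "p \<le> 1 / 3" shows "gmax \<le> ln q"
proof (rule gmax_le_col)
  have pq2: "2 * p \<le> q" using assms pq by linarith
  have a: "p\<^sup>2 \<le> q\<^sup>2" "2 * (p * q) \<le> q\<^sup>2" "2 * (p * q * q) \<le> q ^ 3" "2 * (p * q * p) \<le> q ^ 3"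
  proof -
    show "p\<^sup>2 \<le> q\<^sup>2" using pq_less pq_pos by (intro power_mono) auto
    have "2 * p * q \<le> q * q" using pq2 pq_pos by (intro mult_right_mono) auto
    then show 1: "2 * (p * q) \<le> q\<^sup>2" by (simp add: power2_eq_square)
    then have "2 * (p * q) * q \<le> q\<^sup>2 * q" using pq_pos by (intro mult_right_mono) auto
    then show 2: "2 * (p * q * q) \<le> q ^ 3" by (simp add: power2_eq_square power3_eq_cube)
    have "p * q * p \<le> p * q * q" using pq_less pq_pos by (intro mult_left_mono) auto
    then show "2 * (p * q * p) \<le> q ^ 3" using 2 by linarith
  qed
  then show "(K_mu p q l *v (\<chi> i. 1)) $ i \<le> exp (ln q * real (len l))" for l i
    using exhaust_2[of i] exp_slope[of q] pq_pos by (cases l) (auto simp: matrix_vector_2 mult_ac)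
qed

text \<open>
  For $q \le 2p$ the largest row sum of \<open>K_mu p q Lo\<close> and of \<open>K_mu p q
  Hi\<close> is $2pq$, and those of \<open>K_mu p q Mid\<close> are at most $(2pq)^{3/2}$.\<close>

lemma gmax_le_half_ln:
  assumes "1 / 3 \<le> p" shows "gmax \<le> ln (2 * p * q) / 2"
proof (rule gmax_le_col)
  have pq2: "q \<le> 2 * p" using assms pq by linarith
  have pos: "0 < 2 * p * q" using pq_pos by simp
  have sq: "q\<^sup>2 \<le> 2 * p * q" using pq2 pq_pos by (simp add: power2_eq_square)
  then have "q \<le> sqrt (2 * p * q)" by (rule real_le_rsqrt)
  then have a: "2 * p * q * q \<le> 2 * p * q * sqrt (2 * p * q)"
    using pos by (intro mult_left_mono) auto
  have "p * q * p \<le> p * q * q" using pq_less pq_pos by (intro mult_left_mono) auto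
  then have b: "2 * p * q * p \<le> 2 * p * q * sqrt (2 * p * q)" using a by linarith
  have c: "p\<^sup>2 \<le> 2 * p * q" using pq_less pq_pos by linarith
  show "(K_mu p q l *v (\<chi> i. 1)) $ i \<le> exp (ln (2 * p * q) / 2 * real (len l))" for l i
    using exhaust_2[of i] exp_slope[OF pos] sq a b c
    by (cases l) (auto simp: matrix_vector_2 mult_ac simp del: len.simps)
qed

text \<open>
  The matrix of \<open>Mid\<close> has rank one, so \<open>(1, 1)\<close> is an exact
  eigenvector of the product along \<open>Hi ... Hi Mid\<close>. With \<open>n\<close> letters
  \<open>Hi\<close> its eigenvalue is at least $p q^{2n+2}$ times a partial sum of the geometric
  series of $p/q$. The series sums to $q/(q-p)$, which exceeds $q/p$ exactly when $p > 1/3$, and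
  then the eigenvalue exceeds $q^{2n+3}$.\<close>

lemma ln_q_less_gmax:
  assumes "1 / 3 < p" shows "ln q < gmax"
proof -
  define v :: "real^2" where "v = vector [1, 1]"
  have v: "v $ j = 1" for j using exhaust_2[of j] by (auto simp: v_def)
  have c: "0 \<le> p / q" "p / q < 1" using pq_less pq_pos by auto
  have powers: "(v v* KW (replicate n Hi)) $ 1 = (p * q) ^ n \<and>
      (v v* KW (replicate n Hi)) $ 2 = q ^ (2 * n) * (\<Sum>i<Suc n. (p / q) ^ i)" for n
  proof (induction n)
    case (Suc n)
    have "KW (replicate (Suc n) Hi) = KW (replicate n Hi) ** K_mu p q Hi"
      using KW_append[of "replicate n Hi" "[Hi]"]
      by (simp only: replicate_append_same replicate_Suc) simp
    then have "v v* KW (replicate (Suc n) Hi) = (v v* KW (replicate n Hi)) v* K_mu p q Hi"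
      by (simp add: vector_matrix_mul_assoc del: replicate_Suc)
    moreover have "(p * q) ^ Suc n = q ^ (2 * Suc n) * (p / q) ^ Suc n"
    proof -
      have "q\<^sup>2 * (p / q) = p * q" using pq_pos by (simp add: power2_eq_square)
      then show ?thesis unfolding power_mult by (metis power_mult_distrib)
    qed
    ultimately show ?case using Suc
      by (simp add: vector_matrix_2 algebra_simps power2_eq_square del: replicate_Suc)
  qed (simp add: v)
  have "(\<lambda>n. \<Sum>i<n. (p / q) ^ i) \<longlonglongrightarrow> 1 / (1 - p / q)"
    using geometric_sums[of "p / q"] c by (simp add: sums_def)
  moreover have "q / p < 1 / (1 - p / q)"
  proof -
    have "q - p < p" using assms pq by linarith
    then have "q * (q - p) < q * p" using pq_pos by (intro mult_strict_left_mono) auto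
    then show ?thesis using pq_pos pq_less by (simp add: field_simps)
  qed
  ultimately have "eventually (\<lambda>n. q / p < (\<Sum>i<n. (p / q) ^ i)) sequentially"
    by (rule order_tendstoD)
  then obtain n where "\<And>m. n \<le> m \<Longrightarrow> q / p < (\<Sum>i<m. (p / q) ^ i)"
    unfolding eventually_sequentially by blast
  then have n: "q / p < (\<Sum>i<Suc n. (p / q) ^ i)" by (meson le_SucI order_refl)
  define w where "w = replicate n Hi @ [Mid]"
  define th where "th = p * q * (p * (p * q) ^ n + q * (q ^ (2 * n) * (\<Sum>i<Suc n. (p / q) ^ i)))"
  have row: "(v v* KW w) $ j = th" for j
  proof -
    have "v v* KW w = (v v* KW (replicate n Hi)) v* K_mu p q Mid"
      unfolding w_def KW_append by (simp add: vector_matrix_mul_assoc)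
    then show ?thesis using powers[of n] exhaust_2[of j]
      by (auto simp: vector_matrix_2 th_def algebra_simps)
  qed
  have "q ^ (2 * n + 3) = p * q * (q * (q ^ (2 * n) * (q / p)))"
    using pq_pos by (simp add: power_add power3_eq_cube)
  also have "\<dots> < p * q * (q * (q ^ (2 * n) * (\<Sum>i<Suc n. (p / q) ^ i)))"
    using pq_pos n by (intro mult_strict_left_mono) auto
  also have "\<dots> \<le> th" unfolding th_def using pq_pos by (intro mult_left_mono) auto
  finally have th: "q ^ (2 * n + 3) < th" .
  then have th0: "0 < th" using pq_pos by (meson less_trans zero_less_power)
  define g where "g = ln th / L w"
  have Lw: "L w = 2 * n + 3" by (simp add: w_def)
  have "g \<le> gmax"
  proof (rule gmax_ge_row[of v 1 w])
    show "exp (g * L w) * v $ j \<le> (v v* KW w) $ j" for j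
      unfolding row v using th0 Lw by (simp add: g_def)
  qed (auto simp: v w_def)
  moreover have "ln q < g"
  proof -
    have "real (2 * n + 3) * ln q = ln (q ^ (2 * n + 3))" using pq_pos by (simp add: ln_realpow)
    also have "\<dots> < ln th" using th th0 pq_pos by simp
    finally show ?thesis unfolding g_def Lw by (simp add: field_simps)
  qed
  ultimately show ?thesis by simp
qed

text \<open>
  The growth rate of the word \<open>Lo Hi Lo Hi ...\<close>. With $z = pq$, the product of the
  two matrices has trace $z(1-z)$ and determinant $z^4$, and \<open>s\<close> below is its
  larger eigenvalue, with the left eigenvector \<open>(1, x)\<close>.\<close>

lemma gmax_ge_Lo_Hi:
  "ln (p * q / 2 * (1 - p * q + sqrt ((1 + p * q) * (1 - 3 * (p * q))))) / 4 \<le> gmax"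
proof -
  define z where "z = p * q"
  have z0: "0 < z" using pq_pos by (simp add: z_def)
  have sq: "p\<^sup>2 + q\<^sup>2 = 1 - 2 * z"
  proof -
    have "(p + q)\<^sup>2 = 1" using pq by simp
    then show ?thesis by (simp add: z_def power2_sum)
  qed
  have z4: "4 * z < 1"
  proof -
    have "0 < (q - p)\<^sup>2" using pq_less by simp
    then show ?thesis using sq by (simp add: z_def power2_diff mult_ac)
  qed
  define D where "D = sqrt ((1 + z) * (1 - 3 * z))"
  have D0: "0 \<le> D" using z0 z4 by (simp add: D_def)
  have DD: "D * D = (1 + z) * (1 - 3 * z)" using z0 z4 by (simp add: D_def)
  define s where "s = z / 2 * (1 - z + D)"
  have s0: "0 < s" using z0 z4 D0 unfolding s_def by (intro mult_pos_pos) auto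
  have s2: "2 * s = z * (1 - z + D)" by (simp add: s_def)
  have char: "s * s - z * (1 - z) * s + z * z * z * z = 0"
  proof -
    have "4 * (s * s - z * (1 - z) * s + z * z * z * z)
        = (2 * s) * (2 * s) - 2 * (z * (1 - z)) * (2 * s) + 4 * (z * z * z * z)"
      by (simp add: algebra_simps)
    also have "\<dots> = z * z * (D * D - (1 - z) * (1 - z) + 4 * z * z)"
      unfolding s2 by (simp add: algebra_simps)
    also have "\<dots> = 0" unfolding DD by (simp add: algebra_simps)
    finally show ?thesis by simp
  qed
  have sp: "p\<^sup>2 * z \<le> s"
  proof -
    have "2 * p\<^sup>2 \<le> 1 - z" using sq pq_less z0 unfolding z_def by simp
    then have "z / 2 * (2 * p\<^sup>2) \<le> z / 2 * (1 - z + D)" using z0 D0 by (intro mult_left_mono) auto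
    then show ?thesis by (simp add: s_def mult.commute)
  qed
  define x where "x = (s - p\<^sup>2 * z) / z\<^sup>2"
  define v :: "real^2" where "v = vector [1, x]"
  have v: "v $ 1 = 1" "v $ 2 = x" by (simp_all add: v_def)
  have x0: "0 \<le> x" using sp by (simp add: x_def)
  have xz: "x * z\<^sup>2 = s - p\<^sup>2 * z" using z0 by (simp add: x_def)
  have KW: "KW [Lo, Hi] = K_mu p q Lo ** K_mu p q Hi" by simp
  have r1: "(v v* KW [Lo, Hi]) $ 1 = p\<^sup>2 * z + x * z\<^sup>2"
    and r2: "(v v* KW [Lo, Hi]) $ 2 = p\<^sup>2 * z + x * (z\<^sup>2 + z * q\<^sup>2)"
    unfolding KW vector_matrix_mul_assoc[symmetric]
    by (simp_all add: vector_matrix_2 v z_def algebra_simps power2_eq_square)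
  have e1: "p\<^sup>2 * z + x * z\<^sup>2 = s" using xz by simp
  have e2: "p\<^sup>2 * z + x * (z\<^sup>2 + z * q\<^sup>2) = s * x"
  proof -
    have pz: "p\<^sup>2 * q\<^sup>2 = z * z" by (simp add: z_def power2_eq_square)
    have "z\<^sup>2 * (p\<^sup>2 * z + x * (z\<^sup>2 + z * q\<^sup>2) - s * x)
        = z\<^sup>2 * (p\<^sup>2 * z) + (x * z\<^sup>2) * (z\<^sup>2 + z * q\<^sup>2) - s * (x * z\<^sup>2)"
      by (simp add: algebra_simps)
    also have "\<dots> = - (s * s) + z * (p\<^sup>2 + q\<^sup>2 + z) * s - z * z * (p\<^sup>2 * q\<^sup>2)"
      unfolding xz by (simp add: algebra_simps power2_eq_square)
    also have "\<dots> = - (s * s - z * (1 - z) * s + z * z * z * z)"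
      unfolding sq pz by (simp add: algebra_simps)
    finally show ?thesis using z0 char by simp
  qed
  have "ln s / 4 \<le> gmax"
  proof (rule gmax_ge_row[of v 1 "[Lo, Hi]"])
    show "0 \<le> v $ j" for j using x0 v exhaust_2[of j] by auto
    have "exp (ln s / 4 * L [Lo, Hi]) = s" using s0 by simp
    then show "exp (ln s / 4 * L [Lo, Hi]) * v $ j \<le> (v v* KW [Lo, Hi]) $ j" for j
      using exhaust_2[of j] r1 r2 e1 e2 v by auto
  qed (auto simp: v)
  then show ?thesis unfolding s_def D_def z_def .
qed

end

section \<open>The measure $\nu$\<close>

text \<open>
  The state of an interval $[x,y] \subseteq [0,r]$ is the pair of the masses of $[x,y]$ and of
  its mirror image $[r-y,r-x]$, since \<open>R1\<close> reverses orientation.\<close>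

fun K_nu :: "real \<Rightarrow> real \<Rightarrow> letter \<Rightarrow> real^2^2" where
  "K_nu p q Lo = vector [vector [p\<^sup>2, 0], vector [p * q, q\<^sup>2]]"
| "K_nu p q Mid = vector [vector [p * q * q, p * q * p], vector [p * q * p, p * q * q]]"
| "K_nu p q Hi = vector [vector [q\<^sup>2, p * q], vector [0, p\<^sup>2]]"

locale nu_measure = self_similar_measure M p q R1 for M p q
begin

lemma h_rec: "h x y = p * h (x / r) (y / r) + q * h ((1 - y) / r) ((1 - x) / r)"
  using h_self_similar[of x y] by (simp add: vimage_R1)

lemma no_atoms: "measure M {0} = 0" "measure M {1} = 0"
proof -
  have out: "h (1 / r) (1 / r) = 0"
    using r_pos r_less_1 by (auto intro!: null_outside simp: field_simps)
  then have "h 0 0 = p * h 0 0" using h_rec[of 0 0] by simp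
  then have "(1 - p) * h 0 0 = 0" by (simp add: algebra_simps)
  then show zero: "measure M {0} = 0" using p by auto
  show "measure M {1} = 0" using h_rec[of 1 1] out zero by simp
qed

lemmas h_zero = h_null[OF no_atoms]

lemma one_minus_r_times:
  assumes "y \<le> r" shows "1 \<le> (1 - r * y) / r"
proof -
  have "r * y \<le> r * r" using assms r_pos by simp
  then have "r \<le> 1 - r * y" using r_square unfolding power2_eq_square by linarith
  then show ?thesis using r_pos by (simp add: pos_le_divide_eq)
qed

lemma h_left: "y \<le> r \<Longrightarrow> h (r * x) (r * y) = p * h x y"
  using h_rec[of "r * x" "r * y"] h_zero one_minus_r_times[of y] r_pos by simp

lemma h_right: "y \<le> r \<Longrightarrow> h (1 - r * y) (1 - r * x) = q * h x y"
  using h_rec[of "1 - r * y" "1 - r * x"] h_zero one_minus_r_times[of y] r_pos by simp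

text \<open>
  The overlap $[r^2,r]$ is the image of $[0,r]$ both under \<open>S0\<close> after
  \<open>R1\<close> and under \<open>R1\<close> after \<open>R1\<close>. The two maps differ by
  the reflection of $[0,r]$.\<close>

lemma h_middle:
  assumes "0 \<le> x" "y \<le> r"
  shows "h (r\<^sup>2 + r\<^sup>2 * x) (r\<^sup>2 + r\<^sup>2 * y) = q\<^sup>2 * h x y + p * q * h (r - y) (r - x)"
proof -
  have "(1 - (r\<^sup>2 + r\<^sup>2 * z)) / r = 1 - r * z" for z
  proof -
    have "1 - (r\<^sup>2 + r\<^sup>2 * z) = r * (1 - r * z)" using r_square by (simp add: algebra_simps power2_eq_square)
    then show ?thesis using r_pos by simp
  qed
  moreover have "(r\<^sup>2 + r\<^sup>2 * z) / r = 1 - r * (r - z)" for z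
  proof -
    have "(r\<^sup>2 + r\<^sup>2 * z) / r = r + r * z" using r_pos by (simp add: power2_eq_square field_simps)
    also have "\<dots> = 1 - r * (r - z)" using r_square by (simp add: algebra_simps power2_eq_square)
    finally show ?thesis .
  qed
  ultimately show ?thesis
    using h_rec[of "r\<^sup>2 + r\<^sup>2 * x" "r\<^sup>2 + r\<^sup>2 * y"] h_right[OF assms(2), of x] h_right[of "r - x" "r - y"] assms
    by (simp add: power2_eq_square[of q])
qed

definition F :: "real \<Rightarrow> real \<Rightarrow> real^2" where
  "F x y = vector [h x y, h (r - y) (r - x)]"

lemma F_tile_nu:
  assumes "0 \<le> x" "x \<le> y" "y \<le> r"
  shows "F (T l x) (T l y) = K_nu p q l *v F x y"
proof (cases l)
  case Lo
  have e: "r\<^sup>2 * z = r * (r * z)" "r - r\<^sup>2 * z = r\<^sup>2 + r\<^sup>2 * (r - z)" for z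
    using r_square r_cube by (simp_all add: power2_eq_square power3_eq_cube algebra_simps)
  have "r * y \<le> r" using assms r_pos r_less_1 by (simp add: mult_left_le)
  then have "h (r\<^sup>2 * x) (r\<^sup>2 * y) = p * (p * h x y)"
    unfolding e(1) using h_left assms by simp
  moreover have "h (r - r\<^sup>2 * y) (r - r\<^sup>2 * x) = q\<^sup>2 * h (r - y) (r - x) + p * q * h x y"
    unfolding e(2) using h_middle[of "r - y" "r - x"] assms by simp
  ultimately show ?thesis using Lo
    by (simp add: vec_eq_2 matrix_vector_2 F_def power2_eq_square[of p])
next
  case Mid
  have e: "r ^ 3 + r ^ 3 * z = r * (r\<^sup>2 + r\<^sup>2 * z)"
      "r - (r ^ 3 + r ^ 3 * z) = r * (r\<^sup>2 + r\<^sup>2 * (r - z))" for z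
    using r_square r_cube r_power_4
    by (simp_all add: power2_eq_square power3_eq_cube power4_eq_xxxx algebra_simps)
  have le: "r\<^sup>2 + r\<^sup>2 * z \<le> r" if "z \<le> r" for z
  proof -
    have "r\<^sup>2 + r\<^sup>2 * z \<le> r\<^sup>2 + r\<^sup>2 * r" using that by (intro add_left_mono mult_left_mono) auto
    also have "\<dots> = r" using r_square r_cube by (simp add: power2_eq_square power3_eq_cube)
    finally show ?thesis .
  qed
  have "h (r ^ 3 + r ^ 3 * x) (r ^ 3 + r ^ 3 * y) = p * (q\<^sup>2 * h x y + p * q * h (r - y) (r - x))"
    unfolding e(1) using h_left[OF le] h_middle assms by simp
  moreover have "h (r - (r ^ 3 + r ^ 3 * y)) (r - (r ^ 3 + r ^ 3 * x))
      = p * (q\<^sup>2 * h (r - y) (r - x) + p * q * h x y)"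
    unfolding e(2) using h_left[OF le] h_middle[of "r - y" "r - x"] assms by simp
  ultimately show ?thesis using Mid
    by (simp add: vec_eq_2 matrix_vector_2 F_def algebra_simps power2_eq_square)
next
  case Hi
  have e: "r - (r\<^sup>2 + r\<^sup>2 * z) = r * (r * (r - z))" for z
    using r_square r_cube by (simp_all add: power2_eq_square power3_eq_cube algebra_simps)
  have "r * (r - x) \<le> r" using assms r_pos r_less_1 mult_left_le[of "r - x" r] by simp
  then have "h (r - (r\<^sup>2 + r\<^sup>2 * y)) (r - (r\<^sup>2 + r\<^sup>2 * x)) = p * (p * h (r - y) (r - x))"
    unfolding e using h_left assms by simp
  then show ?thesis using Hi h_middle[of x y] assms
    by (simp add: vec_eq_2 matrix_vector_2 F_def power2_eq_square[of p])
qed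

lemma h_0_r_pos: "0 < h 0 r"
proof -
  have "h 0 r \<ge> p * h 0 1" using h_rec[of 0 r] r_pos q by simp
  then show "0 < h 0 r" using h_unit p by simp
qed

sublocale cascade "K_nu p q" F
proof
  have pq0: "0 < p" "0 < q" using p q by auto
  show "nonneg (K_nu p q l)" for l using pq0 by (cases l) (auto simp: forall_2)
  show "0 < K_nu p q Mid $ i $ j" for i j using pq0 exhaust_2[of i] exhaust_2[of j] by auto
  show "\<exists>i. 0 < K_nu p q l $ i $ j" for l j
    using pq0 exhaust_2[of j] by (intro exI[of _ "if l = Hi then 1 else 2"], cases l) auto
  show "F (T l x) (T l y) = K_nu p q l *v F x y" if "0 \<le> x" "x \<le> y" "y \<le> r" for x y l
    using F_tile_nu that by blast
  show "F x y $ i \<le> F x' y' $ i" if "0 \<le> x'" "x' \<le> x" "x \<le> y" "y \<le> y'" "y' \<le> r" for x' x y y' i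
    using that exhaust_2[of i] by (auto simp: F_def intro!: h_mono)
  show "F x z $ i \<le> F x y $ i + F y z $ i" for x y z i
    using exhaust_2[of i] h_split[of x z y] h_split[of "r - z" "r - x" "r - y"] by (auto simp: F_def)
  show "0 < F 0 r $ i" for i
    using exhaust_2[of i] h_0_r_pos by (auto simp: F_def)
qed

lemma h_around_0: "t \<le> r \<Longrightarrow> h (- (r * t)) (r * t) = p * h (- t) t"
  using h_left[of t "- t"] by simp

lemma h_around_1: "t \<le> r \<Longrightarrow> h (1 - r * t) (1 + r * t) = q * h (- t) t"
  using h_right[of t "- t"] by simp

lemma has_local_dim_0: "has_local_dim M 0 (ln p / ln r)"
proof (rule two_sided_local_dim)
  fix t assume t: "0 < t" "t \<le> r\<^sup>2"
  then have "t \<le> r" using r_square r_bounds by linarith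
  then show "h (0 - r * t) (0 + r * t) = p * h (0 - t) (0 + t)" using h_around_0[of t] by simp
next
  have "h 0 r \<le> h (- r) r" using r_pos by (intro h_mono) auto
  then show "0 < h (0 - r\<^sup>2) (0 + r\<^sup>2)"
    using h_around_0[of r] h_0_r_pos p by (simp add: power2_eq_square)
qed (rule p)

lemma has_local_dim_1: "has_local_dim M 1 (ln p / ln r)"
proof (rule two_sided_local_dim)
  fix t assume t: "0 < t" "t \<le> r\<^sup>2"
  define s where "s = t / r"
  have s: "t = r * s" "s \<le> r" "t \<le> r"
    using t r_pos r_square r_bounds by (auto simp: s_def pos_divide_le_eq power2_eq_square)
  show "h (1 - r * t) (1 + r * t) = p * h (1 - t) (1 + t)"
    using h_around_1[OF s(3)] h_around_1[OF s(2)] h_around_0[OF s(2)] by (simp add: s(1))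
next
  have "h 0 r \<le> h (- r) r" using r_pos by (intro h_mono) auto
  then show "0 < h (1 - r\<^sup>2) (1 + r\<^sup>2)"
    using h_around_1[of r] h_0_r_pos q by (simp add: power2_eq_square)
qed (rule p)

lemma upper_bound:
  obtains C where "0 < C"
    "\<And>x t. \<lbrakk>0 < t; t \<le> 1\<rbrakk> \<Longrightarrow> h (x - t) (x + t) \<le> C * t powr (gmax / ln r)"
proof -
  obtain C where C: "0 < C" "\<And>x y t i. \<lbrakk>0 \<le> x; x \<le> y; y \<le> r; y - x \<le> 4 * t; 0 < t; t \<le> 1\<rbrakk>
      \<Longrightarrow> F x y $ i \<le> C * t powr (gmax / ln r)" using F_upper by blast
  show ?thesis
  proof (rule that[of "2 * C"])
    fix x t :: real assume t: "0 < t" "t \<le> 1"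
    have left: "h a b \<le> C * t powr (gmax / ln r)" if "0 \<le> a" "a \<le> b" "b \<le> r" "b - a \<le> 4 * t" for a b
      using C(2)[OF that t, of 1] by (simp add: F_def)
    have right: "h a b \<le> C * t powr (gmax / ln r)" if "r \<le> a" "a \<le> b" "b \<le> 1" "b - a \<le> 2 * t" for a b
    proof -
      define a' where "a' = (1 - b) / r"
      define b' where "b' = (1 - a) / r"
      have ab: "a = 1 - r * b'" "b = 1 - r * a'" using r_pos by (simp_all add: a'_def b'_def)
      have b': "b' \<le> r" using that r_pos r_square by (simp add: b'_def pos_divide_le_eq power2_eq_square)
      have "b' - a' = (b - a) / r" by (simp add: a'_def b'_def diff_divide_distrib)
      also have "\<dots> \<le> 4 * t"
      proof -
        have "1 / 2 * (4 * t) \<le> r * (4 * t)" using r_bounds t by (intro mult_right_mono) auto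
        then have "b - a \<le> r * (4 * t)" using that(4) by simp
        then show ?thesis using r_pos by (simp add: pos_divide_le_eq mult.commute)
      qed
      finally have "h a' b' \<le> C * t powr (gmax / ln r)"
        using that b' r_pos by (intro left) (auto simp: a'_def b'_def divide_right_mono)
      moreover have "h a b = q * h a' b'" unfolding ab by (rule h_right[OF b'])
      moreover have "q * h a' b' \<le> 1 * h a' b'" using q by (intro mult_right_mono) auto
      ultimately show ?thesis by linarith
    qed
    have "h (x - t) (x + t) \<le> 2 * (C * t powr (gmax / ln r))"
    proof (rule ball_le_two_halves[OF left right t(1)])
      show "b - a \<le> 4 * t" if "b - a \<le> 2 * t" for a b using that t by linarith
    qed (use C(1) in simp_all)
    then show "h (x - t) (x + t) \<le> 2 * C * t powr (gmax / ln r)" by simp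
  qed (use C in simp)
qed

lemma Hi_row: "0 < K_nu p q Hi $ 1 $ j"
  using p q exhaust_2[of j] by auto

lemma link: "h x y = F x y $ 1"
  by (simp add: F_def)

lemma lower_bound:
  assumes "0 < x" "x < 1"
  shows "\<exists>c>0. \<forall>t. 0 < t \<longrightarrow> t \<le> 1 \<longrightarrow> c * t powr (gmin / ln r) \<le> h (x - t) (x + t)"
proof -
  note left = measure_lower_left[OF finite_measure_axioms sets_M link Hi_row pull_S0 p(1)]
  show ?thesis
  proof (cases "x \<le> r")
    case True then show ?thesis using assms by (intro left)
  next
    case False
    define y where "y = (1 - x) / r"
    have "0 < y" "y \<le> r"
      using False assms r_pos r_square by (simp_all add: y_def pos_divide_le_eq power2_eq_square)
    note y = left[OF this]
    have pull: "q * h (y - t / r) (y + t / r) \<le> h (x - t) (x + t)" for t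
    proof -
      have "(1 - (x + t)) / r = y - t / r" "(1 - (x - t)) / r = y + t / r"
        using r_pos by (simp_all add: y_def field_simps)
      then show ?thesis using h_rec[of "x - t" "x + t"] p by simp
    qed
    have "0 < q" using q by simp
    then show ?thesis
      by (rule lower_bound_transfer[OF finite_measure_axioms sets_M _ pull y])
  qed
qed

lemma local_dims_nu:
  "local_dims M = {gmax / ln r..gmin / ln r} \<union> {ln p / ln r}"
proof -
  obtain C where C: "0 < C"
    "\<And>x t. \<lbrakk>0 < t; t \<le> 1\<rbrakk> \<Longrightarrow> h (x - t) (x + t) \<le> C * t powr (gmax / ln r)"
    using upper_bound by blast
  have "local_dims M = {gmax / ln r..gmin / ln r} \<union> {ln p / ln r, ln p / ln r}"
    by (rule local_dims_interval[OF finite_measure_axioms sets_M link Hi_row C lower_bound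
          has_local_dim_0 has_local_dim_1])
  then show ?thesis by simp
qed

lemma pq_less: "p < q"
  using p q by simp

subsection \<open>Growth rates for $\nu$\<close>

text \<open>
  The matrix of \<open>Lo\<close> is triangular with larger eigenvalue $q^2$, so the word
  \<open>Lo ... Lo\<close> has the rate \<open>ln q\<close>, which therefore lies between the
  extreme rates.\<close>

lemma gmax_gmin_q: "gmin \<le> ln q" "ln q \<le> gmax"
proof -
  define v :: "real^2" where "v = vector [p * q / (q - p), 1]"
  have v: "v $ 1 = p * q / (q - p)" "v $ 2 = 1" by (simp_all add: v_def)
  show "gmin \<le> ln q"
  proof (rule gmin_le_row[of v "[Lo]"])
    show "0 < v $ j" for j using pq_less pq_pos exhaust_2[of j] v by auto
    have "p * q = (q\<^sup>2 - p\<^sup>2) * (p * q / (q - p))"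
    proof -
      have "q\<^sup>2 - p\<^sup>2 = q - p" using pq by (simp add: square_diff_square_factored power2_eq_square add.commute)
      then show ?thesis using pq_less by simp
    qed
    then have "p\<^sup>2 * (p * q / (q - p)) + p * q = q\<^sup>2 * (p * q / (q - p))"
      by (simp add: algebra_simps)
    then show "(v v* KW [Lo]) $ j \<le> exp (ln q * L [Lo]) * v $ j" for j
      using exhaust_2[of j] exp_slope[of q] pq_pos by (auto simp: vector_matrix_2 v mult.commute)
  qed simp
next
  define v :: "real^2" where "v = vector [0, 1]"
  have v: "v $ 1 = 0" "v $ 2 = 1" by (simp_all add: v_def)
  show "ln q \<le> gmax"
  proof (rule gmax_ge_row[of v 2 "[Lo]"])
    show "0 \<le> v $ j" for j using exhaust_2[of j] v by auto
    show "exp (ln q * L [Lo]) * v $ j \<le> (v v* KW [Lo]) $ j" for j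
      using exhaust_2[of j] exp_slope[of q] pq_pos by (auto simp: vector_matrix_2 v)
  qed (auto simp: v)
qed

lemma ones_row:
  "((\<chi> i. 1) v* K_nu p q Lo) $ 1 = p" "((\<chi> i. 1) v* K_nu p q Lo) $ 2 = q\<^sup>2"
  "((\<chi> i. 1) v* K_nu p q Mid) $ j = p * q"
  "((\<chi> i. 1) v* K_nu p q Hi) $ 1 = q\<^sup>2" "((\<chi> i. 1) v* K_nu p q Hi) $ 2 = p"
proof -
  have "p\<^sup>2 + p * q = p * (p + q)" "p * q + p\<^sup>2 = p * (p + q)" "p * q * q + p * q * p = p * q * (p + q)"
    "p * q * p + p * q * q = p * q * (p + q)"
    by (simp_all add: algebra_simps power2_eq_square)
  then show
    "((\<chi> i. 1) v* K_nu p q Lo) $ 1 = p" "((\<chi> i. 1) v* K_nu p q Lo) $ 2 = q\<^sup>2"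
    "((\<chi> i. 1) v* K_nu p q Mid) $ j = p * q"
    "((\<chi> i. 1) v* K_nu p q Hi) $ 1 = q\<^sup>2" "((\<chi> i. 1) v* K_nu p q Hi) $ 2 = p"
    using exhaust_2[of j] pq by (auto simp: vector_matrix_2)
qed

text \<open>
  By \<open>ones_row\<close> the entries of \<open>(1, 1)\<close> grow per unit of length by
  $\sqrt p$ or by \<open>q\<close> under \<open>Lo\<close> and \<open>Hi\<close>, and by a
  geometric mean of the two under \<open>Mid\<close>. The comparison of \<open>p\<close> with
  $q^2$ therefore decides which of the two bounds is the upper one. It amounts to comparing
  \<open>p\<close> with $r^2$, because $p = 1 - q$ and $r^2 = 1 - r$.\<close>

lemma slopes_small:
  assumes "p \<le> q\<^sup>2" shows "gmax \<le> ln q" "ln p / 2 \<le> gmin"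
proof -
  have "p * q \<le> q\<^sup>2 * q" using assms pq_pos by (intro mult_right_mono) auto
  then have a: "p * q \<le> q ^ 3" by (simp add: power2_eq_square power3_eq_cube)
  have "sqrt p \<le> q" using assms pq_pos by (intro real_le_lsqrt) auto
  then have b: "p * sqrt p \<le> p * q" using pq_pos by simp
  show "gmax \<le> ln q"
  proof (rule gmax_le_row[of "\<chi> i. 1"])
    show "((\<chi> i. 1) v* K_nu p q l) $ j \<le> exp (ln q * real (len l)) * (\<chi> i. 1) $ j" for l j
      using exhaust_2[of j] ones_row exp_slope[of q] assms pq_pos a by (cases l) (auto simp del: K_nu.simps)
  qed simp
  show "ln p / 2 \<le> gmin"
  proof (rule gmin_ge_row[of "\<chi> i. 1" 1])
    show "exp (ln p / 2 * real (len l)) * (\<chi> i. 1) $ j \<le> ((\<chi> i. 1) v* K_nu p q l) $ j" for l j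
      using exhaust_2[of j] ones_row exp_slope[of p] assms pq_pos b
      by (cases l) (auto simp del: K_nu.simps len.simps)
  qed simp_all
qed

lemma slopes_large:
  assumes "q\<^sup>2 \<le> p" shows "gmax \<le> ln p / 2" "ln q \<le> gmin"
proof -
  have "q\<^sup>2 * q \<le> p * q" using assms pq_pos by (intro mult_right_mono) auto
  then have a: "q ^ 3 \<le> p * q" by (simp add: power2_eq_square power3_eq_cube)
  have "q \<le> sqrt p" using assms by (rule real_le_rsqrt)
  then have b: "p * q \<le> p * sqrt p" using pq_pos by simp
  show "gmax \<le> ln p / 2"
  proof (rule gmax_le_row[of "\<chi> i. 1"])
    show "((\<chi> i. 1) v* K_nu p q l) $ j \<le> exp (ln p / 2 * real (len l)) * (\<chi> i. 1) $ j" for l j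
      using exhaust_2[of j] ones_row exp_slope[of p] assms pq_pos b
      by (cases l) (auto simp del: K_nu.simps len.simps)
  qed simp
  show "ln q \<le> gmin"
  proof (rule gmin_ge_row[of "\<chi> i. 1" 1])
    show "exp (ln q * real (len l)) * (\<chi> i. 1) $ j \<le> ((\<chi> i. 1) v* K_nu p q l) $ j" for l j
      using exhaust_2[of j] ones_row exp_slope[of q] assms pq_pos a
      by (cases l) (auto simp del: K_nu.simps len.simps)
  qed simp_all
qed

text \<open>
  The word \<open>Lo Hi Lo Hi ...\<close>. The product of the two matrices has the eigenvalue
  $(pq/r)^2$, with the positive left eigenvector \<open>(1, p / (q * r))\<close>, so its rate is
  attained exactly and bounds both extreme rates.\<close>

lemma slopes_Lo_Hi: "gmin \<le> ln (p * q / r) / 2" "ln (p * q / r) / 2 \<le> gmax"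
proof -
  define x where "x = p / (q * r)"
  define v :: "real^2" where "v = vector [1, x]"
  have v: "v $ 1 = 1" "v $ 2 = x" by (simp_all add: v_def)
  have x0: "0 < x" using pq_pos r_pos by (simp add: x_def)
  have KW: "KW [Lo, Hi] = K_nu p q Lo ** K_nu p q Hi" by simp
  define s where "s = (p * q / r)\<^sup>2"
  have s: "exp (ln (p * q / r) / 2 * L [Lo, Hi]) = s"
    using exp_slope(4)[of "p * q / r"] pq_pos r_pos by (simp add: s_def mult.commute)
  have r1: "1 + 1 / r = 1 / r\<^sup>2" "1 + 2 / r = 1 / r ^ 3"
  proof -
    have i: "1 / r = 1 + r" using r_square r_pos by (simp add: field_simps power2_eq_square)
    have "1 / r\<^sup>2 = (1 / r) * (1 / r)" "1 / r ^ 3 = (1 / r) * (1 / r) * (1 / r)"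
      by (simp_all add: power2_eq_square power3_eq_cube)
    moreover have "(1 + r) * (1 + r) = 2 + r" "(2 + r) * (1 + r) = 3 + 2 * r"
      using r_square by (simp_all add: power2_eq_square algebra_simps)
    moreover have "2 / r = 2 * (1 / r)" by simp
    ultimately show "1 + 1 / r = 1 / r\<^sup>2" "1 + 2 / r = 1 / r ^ 3" unfolding i by simp_all
  qed
  have xq: "x * q = p / r" using pq_pos by (simp add: x_def)
  have "(v v* KW [Lo, Hi]) $ 1 = p\<^sup>2 * q\<^sup>2 + (x * q) * (p * q\<^sup>2)"
    unfolding KW vector_matrix_mul_assoc[symmetric]
    by (simp add: vector_matrix_2 v algebra_simps power2_eq_square)
  also have "\<dots> = p\<^sup>2 * q\<^sup>2 * (1 + 1 / r)"
    unfolding xq by (simp add: algebra_simps power2_eq_square)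
  also have "\<dots> = s" unfolding r1 by (simp add: s_def power_divide power_mult_distrib)
  finally have e1: "(v v* KW [Lo, Hi]) $ 1 = s" .
  have "(v v* KW [Lo, Hi]) $ 2 = p ^ 3 * q + 2 * (x * q) * (p\<^sup>2 * q)"
    unfolding KW vector_matrix_mul_assoc[symmetric]
    by (simp add: vector_matrix_2 v algebra_simps power2_eq_square power3_eq_cube)
  also have "\<dots> = p ^ 3 * q * (1 + 2 / r)"
    unfolding xq by (simp add: algebra_simps power2_eq_square power3_eq_cube)
  also have "\<dots> = s * x" unfolding r1 using pq_pos
    by (simp add: s_def x_def power_divide power_mult_distrib power2_eq_square power3_eq_cube mult_ac)
  finally have e2: "(v v* KW [Lo, Hi]) $ 2 = s * x" .
  show "gmin \<le> ln (p * q / r) / 2"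
  proof (rule gmin_le_row[of v "[Lo, Hi]"])
    show "0 < v $ j" for j using x0 v exhaust_2[of j] by auto
    show "(v v* KW [Lo, Hi]) $ j \<le> exp (ln (p * q / r) / 2 * L [Lo, Hi]) * v $ j" for j
      unfolding s using exhaust_2[of j] e1 e2 v by auto
  qed simp
  show "ln (p * q / r) / 2 \<le> gmax"
  proof (rule gmax_ge_row[of v 1 "[Lo, Hi]"])
    show "0 \<le> v $ j" for j using x0 v exhaust_2[of j] by auto
    show "exp (ln (p * q / r) / 2 * L [Lo, Hi]) * v $ j \<le> (v v* KW [Lo, Hi]) $ j" for j
      unfolding s using exhaust_2[of j] e1 e2 v by auto
  qed (auto simp: v)
qed

end

section \<open>The absolutely continuous case\<close>

text \<open>The integral of the density from the left.\<close>

definition nu_cdf :: "real \<Rightarrow> real" where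
  "nu_cdf x = (if x \<le> 0 then 0 else if x \<le> r then x\<^sup>2 / r
     else if x \<le> 1 then 1 - (1 - x)\<^sup>2 / r\<^sup>2 else 1)"

text \<open>
  The functional equation of the distribution function of a self-similar measure with weights
  $r^2$ and \<open>r\<close> under \<open>S0\<close> and \<open>R1\<close>. On the overlap both
  terms are quadratic, and their sum collapses because $r^2 + r = 1$.\<close>

lemma nu_cdf_self_similar:
  assumes "0 < x" "x < 1"
  shows "nu_cdf x = r\<^sup>2 * nu_cdf (x / r) + r * (1 - nu_cdf ((1 - x) / r))"
proof -
  have r0: "r \<noteq> 0" using r_pos by simp
  have upper: "nu_cdf y = 1 - (1 - y)\<^sup>2 / r\<^sup>2" if "r \<le> y" "y \<le> 1" for y
  proof (cases "y = r")
    case True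
    have "r\<^sup>2 / r = r" using r0 by (simp add: power2_eq_square)
    moreover have "(1 - r)\<^sup>2 / r\<^sup>2 = r\<^sup>2" using r0 by (simp add: power2_eq_square flip: r_square)
    ultimately show ?thesis using True r_pos r_square by (simp add: nu_cdf_def)
  qed (use that r_pos in \<open>simp add: nu_cdf_def\<close>)
  have lower: "nu_cdf y = y\<^sup>2 / r" if "0 \<le> y" "y \<le> r" for y
    using that by (simp add: nu_cdf_def)
  have one: "nu_cdf y = 1" if "1 \<le> y" for y
    using that r_less_1 by (auto simp: nu_cdf_def)
  consider "x \<le> r\<^sup>2" | "r\<^sup>2 \<le> x" "x \<le> r" | "r \<le> x" by linarith
  then show ?thesis
  proof cases
    case 1
    then have a: "x / r \<le> r" "1 \<le> (1 - x) / r" "0 \<le> x / r"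
      using assms r_pos r_square by (simp_all add: pos_divide_le_eq pos_le_divide_eq power2_eq_square)
    have "x \<le> r" using 1 r_square r_bounds by linarith
    then show ?thesis using lower[of x] lower[OF a(3,1)] one[OF a(2)] assms r0
      by (simp add: power_divide)
  next
    case 2
    then have a: "r \<le> x / r" "x / r \<le> 1" "r \<le> (1 - x) / r" "(1 - x) / r \<le> 1"
      using assms r_pos r_square by (simp_all add: pos_divide_le_eq pos_le_divide_eq power2_eq_square)
    have e: "1 - x / r = (r - x) / r" "1 - (1 - x) / r = (x - r\<^sup>2) / r"
      using r0 r_square by (simp_all add: field_simps)
    have "r\<^sup>2 * nu_cdf (x / r) + r * (1 - nu_cdf ((1 - x) / r))
        = r\<^sup>2 * (1 - ((r - x) / r)\<^sup>2 / r\<^sup>2) + r * (((x - r\<^sup>2) / r)\<^sup>2 / r\<^sup>2)"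
      using upper[OF a(1,2)] upper[OF a(3,4)] unfolding e by simp
    also have "\<dots> = (r ^ 5 - r * (r - x)\<^sup>2 + (x - r\<^sup>2)\<^sup>2) / r ^ 3"
      using r0 by (simp add: field_simps eval_nat_numeral)
    also have "r ^ 5 - r * (r - x)\<^sup>2 + (x - r\<^sup>2)\<^sup>2 = r\<^sup>2 * x\<^sup>2"
    proof -
      have "r ^ 5 - r * (r - x)\<^sup>2 + (x - r\<^sup>2)\<^sup>2 = (1 - r) * x\<^sup>2 + r ^ 3 * (r\<^sup>2 + r - 1)"
        by (simp add: algebra_simps eval_nat_numeral)
      then show ?thesis using r_square by simp
    qed
    also have "r\<^sup>2 * x\<^sup>2 / r ^ 3 = x\<^sup>2 / r" using r0 by (simp add: field_simps eval_nat_numeral)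
    finally show ?thesis using lower[of x] 2 assms by simp
  next
    case 3
    then have a: "1 \<le> x / r" "0 \<le> (1 - x) / r" "(1 - x) / r \<le> r"
      using assms r_pos r_square by (simp_all add: pos_divide_le_eq pos_le_divide_eq power2_eq_square)
    have "r\<^sup>2 * nu_cdf (x / r) + r * (1 - nu_cdf ((1 - x) / r)) = r\<^sup>2 + r - (1 - x)\<^sup>2 / r\<^sup>2"
      using one[OF a(1)] lower[OF a(2,3)] r0 by (simp add: power_divide right_diff_distrib)
    then show ?thesis using upper[of x] 3 assms r_square by simp
  qed
qed

lemma nu_cdf_bounds: "0 \<le> nu_cdf x" "nu_cdf x \<le> 1"
proof -
  have "x\<^sup>2 / r \<le> 1" if "0 \<le> x" "x \<le> r"
  proof -
    have "x\<^sup>2 \<le> r\<^sup>2" using that by (intro power_mono)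
    also have "\<dots> \<le> r" using r_square r_bounds by linarith
    finally show ?thesis using r_pos by simp
  qed
  moreover have "(1 - x)\<^sup>2 / r\<^sup>2 \<le> 1" if "r \<le> x" "x \<le> 1"
  proof -
    have "1 - x \<le> r" using that r_bounds by linarith
    then have "(1 - x)\<^sup>2 \<le> r\<^sup>2" using that by (intro power_mono) auto
    then show ?thesis using r_pos by simp
  qed
  ultimately show "0 \<le> nu_cdf x" "nu_cdf x \<le> 1"
    using r_pos by (auto simp: nu_cdf_def)
qed

lemma nu_density_borel [measurable]: "nu_density \<in> borel_measurable borel"
  unfolding nu_density_def[abs_def] by measurable

lemma nu_density_cdf:
  "emeasure (density lborel (\<lambda>x. ennreal (nu_density x))) {..x} = ennreal (nu_cdf x)"
proof -
  have left: "(\<integral>\<^sup>+y. ennreal (2 * y / r) * indicator {0..b} y \<partial>lborel) = ennreal (b\<^sup>2 / r)"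
    if "0 \<le> b" for b
    by (subst nn_integral_FTC_Icc[where F = "\<lambda>y. y\<^sup>2 / r"])
       (use that r_pos in \<open>auto intro!: derivative_eq_intros\<close>)
  have right: "(\<integral>\<^sup>+y. ennreal (2 * (1 - y) / r\<^sup>2) * indicator {r..b} y \<partial>lborel)
      = ennreal ((1 - r)\<^sup>2 / r\<^sup>2 - (1 - b)\<^sup>2 / r\<^sup>2)" if "r \<le> b" "b \<le> 1" for b
    by (subst nn_integral_FTC_Icc[where F = "\<lambda>y. - ((1 - y)\<^sup>2 / r\<^sup>2)"])
       (use that r_pos in \<open>auto intro!: derivative_eq_intros simp: field_simps\<close>)
  have eq: "emeasure (density lborel (\<lambda>x. ennreal (nu_density x))) {..x}
      = (\<integral>\<^sup>+y. ennreal (nu_density y) * indicator {..x} y \<partial>lborel)"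
    by (intro emeasure_density) auto
  consider "x \<le> 0" | "0 < x" "x \<le> r" | "r < x" by linarith
  then show ?thesis
  proof cases
    case 1
    then have fn: "(\<lambda>y. ennreal (nu_density y) * indicator {..x} y) = (\<lambda>_. 0)"
      using r_pos by (intro ext) (auto simp: nu_density_def indicator_def)
    show ?thesis unfolding eq fn using 1 by (simp add: nu_cdf_def)
  next
    case 2
    then have fn: "(\<lambda>y. ennreal (nu_density y) * indicator {..x} y)
        = (\<lambda>y. ennreal (2 * y / r) * indicator {0..x} y)"
      using r_pos by (intro ext) (auto simp: nu_density_def indicator_def)
    show ?thesis unfolding eq fn using 2 left[of x] by (simp add: nu_cdf_def)
  next
    case 3
    have x1: "r \<le> min x 1" "min x 1 \<le> 1" using 3 r_less_1 by auto
    have "(\<integral>\<^sup>+y. ennreal (nu_density y) * indicator {..x} y \<partial>lborel)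
        = (\<integral>\<^sup>+y. ennreal (2 * y / r) * indicator {0..r} y
            + ennreal (2 * (1 - y) / r\<^sup>2) * indicator {r..min x 1} y \<partial>lborel)"
    proof (rule nn_integral_cong_AE)
      show "AE y in lborel. ennreal (nu_density y) * indicator {..x} y
          = ennreal (2 * y / r) * indicator {0..r} y
            + ennreal (2 * (1 - y) / r\<^sup>2) * indicator {r..min x 1} y"
        using AE_lborel_singleton[of r]
      \<comment> \<open>At \<open>y = r\<close> the sum counts the density twice.\<close>
      proof eventually_elim
        case (elim y)
        then show ?case using 3 r_pos
          by (auto simp: nu_density_def indicator_def)
      qed
    qed
    also have "\<dots> = ennreal (r\<^sup>2 / r) + ennreal ((1 - r)\<^sup>2 / r\<^sup>2 - (1 - min x 1)\<^sup>2 / r\<^sup>2)"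
      using left[of r] right[OF x1] r_pos by (subst nn_integral_add) auto
    also have "\<dots> = ennreal (r\<^sup>2 / r + ((1 - r)\<^sup>2 / r\<^sup>2 - (1 - min x 1)\<^sup>2 / r\<^sup>2))"
    proof (rule ennreal_plus[symmetric])
      have "(1 - min x 1)\<^sup>2 \<le> (1 - r)\<^sup>2" using x1 by (intro power_mono) auto
      then show "0 \<le> (1 - r)\<^sup>2 / r\<^sup>2 - (1 - min x 1)\<^sup>2 / r\<^sup>2" by (simp add: divide_right_mono)
    qed (use r_pos in simp)
    also have "r\<^sup>2 / r + ((1 - r)\<^sup>2 / r\<^sup>2 - (1 - min x 1)\<^sup>2 / r\<^sup>2) = nu_cdf x"
    proof -
      have "r\<^sup>2 / r = r" "(1 - r)\<^sup>2 / r\<^sup>2 = r\<^sup>2"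
        using r_pos by (simp_all add: power2_eq_square flip: r_square)
      then show ?thesis using 3 r_pos r_square by (auto simp: nu_cdf_def min_def)
    qed
    finally show ?thesis unfolding eq .
  qed
qed

context nu_measure begin

text \<open>
  Both the distribution function of \<open>M\<close> and \<open>nu_cdf\<close> solve the
  functional equation. Their difference \<open>P\<close> vanishes outside $(0,1)$. Outside the
  overlap one of the two terms of the equation is therefore zero, and the other is contracted by
  at least \<open>r\<close>. On the overlap both terms are evaluated in $[r,1]$, where a second
  application contracts by \<open>r\<close>
  again, and the weights add up to 1. The flag \<open>e\<close> tells closed from open half-lines, which \<open>R1\<close>
  exchanges by reversing orientation.\<close>

lemma density_case:
  assumes pr: "p = r\<^sup>2" and qr: "q = r"
  shows "M = density lborel (\<lambda>x. ennreal (nu_density x))"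
proof -
  define W where "W = (\<lambda>e x::real. if e then {..x} else {..<x})"
  define N where "N = (\<lambda>e x. measure M (W e x))"
  define P where "P = (\<lambda>e x. N e x - nu_cdf x)"
  have W_sets [simp]: "W e x \<in> sets borel" for e x by (simp add: W_def)
  have N_range: "0 \<le> N e x" "N e x \<le> 1" for e x by (simp_all add: N_def)
  have spaceM: "space M = UNIV" using sets_eq_imp_space_eq[OF sets_M] by simp
  have N_low: "N e x = 0" if "x \<le> 0" for e x
  proof -
    have "N e x \<le> measure M ({0} \<union> {..<0})"
      unfolding N_def using that by (intro finite_measure_mono) (auto simp: W_def split: if_splits)
    also have "\<dots> \<le> measure M {0} + measure M {..<0}" by (intro measure_Un_le) simp_all
    also have "measure M {..<0} = 0" by (intro null_outside) auto
    finally show ?thesis using no_atoms N_range(1)[of e x] by simp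
  qed
  have N_compl: "measure M (- W e x) = 1 - N e x" for e x
    using prob_compl[of "W e x"] by (simp add: N_def spaceM Compl_eq_Diff_UNIV)
  have N_high: "N e x = 1" if "1 \<le> x" for e x
  proof -
    have "measure M (- W e x) \<le> measure M ({1} \<union> {1<..})"
      using that by (intro finite_measure_mono) (auto simp: W_def split: if_splits)
    also have "\<dots> \<le> measure M {1} + measure M {1<..}" by (intro measure_Un_le) simp_all
    also have "measure M {1<..} = 0" by (intro null_outside) auto
    finally show ?thesis using no_atoms N_compl[of e x] N_range(2)[of e x] by simp
  qed
  have N_rec: "N e x = r\<^sup>2 * N e (x / r) + r * (1 - N (\<not> e) ((1 - x) / r))" for e x
  proof -
    have "S0 -` W e x = W e (x / r)"
      using r_pos by (auto simp: W_def S0_def pos_le_divide_eq pos_less_divide_eq mult.commute)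
    moreover have "R1 -` W e x = - W (\<not> e) ((1 - x) / r)"
    proof -
      have "1 - r * y \<le> x \<longleftrightarrow> \<not> y < (1 - x) / r" "1 - r * y < x \<longleftrightarrow> \<not> y \<le> (1 - x) / r" for y
        using r_pos by (auto simp: pos_le_divide_eq pos_less_divide_eq mult.commute)
      then show ?thesis by (auto simp: W_def R1_def)
    qed
    moreover have "measure M (W e x) = p * measure M (S0 -` W e x) + q * measure M (R1 -` W e x)"
      using self_similar W_sets unfolding self_similar_def by blast
    ultimately show ?thesis using N_compl[of "\<not> e" "(1 - x) / r"] by (simp add: N_def pr qr)
  qed
  have P_out: "P e x = 0" if "x \<le> 0 \<or> 1 \<le> x" for e x
    using that N_low N_high r_less_1 r_pos by (auto simp: P_def nu_cdf_def)
  have P_rec: "P e x = r\<^sup>2 * P e (x / r) - r * P (\<not> e) ((1 - x) / r)" if "0 < x" "x < 1" for e x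
    unfolding P_def by (subst N_rec, subst nu_cdf_self_similar[OF that]) (simp add: algebra_simps)
  have r01: "0 \<le> r" "r\<^sup>2 \<le> r" "r\<^sup>2 + r = 1" using r_square r_bounds by linarith+
  have P_small: "\<bar>P e x\<bar> \<le> r ^ n" for n e x
  proof (induction n arbitrary: e x)
    case 0
    then show ?case
      using N_range[of e x] nu_cdf_bounds[of x] by (simp add: P_def abs_le_iff)
  next
    case (Suc n)
    have right: "\<bar>P e x\<bar> \<le> r * r ^ n" if x: "r \<le> x" for e x
    proof (cases "x < 1")
      case True
      have "1 \<le> x / r" using x r_pos by (simp add: pos_le_divide_eq)
      then have "\<bar>P e x\<bar> = r * \<bar>P (\<not> e) ((1 - x) / r)\<bar>"
        using P_rec[of x e] True x r_pos by (simp add: P_out abs_mult)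
      then show ?thesis using Suc r01 by (simp add: mult_left_mono)
    qed (use P_out r_pos in simp)
    consider "x \<le> 0 \<or> 1 \<le> x" | "0 < x" "x \<le> r\<^sup>2" | "r\<^sup>2 < x" "x < r" | "r \<le> x" by linarith
    then show ?case
    proof cases
      case 1 then show ?thesis using P_out r_pos by simp
    next
      case 2
      have "1 \<le> (1 - x) / r" using 2 r_pos r_square by (simp add: pos_le_divide_eq)
      moreover have "x < 1" using 2 r_square r_pos by linarith
      ultimately have "\<bar>P e x\<bar> = r\<^sup>2 * \<bar>P e (x / r)\<bar>"
        using P_rec[of x e] 2 by (simp add: P_out abs_mult)
      also have "\<dots> \<le> r * r ^ n" using Suc r01 by (intro mult_mono) auto
      finally show ?thesis by simp
    next
      case 3
      have "r \<le> x / r" "r \<le> (1 - x) / r"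
        using 3 r_pos r_square by (simp_all add: pos_le_divide_eq power2_eq_square)
      then have "\<bar>P e (x / r)\<bar> \<le> r * r ^ n" "\<bar>P (\<not> e) ((1 - x) / r)\<bar> \<le> r * r ^ n"
        by (auto intro: right)
      then have "r\<^sup>2 * \<bar>P e (x / r)\<bar> + r * \<bar>P (\<not> e) ((1 - x) / r)\<bar> \<le> r\<^sup>2 * (r * r ^ n) + r * (r * r ^ n)"
        using r01 by (intro add_mono mult_left_mono) auto
      also have "\<dots> = (r\<^sup>2 + r) * (r * r ^ n)" by (simp add: algebra_simps)
      also have "\<dots> = r ^ Suc n" using r01 by simp
      finally have sum: "r\<^sup>2 * \<bar>P e (x / r)\<bar> + r * \<bar>P (\<not> e) ((1 - x) / r)\<bar> \<le> r ^ Suc n" .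
      have "0 < x" "x < 1" using 3 r_pos r_less_1 zero_le_power2[of r] by linarith+
      then have "\<bar>P e x\<bar> \<le> \<bar>r\<^sup>2 * P e (x / r)\<bar> + \<bar>r * P (\<not> e) ((1 - x) / r)\<bar>"
        using P_rec[of x e] by (simp add: abs_triangle_ineq4)
      then show ?thesis using sum r01 by (simp add: abs_mult)
    next
      case 4 then show ?thesis using right by simp
    qed
  qed
  have N_eq: "N e x = nu_cdf x" for e x
  proof -
    have "\<bar>P e x\<bar> \<le> 0"
    proof (rule LIMSEQ_le_const)
      show "(\<lambda>n. r ^ n) \<longlonglongrightarrow> 0" using r_pos r_less_1 by (intro LIMSEQ_realpow_zero) auto
    qed (use P_small in blast)
    then show ?thesis by (simp add: P_def)
  qed
  define D where "D = density lborel (\<lambda>x. ennreal (nu_density x))"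
  have D_cdf: "emeasure D {..x} = ennreal (nu_cdf x)" for x
    unfolding D_def by (rule nu_density_cdf)
  have setsD: "sets D = sets borel" by (simp add: D_def)
  have M_cdf: "emeasure M {..x} = ennreal (nu_cdf x)" for x
    using N_eq[of True x] by (simp add: N_def W_def emeasure_eq_measure)
  have "M = D"
  proof (rule measure_eqI_generator_eq[where \<Omega> = UNIV and E = "range (\<lambda>a::real. {..a})"
        and A = "\<lambda>n. {..real n}"])
    show "Int_stable (range (\<lambda>a::real. {..a}))"
      by (auto simp: Int_stable_def)
    show "emeasure M X = emeasure D X" if "X \<in> range (\<lambda>a::real. {..a})" for X
      using that by (auto simp: M_cdf D_cdf)
    show "sets M = sigma_sets UNIV (range (\<lambda>a::real. {..a}))"
        "sets D = sigma_sets UNIV (range (\<lambda>a::real. {..a}))"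
      unfolding setsD sets_M borel_eq_atMost by (simp_all add: sets_measure_of_conv)
    show "(\<Union>n. {..real n}) = (UNIV :: real set)"
      by (auto intro: real_arch_simple)
    show "emeasure M {..real n} \<noteq> \<infinity>" for n by (simp add: M_cdf)
  qed auto
  then show ?thesis by (simp add: D_def)
qed

end

section \<open>The spectra of local dimensions\<close>

lemma s_crit_bounds: "1 / 3 < s_crit" "s_crit < r\<^sup>2"
proof -
  have a: "115 / 32 < sqrt 13" by (rule real_less_rsqrt) (simp add: power2_eq_square)
  have b: "sqrt 13 < 22 / 6" by (rule real_less_lsqrt) (simp_all add: power2_eq_square)
  have "sqrt (6 * sqrt 13 - 21) < 1" using b by simp
  then show "1 / 3 < s_crit" unfolding s_crit_def by linarith
  have "3 / 4 < sqrt (6 * sqrt 13 - 21)"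
    by (rule real_less_rsqrt) (use a in \<open>simp add: power2_eq_square\<close>)
  then have "s_crit < 3 / 8" unfolding s_crit_def by linarith
  then show "s_crit < r\<^sup>2" using r_square r_bounds by linarith
qed

lemma divide_ln_r_le [simp]: "x / ln r \<le> y / ln r \<longleftrightarrow> y \<le> x"
  using ln_r_neg by (simp add: divide_le_cancel)

lemma divide_ln_r_less [simp]: "x / ln r < y / ln r \<longleftrightarrow> y < x"
  using ln_r_neg by (simp add: divide_less_cancel)

text \<open>
  Dividing by \<open>ln r < 0\<close> reverses all inequalities, so that \<open>gmax\<close>
  gives the left end points \<open>a\<close>, \<open>A\<close> and \<open>gmin\<close> the right
  end points \<open>b\<close>, \<open>B\<close>. The dimension of \<open>\<mu>\<close> at the
  point 1 is \<open>ln p1 / ln r\<close>, which lies in the interval already; the dimension at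
  0, and for \<open>\<nu>\<close> also at 1, is the extra value \<open>ln p0 / ln r\<close>.\<close>

theorem theorem5p1:
  fixes p0 p1 :: real and \<mu> \<nu> :: "real measure"
  assumes "0 < p0" and "p0 < 1 / 2" and "1 / 2 < p1" and "p0 + p1 = 1"
    and "self_similar p0 S0 p1 S1 \<mu>"
    and "self_similar p0 S0 p1 R1 \<nu>"
  shows "1 / 3 < s_crit \<and> s_crit < r_gold\<^sup>2 \<and>
    (\<exists>a b A B :: real. a \<le> b \<and> A \<le> B \<and>
      local_dims \<mu> = {a..b} \<union> {ln p0 / ln r_gold} \<and>
      local_dims \<nu> = {A..B} \<union> {ln p0 / ln r_gold} \<and>
      b = ln (p0 * p1) / (2 * ln r_gold) \<and>
      (p0 \<le> 1 / 3 \<longrightarrow> a = ln p1 / ln r_gold) \<and>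
      (1 / 3 < p0 \<and> p0 \<le> s_crit \<longrightarrow>
         ln (2 * p0 * p1) / (2 * ln r_gold) \<le> a \<and> a < ln p1 / ln r_gold) \<and>
      (s_crit < p0 \<longrightarrow>
         ln (2 * p0 * p1) / (2 * ln r_gold) \<le> a \<and>
         a \<le> ln (p0 * p1 / 2 *
                  (1 - p0 * p1 + sqrt ((1 + p0 * p1) * (1 - 3 * p0 * p1)))) / (4 * ln r_gold)) \<and>
      (p0 \<le> r_gold\<^sup>2 \<longrightarrow>
         A = ln p1 / ln r_gold \<and>
         ln (p0 * p1 / r_gold) / (2 * ln r_gold) \<le> B \<and> B \<le> ln p0 / (2 * ln r_gold)) \<and>
      (r_gold\<^sup>2 < p0 \<longrightarrow>
         ln p0 / (2 * ln r_gold) \<le> A \<and> A \<le> ln (p0 * p1 / r_gold) / (2 * ln r_gold) \<and>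
         B = ln p1 / ln r_gold) \<and>
      B < b \<and> a < b \<and>
      (1 / 3 < p0 \<and> p0 \<le> r_gold\<^sup>2 \<longrightarrow> a < A) \<and>
      (p0 \<le> 1 / 3 \<longrightarrow> a = A) \<and>
      (p0 \<noteq> r_gold\<^sup>2 \<longrightarrow> A < B) \<and>
      (p0 = r_gold\<^sup>2 \<longrightarrow>
         A = 1 \<and> B = 1 \<and> local_dims \<nu> = {1, 2} \<and>
         absolutely_continuous lborel \<nu> \<and>
         \<nu> = density lborel (\<lambda>x. ennreal (nu_density x))))"
proof -
  interpret mu: mu_measure \<mu> p0 p1 by unfold_locales (use assms in auto)
  interpret nu: nu_measure \<nu> p0 p1 by unfold_locales (use assms in auto)
  note pos = nu.pq_pos
  define a where "a = mu.gmax / ln r"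
  define b where "b = mu.gmin / ln r"
  define A where "A = nu.gmax / ln r"
  define B where "B = nu.gmin / ln r"
  have halves: "x / (2 * ln r) = (x / 2) / ln r" "x / (4 * ln r) = (x / 4) / ln r" for x
    by simp_all
  have ln_pq: "ln (p0 * p1) / 2 < ln p1"
  proof -
    have "ln (p0 * p1) < ln (p1\<^sup>2)" using mu.pq_less(2) pos by simp
    then show ?thesis using pos by (simp add: ln_realpow)
  qed
  have mu_min: "mu.gmin < ln p1" using ln_pq by (simp add: mu.gmin_mu)
  have ln_p: "ln (p0 * p1) < ln p0" using pos assms by (simp add: mult_less_cancel_left2)
  have p1_iff: "p0 \<le> r\<^sup>2 \<longleftrightarrow> r \<le> p1" "p0 = r\<^sup>2 \<longleftrightarrow> p1 = r"
    using r_square assms by auto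
  have small: "p0 \<le> p1\<^sup>2" if "p0 \<le> r\<^sup>2"
  proof -
    have "r\<^sup>2 \<le> p1\<^sup>2" using that p1_iff r_pos by (intro power_mono) auto
    then show ?thesis using that by linarith
  qed
  have large: "p1\<^sup>2 \<le> p0" if "r\<^sup>2 \<le> p0"
  proof -
    have "p1 \<le> r" using that r_square assms by linarith
    then have "p1\<^sup>2 \<le> r\<^sup>2" using pos by (intro power_mono) auto
    then show ?thesis using that by linarith
  qed
  note nu_small = nu.slopes_small[OF small] and nu_large = nu.slopes_large[OF large]
  have nu_max: "nu.gmax = ln p1" if "p0 \<le> r\<^sup>2"
    using nu_small[OF that] nu.gmax_gmin_q by simp
  have nu_min: "nu.gmin = ln p1" if "r\<^sup>2 \<le> p0"
    using nu_large[OF that] nu.gmax_gmin_q by simp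
  have mu_a: "mu.gmax = ln p1" if "p0 \<le> 1 / 3"
    using mu.gmax_le_ln_q[OF that] mu.ln_q_le_gmax by simp
  have third: "1 / 3 < r\<^sup>2" using s_crit_bounds by linarith
  have local_mu: "local_dims \<mu> = {a..b} \<union> {ln p0 / ln r}"
  proof -
    have "ln p1 / ln r \<in> {a..b}" using mu.ln_q_le_gmax mu_min by (simp add: a_def b_def)
    then show ?thesis using mu.local_dims_mu by (auto simp: a_def b_def)
  qed
  have local_nu: "local_dims \<nu> = {A..B} \<union> {ln p0 / ln r}"
    using nu.local_dims_nu by (simp add: A_def B_def)
  have B_b: "B < b"
  proof (cases "p0 \<le> r\<^sup>2")
    case True
    then have "mu.gmin < nu.gmin" using nu_small(2) ln_p unfolding mu.gmin_mu by simp
    then show ?thesis by (simp add: B_def b_def)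
  next
    case False
    then show ?thesis using nu_min mu_min by (simp add: B_def b_def)
  qed
  have ln_quot: "p0 < r\<^sup>2 \<Longrightarrow> ln (p0 * p1 / r) / 2 < ln p1" "r\<^sup>2 < p0 \<Longrightarrow> ln p1 < ln (p0 * p1 / r) / 2"
  proof -
    have sq: "ln (p1\<^sup>2) = 2 * ln p1" using pos by (simp add: ln_realpow)
    have q0: "0 < p0 * p1 / r" using pos r_pos by simp
    show "ln (p0 * p1 / r) / 2 < ln p1" if "p0 < r\<^sup>2"
    proof -
      have "r < p1" using that r_square assms by linarith
      then have "r * r < p1 * r" using r_pos by simp
      then have "p0 < p1 * r" using that by (simp add: power2_eq_square)
      then have "p0 * p1 / r < p1\<^sup>2" using pos r_pos by (simp add: pos_divide_less_eq power2_eq_square)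
      then have "ln (p0 * p1 / r) < ln (p1\<^sup>2)" using q0 pos by (subst ln_less_cancel_iff) auto
      then show ?thesis using sq by simp
    qed
    show "ln p1 < ln (p0 * p1 / r) / 2" if "r\<^sup>2 < p0"
    proof -
      have "p1 < r" using that r_square assms by linarith
      then have "p1 * r < r * r" using r_pos by simp
      then have "p1 * r < p0" using that by (simp add: power2_eq_square)
      then have "p1\<^sup>2 < p0 * p1 / r" using pos r_pos by (simp add: pos_less_divide_eq power2_eq_square)
      then have "ln (p1\<^sup>2) < ln (p0 * p1 / r)" using q0 pos by (subst ln_less_cancel_iff) auto
      then show ?thesis using sq by simp
    qed
  qed
  have A_B: "A < B" if "p0 \<noteq> r\<^sup>2"
  proof (cases "p0 < r\<^sup>2")
    case True
    then show ?thesis using nu_max ln_quot(1) nu.slopes_Lo_Hi by (simp add: A_def B_def)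
  next
    case False
    then show ?thesis using that nu_min ln_quot(2) nu.slopes_Lo_Hi by (simp add: A_def B_def)
  qed
  have equal: "A = 1 \<and> B = 1 \<and> local_dims \<nu> = {1, 2} \<and> absolutely_continuous lborel \<nu> \<and>
      \<nu> = density lborel (\<lambda>x. ennreal (nu_density x))" if eq: "p0 = r\<^sup>2"
  proof -
    have p1: "p1 = r" using eq p1_iff by blast
    have AB: "A = 1" "B = 1" using nu_max nu_min eq p1 ln_r_neg by (simp_all add: A_def B_def)
    have "ln p0 / ln r = 2" using eq r_pos ln_r_neg by (simp add: ln_realpow)
    then have "local_dims \<nu> = {1, 2}" using local_nu AB by auto
    moreover have dens: "\<nu> = density lborel (\<lambda>x. ennreal (nu_density x))"
      by (rule nu.density_case[OF eq p1])
    moreover have "absolutely_continuous lborel \<nu>"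
      by (subst dens) (rule absolutely_continuousI_density, measurable)
    ultimately show ?thesis using AB by blast
  qed
  show ?thesis
  proof (intro conjI s_crit_bounds, rule exI[of _ a], rule exI[of _ b], rule exI[of _ A],
      rule exI[of _ B], intro conjI impI)
    show "a \<le> b" "A \<le> B" using mu.gmin_le_gmax nu.gmin_le_gmax by (simp_all add: a_def b_def A_def B_def)
    show "local_dims \<mu> = {a..b} \<union> {ln p0 / ln r}" by (rule local_mu)
    show "local_dims \<nu> = {A..B} \<union> {ln p0 / ln r}" by (rule local_nu)
    show "b = ln (p0 * p1) / (2 * ln r)" unfolding halves by (simp add: b_def mu.gmin_mu)
    show "a = ln p1 / ln r" if "p0 \<le> 1 / 3" using mu_a[OF that] by (simp add: a_def)
    show "ln (2 * p0 * p1) / (2 * ln r) \<le> a" if "1 / 3 < p0 \<and> p0 \<le> s_crit"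
      unfolding halves a_def divide_ln_r_le using mu.gmax_le_half_ln that by simp
    show "a < ln p1 / ln r" if "1 / 3 < p0 \<and> p0 \<le> s_crit"
      unfolding a_def using mu.ln_q_less_gmax that by simp
    show "ln (2 * p0 * p1) / (2 * ln r) \<le> a" if "s_crit < p0"
      unfolding halves a_def divide_ln_r_le using mu.gmax_le_half_ln that s_crit_bounds by simp
    show "a \<le> ln (p0 * p1 / 2 *
                  (1 - p0 * p1 + sqrt ((1 + p0 * p1) * (1 - 3 * p0 * p1)))) / (4 * ln r)"
      unfolding halves a_def divide_ln_r_le using mu.gmax_ge_Lo_Hi by (simp add: mult.assoc)
    show "A = ln p1 / ln r" if "p0 \<le> r\<^sup>2" using nu_max[OF that] by (simp add: A_def)
    show "ln (p0 * p1 / r) / (2 * ln r) \<le> B"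
      unfolding halves B_def divide_ln_r_le using nu.slopes_Lo_Hi by simp
    show "B \<le> ln p0 / (2 * ln r)" if "p0 \<le> r\<^sup>2"
      unfolding halves B_def divide_ln_r_le using nu_small(2)[OF that] by simp
    show "ln p0 / (2 * ln r) \<le> A" if "r\<^sup>2 < p0"
      unfolding halves A_def divide_ln_r_le using nu_large(1) that by simp
    show "A \<le> ln (p0 * p1 / r) / (2 * ln r)"
      unfolding halves A_def divide_ln_r_le using nu.slopes_Lo_Hi by simp
    show "B = ln p1 / ln r" if "r\<^sup>2 < p0" using nu_min that by (simp add: B_def)
    show "B < b" by (rule B_b)
    show "a < b" using mu_min mu.ln_q_le_gmax by (simp add: a_def b_def)
    show "a < A" if "1 / 3 < p0 \<and> p0 \<le> r\<^sup>2"
      using mu.ln_q_less_gmax nu_max that by (simp add: a_def A_def)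
    show "a = A" if "p0 \<le> 1 / 3"
      using mu_a nu_max that third by (simp add: a_def A_def)
    show "A < B" if "p0 \<noteq> r\<^sup>2" by (rule A_B[OF that])
  qed (use equal in blast)+
qed

end
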